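(* Let $c\in\{1,-1\}$ and let $f\colon M^n\to\mathbb{Q}^n_c\times\mathbb{R}$, $n\ge 2$, be a hypersurface having constant principal curvatures and $T$ as a principal direction, such that $\nu(p)\neq 0$ for all $p\in M^n$. Then $c=-1$ and $f$ is given locally by $f(x,s)=h_s(x)+Bs\,\partial/\partial t$ for some $B\in\mathbb{R}$, $B>0$, where $h_s$ is a family of horospheres in $\mathbb{H}^n$. Moreover, the principal curvature associated to the field $T$ is equal to $0$ and the other principal curvatures are all equal to $\dfrac{B}{\sqrt{1+B^2}}$ or all equal to $-\dfrac{B}{\sqrt{1+B^2}}$.
   Context: $\mathbb{Q}^n_c$ denotes the unit sphere $\mathbb{S}^n$ if $c=1$ and the hyperbolic space $\mathbb{H}^n$ (curvature $-1$) if $c=-1$. Let $\mathbb{E}^{n+2}$ be $\mathbb{R}^{n+2}$ with the flat metric $c\,dx_1^2+dx_2^2+\dots+dx_{n+2}^2$; then $\mathbb{Q}^n_c=\{x\in\mathbb{E}^{n+1}: cx_1^2+x_2^2+\dots+x_{n+1}^2=c\}$ (with $x_1>0$ if $c=-1$), $\mathbb{E}^{n+1}=\{x_{n+2}=0\}$, and $\mathbb{Q}^n_c\times\mathbb{R}\subset\mathbb{E}^{n+2}$. A hypersurface $f\colon M^n\to\mathbb{Q}^n_c\times\mathbb{R}$ is an isometric immersion of a (connected) Riemannian $n$-manifold with unit normal field $\eta$ and shape operator $A$; principal curvatures are the eigenvalues of $A$. With $\partial/\partial t$ the unit vector field tangent to the factor $\mathbb{R}$, the tangent vector field $T$ on $M^n$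 and the smooth function $\nu$ are defined by $\partial/\partial t=df(T)+\nu\eta$. "$T$ is a principal direction" means that $T$ is nowhere zero and is at every point an eigenvector of $A$. In the local description, $M^n$ is locally a product $M^{n-1}\times I$ with $I\subset\mathbb{R}$ an open interval, $(x,s)\in M^{n-1}\times I$, and the $h_s$ are a family of parallel hypersurfaces of $\mathbb{H}^n$, $h_s(x)=\cosh(s)\,h(x)+\sinh(s)\,N(x)$, with $h\colon M^{n-1}\to\mathbb{H}^n$ a hypersurface with unit normal field $N$, each $h_s$ being (an open part of) a horosphere. *)

theory Defs
  imports "HOL-Analysis.Analysis"
begin

section \<open>Smooth maps and smooth manifolds\<close>

text \<open>
  Class $C^k$ on an open set, by iterated directional derivatives.  Both predicates below are only
  meaningful, and only used, for open \<open>S\<close>.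
\<close>

primrec Ck_on :: "nat \<Rightarrow> 'a::real_normed_vector set \<Rightarrow> ('a \<Rightarrow> 'b::real_normed_vector) \<Rightarrow> bool" where
  "Ck_on 0 S f \<longleftrightarrow> continuous_on S f"
| "Ck_on (Suc k) S f \<longleftrightarrow>
     (\<forall>x\<in>S. f differentiable (at x)) \<and> (\<forall>v. Ck_on k S (\<lambda>x. frechet_derivative f (at x) v))"

definition smooth_on :: "'a::real_normed_vector set \<Rightarrow> ('a \<Rightarrow> 'b::real_normed_vector) \<Rightarrow> bool" where
  "smooth_on S f \<longleftrightarrow> (\<forall>k. Ck_on k S f)"

text \<open>
  A chart is a pair of its (open) domain and its coordinate map.  The manifold is the union of the
  chart domains, an open subset of a Hausdorff second countable space.
\<close>

type_synonym ('m, 'e) chart = "'m set \<times> ('m \<Rightarrow> 'e)"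

definition chart_image :: "('m, 'e) chart \<Rightarrow> 'e set" where
  "chart_image \<kappa> = snd \<kappa> ` fst \<kappa>"

definition chart_inv :: "('m, 'e) chart \<Rightarrow> 'e \<Rightarrow> 'm" where
  "chart_inv \<kappa> = inv_into (fst \<kappa>) (snd \<kappa>)"

definition smooth_atlas ::
  "('m::{t2_space, second_countable_topology}, 'e::euclidean_space) chart set \<Rightarrow> bool" where
  "smooth_atlas \<A> \<longleftrightarrow>
     (\<forall>\<kappa>\<in>\<A>. open (fst \<kappa>) \<and> open (chart_image \<kappa>) \<and>
        homeomorphism (fst \<kappa>) (chart_image \<kappa>) (snd \<kappa>) (chart_inv \<kappa>)) \<and>
     (\<forall>\<kappa>\<in>\<A>. \<forall>\<kappa>'\<in>\<A>. smooth_on (snd \<kappa> ` (fst \<kappa> \<inter> fst \<kappa>')) (snd \<kappa>' \<circ> chart_inv \<kappa>))"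

definition carrier_of :: "('m, 'e) chart set \<Rightarrow> 'm set" where
  "carrier_of \<A> = (\<Union>\<kappa>\<in>\<A>. fst \<kappa>)"

definition smooth_map ::
  "('m, 'e::euclidean_space) chart set \<Rightarrow> ('m \<Rightarrow> 'b::real_normed_vector) \<Rightarrow> bool" where
  "smooth_map \<A> f \<longleftrightarrow> (\<forall>\<kappa>\<in>\<A>. smooth_on (chart_image \<kappa>) (f \<circ> chart_inv \<kappa>))"

text \<open>
  A tangent vector at a point \<open>p\<close> is given by its coordinate vector \<open>v\<close> in a chart \<open>\<kappa>\<close> around \<open>p\<close>;
  \<open>mdiff \<kappa> f p v\<close> is the differential of \<open>f\<close> at \<open>p\<close> applied to it.
\<close>

definition mdiff ::
  "('m, 'e::euclidean_space) chart \<Rightarrow> ('m \<Rightarrow> 'b::real_normed_vector) \<Rightarrow> 'm \<Rightarrow> 'e \<Rightarrow> 'b" where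
  "mdiff \<kappa> f p v = frechet_derivative (f \<circ> chart_inv \<kappa>) (at (snd \<kappa> p)) v"

text \<open>
  \<open>g \<kappa> p v w\<close> is the inner product of the tangent vectors at \<open>p\<close> with coordinates \<open>v\<close>, \<open>w\<close> in the
  chart \<open>\<kappa>\<close>; the last clause says that the value does not depend on the chart.
\<close>

definition riemannian_metric ::
  "('m, 'e::euclidean_space) chart set \<Rightarrow> (('m, 'e) chart \<Rightarrow> 'm \<Rightarrow> 'e \<Rightarrow> 'e \<Rightarrow> real) \<Rightarrow> bool" where
  "riemannian_metric \<A> g \<longleftrightarrow>
     (\<forall>\<kappa>\<in>\<A>. \<forall>p\<in>fst \<kappa>. bilinear (g \<kappa> p) \<and> (\<forall>v w. g \<kappa> p v w = g \<kappa> p w v) \<and>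
        (\<forall>v. v \<noteq> 0 \<longrightarrow> g \<kappa> p v v > 0)) \<and>
     (\<forall>\<kappa>\<in>\<A>. \<forall>v w. smooth_on (chart_image \<kappa>) (\<lambda>u. g \<kappa> (chart_inv \<kappa> u) v w)) \<and>
     (\<forall>\<kappa>\<in>\<A>. \<forall>\<kappa>'\<in>\<A>. \<forall>p\<in>fst \<kappa> \<inter> fst \<kappa>'. \<forall>v w.
        g \<kappa> p v w = g \<kappa>' p (mdiff \<kappa> (snd \<kappa>') p v) (mdiff \<kappa> (snd \<kappa>') p w))"

definition diffeo_onto_open ::
  "('m::topological_space, 'e::euclidean_space) chart set \<Rightarrow> 'd::euclidean_space set \<Rightarrow> ('d \<Rightarrow> 'm)
     \<Rightarrow> bool" where
  "diffeo_onto_open \<A> D \<psi> \<longleftrightarrow>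
     open D \<and> open (\<psi> ` D) \<and> \<psi> ` D \<subseteq> carrier_of \<A> \<and>
     homeomorphism D (\<psi> ` D) \<psi> (inv_into D \<psi>) \<and>
     (\<forall>\<kappa>\<in>\<A>. smooth_on (D \<inter> \<psi> -` fst \<kappa>) (snd \<kappa> \<circ> \<psi>) \<and>
        smooth_on (snd \<kappa> ` (fst \<kappa> \<inter> \<psi> ` D)) (inv_into D \<psi> \<circ> chart_inv \<kappa>))"


section \<open>The ambient spaces\<close>

text \<open>
  With $n$ = \<open>CARD('n)\<close>, the type \<open>'n flat1\<close> is $\mathbb{E}^{n+1}$ and \<open>'n flat2\<close> is $\mathbb{E}^{n+2}$,
  the coordinates being grouped as $((x_1, (x_2,\dots,x_{n+1})), x_{n+2})$.
\<close>

type_synonym 'n flat1 = "real \<times> (real ^ 'n)"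
type_synonym 'n flat2 = "'n flat1 \<times> real"

definition ip1 :: "real \<Rightarrow> 'n::finite flat1 \<Rightarrow> 'n flat1 \<Rightarrow> real" where
  "ip1 c x y = c * fst x * fst y + snd x \<bullet> snd y"

definition ip2 :: "real \<Rightarrow> 'n::finite flat2 \<Rightarrow> 'n flat2 \<Rightarrow> real" where
  "ip2 c x y = ip1 c (fst x) (fst y) + snd x * snd y"

definition space_form :: "real \<Rightarrow> 'n::finite flat1 set" where
  "space_form c = {x. ip1 c x x = c \<and> (c = -1 \<longrightarrow> fst x > 0)}"

definition dt :: "'n::finite flat2" where
  "dt = (0, 1)"

text \<open>
  The vector \<open>(fst x, 0)\<close> is normal to $\mathbb{Q}^n_c \times \mathbb{R}$ at \<open>x\<close> and has square
  \<open>c = 1 / c\<close>, so this is the orthogonal projection onto the tangent space at \<open>x\<close>.  Composed with the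
  derivative in the flat space $\mathbb{E}^{n+2}$, it gives the Levi-Civita connection of
  $\mathbb{Q}^n_c \times \mathbb{R}$.
\<close>

definition tangent_proj :: "real \<Rightarrow> 'n::finite flat2 \<Rightarrow> 'n flat2 \<Rightarrow> 'n flat2" where
  "tangent_proj c x y = y - (c * ip2 c y (fst x, 0)) *\<^sub>R (fst x, 0)"


section \<open>Hypersurfaces of the product of a space form and the line\<close>

text \<open>The third group of conditions says that \<open>\<eta>\<close> is a smooth unit normal field along \<open>f\<close>.\<close>

definition hypersurface ::
  "real \<Rightarrow> ('m::{t2_space, second_countable_topology}, real ^ 'n::finite) chart set \<Rightarrow>
     (('m, real ^ 'n) chart \<Rightarrow> 'm \<Rightarrow> real ^ 'n \<Rightarrow> real ^ 'n \<Rightarrow> real) \<Rightarrow>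
     ('m \<Rightarrow> 'n flat2) \<Rightarrow> ('m \<Rightarrow> 'n flat2) \<Rightarrow> bool" where
  "hypersurface c \<A> g f \<eta> \<longleftrightarrow>
     (smooth_atlas \<A> \<and> carrier_of \<A> \<noteq> {} \<and> connected (carrier_of \<A>) \<and> riemannian_metric \<A> g) \<and>
     (smooth_map \<A> f \<and> f ` carrier_of \<A> \<subseteq> space_form c \<times> UNIV \<and>
       (\<forall>\<kappa>\<in>\<A>. \<forall>p\<in>fst \<kappa>. \<forall>v w. ip2 c (mdiff \<kappa> f p v) (mdiff \<kappa> f p w) = g \<kappa> p v w)) \<and>
     (smooth_map \<A> \<eta> \<and>
       (\<forall>p\<in>carrier_of \<A>. ip2 c (\<eta> p) (\<eta> p) = 1 \<and> ip2 c (\<eta> p) (fst (f p), 0) = 0) \<and>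
       (\<forall>\<kappa>\<in>\<A>. \<forall>p\<in>fst \<kappa>. \<forall>v. ip2 c (\<eta> p) (mdiff \<kappa> f p v) = 0))"

text \<open>\<open>df (A v) = - \<nabla>\<^sub>v \<eta>\<close>; the solution is unique because \<open>f\<close> is an immersion.\<close>

definition shape_operator ::
  "real \<Rightarrow> ('m, real ^ 'n::finite) chart \<Rightarrow> ('m \<Rightarrow> 'n flat2) \<Rightarrow> ('m \<Rightarrow> 'n flat2) \<Rightarrow> 'm \<Rightarrow>
     real ^ 'n \<Rightarrow> real ^ 'n" where
  "shape_operator c \<kappa> f \<eta> p v = (THE w. mdiff \<kappa> f p w = - tangent_proj c (f p) (mdiff \<kappa> \<eta> p v))"

definition principal_curvatures ::
  "real \<Rightarrow> ('m, real ^ 'n::finite) chart \<Rightarrow> ('m \<Rightarrow> 'n flat2) \<Rightarrow> ('m \<Rightarrow> 'n flat2) \<Rightarrow> 'm \<Rightarrow> real set" where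
  "principal_curvatures c \<kappa> f \<eta> p = {\<mu>. \<exists>v. v \<noteq> 0 \<and> shape_operator c \<kappa> f \<eta> p v = \<mu> *\<^sub>R v}"

definition constant_principal_curvatures ::
  "real \<Rightarrow> ('m, real ^ 'n::finite) chart set \<Rightarrow> ('m \<Rightarrow> 'n flat2) \<Rightarrow> ('m \<Rightarrow> 'n flat2) \<Rightarrow> bool" where
  "constant_principal_curvatures c \<A> f \<eta> \<longleftrightarrow>
     (\<exists>\<Lambda>. \<forall>\<kappa>\<in>\<A>. \<forall>p\<in>fst \<kappa>. principal_curvatures c \<kappa> f \<eta> p = \<Lambda>)"

definition principal_multiplicity ::
  "real \<Rightarrow> ('m, real ^ 'n::finite) chart \<Rightarrow> ('m \<Rightarrow> 'n flat2) \<Rightarrow> ('m \<Rightarrow> 'n flat2) \<Rightarrow> 'm \<Rightarrow> real \<Rightarrow> nat"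
  where
  "principal_multiplicity c \<kappa> f \<eta> p \<mu> = dim {v. shape_operator c \<kappa> f \<eta> p v = \<mu> *\<^sub>R v}"

text \<open>
  The function \<open>\<nu>\<close> and the tangent field \<open>T\<close> of the decomposition \<open>dt = df T + \<nu> \<eta>\<close>; taking the
  inner product with the unit normal \<open>\<eta>\<close> gives \<open>\<nu>\<close>.
\<close>

definition angle_fun :: "real \<Rightarrow> ('m \<Rightarrow> 'n::finite flat2) \<Rightarrow> 'm \<Rightarrow> real" where
  "angle_fun c \<eta> p = ip2 c dt (\<eta> p)"

definition T_field ::
  "real \<Rightarrow> ('m, real ^ 'n::finite) chart \<Rightarrow> ('m \<Rightarrow> 'n flat2) \<Rightarrow> ('m \<Rightarrow> 'n flat2) \<Rightarrow> 'm \<Rightarrow> real ^ 'n" where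
  "T_field c \<kappa> f \<eta> p = (THE w. dt = mdiff \<kappa> f p w + angle_fun c \<eta> p *\<^sub>R \<eta> p)"

definition T_principal_direction ::
  "real \<Rightarrow> ('m, real ^ 'n::finite) chart set \<Rightarrow> ('m \<Rightarrow> 'n flat2) \<Rightarrow> ('m \<Rightarrow> 'n flat2) \<Rightarrow> bool" where
  "T_principal_direction c \<A> f \<eta> \<longleftrightarrow>
     (\<forall>\<kappa>\<in>\<A>. \<forall>p\<in>fst \<kappa>. T_field c \<kappa> f \<eta> p \<noteq> 0 \<and>
        (\<exists>\<mu>. shape_operator c \<kappa> f \<eta> p (T_field c \<kappa> f \<eta> p) = \<mu> *\<^sub>R T_field c \<kappa> f \<eta> p))"


section \<open>Parallel horospheres in hyperbolic space\<close>

text \<open>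
  A hypersurface of hyperbolic space, parametrized by an open subset \<open>V\<close> of $\mathbb{R}^{n-1}$, with
  unit normal field \<open>N\<close>.
\<close>

definition hyperbolic_hypersurface ::
  "(real ^ 'k::finite) set \<Rightarrow> (real ^ 'k \<Rightarrow> 'n::finite flat1) \<Rightarrow> (real ^ 'k \<Rightarrow> 'n flat1) \<Rightarrow> bool" where
  "hyperbolic_hypersurface V h N \<longleftrightarrow>
     open V \<and> connected V \<and> smooth_on V h \<and> h ` V \<subseteq> space_form (-1) \<and>
     (\<forall>x\<in>V. inj (frechet_derivative h (at x))) \<and>
     smooth_on V N \<and>
     (\<forall>x\<in>V. ip1 (-1) (N x) (N x) = 1 \<and> ip1 (-1) (N x) (h x) = 0 \<and>
        (\<forall>v. ip1 (-1) (N x) (frechet_derivative h (at x) v) = 0))"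

definition parallel ::
  "(real ^ 'k::finite \<Rightarrow> 'n::finite flat1) \<Rightarrow> (real ^ 'k \<Rightarrow> 'n flat1) \<Rightarrow> real \<Rightarrow> real ^ 'k \<Rightarrow> 'n flat1" where
  "parallel h N s x = cosh s *\<^sub>R h x + sinh s *\<^sub>R N x"

text \<open>
  In the hyperboloid model the horospheres are the nonempty sections by affine hyperplanes whose
  Lorentz normal is lightlike.
\<close>

definition horosphere :: "'n::finite flat1 set \<Rightarrow> bool" where
  "horosphere H \<longleftrightarrow> H \<noteq> {} \<and>
     (\<exists>w a. w \<noteq> 0 \<and> ip1 (-1) w w = 0 \<and> H = {x \<in> space_form (-1). ip1 (-1) x w = a})"

text \<open>
  Differentiating shows that the unit normal field of \<open>parallel h N s\<close> is
  \<open>cosh s *\<^sub>R N x + sinh s *\<^sub>R h x\<close>, that is, \<open>parallel N h s\<close>.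
\<close>

definition parallel_horospheres ::
  "(real ^ 'k::finite) set \<Rightarrow> real set \<Rightarrow> (real ^ 'k \<Rightarrow> 'n::finite flat1) \<Rightarrow> (real ^ 'k \<Rightarrow> 'n flat1)
     \<Rightarrow> bool" where
  "parallel_horospheres V I h N \<longleftrightarrow>
     hyperbolic_hypersurface V h N \<and>
     (\<forall>s\<in>I. hyperbolic_hypersurface V (parallel h N s) (parallel N h s) \<and>
        (\<exists>H. horosphere H \<and> openin (top_of_set H) (parallel h N s ` V)))"

end

theory Submission
  imports Defs
begin

text \<open>
  If \<open>X\<close> is a principal field orthogonal to \<open>T\<close> with constant curvature \<open>\<mu>\<close>, and \<open>\<lambda>\<close> is the curvature
  of \<open>T\<close>, the Codazzi equation in the directions \<open>X\<close>, \<open>T\<close> reads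
  \<open>\<mu>\<^sup>2 - \<lambda> \<mu> + c (1 - \<nu>\<^sup>2) = 0\<close>.  The spectrum being finite, \<open>\<nu>\<close> takes finitely many values and is
  constant; as its gradient is \<open>-\<lambda> T\<close>, also \<open>\<lambda> = 0\<close>, and then \<open>\<mu>\<^sup>2 = -c (1 - \<nu>\<^sup>2)\<close> forces \<open>c = -1\<close>.
  Both signs of \<open>\<mu>\<close> cannot occur: the two eigendistributions would be parallel, against the Gauss
  equation.  So the shape operator is \<open>\<mu>\<close> on the orthogonal complement of \<open>T\<close>, and with \<open>F\<close>, \<open>E\<close>, \<open>t\<close>
  the components of \<open>f\<close> and \<open>\<eta>\<close> in \<open>E\<^sup>n\<^sup>+\<^sup>1\<close> and the height, the vector
  \<open>exp (\<nu> t / \<mu>) (F + E / \<mu>)\<close> is constant and lightlike: it is the common normal of the horospheres.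
\<close>

section \<open>Calculus of maps of class Ck\<close>

text \<open>Only the set of eigenvalues is given as constant: neither smooth eigenvectors nor
  constant multiplicities. Smooth eigenfields come from a polynomial in the shape operator whose
  roots do not depend on the point. The curvature \<lambda> of \<open>T\<close> is at first a mere
  function, so the Codazzi argument must not differentiate it. The Codazzi and Gauss equations
  appear as symmetry of second derivatives of the position and of the normal in the flat space. If
  fields \<open>X\<close>, \<open>Y\<close> belonged to the curvatures \<sigma> and -\<sigma>, the
  second derivatives of the position along \<open>X\<close> twice and along \<open>Y\<close> twice
  would be orthogonal, while their components along \<open>P\<close>, \<open>e\<close> and
  \<open>T\<close> give the product \<open>- (1 + \<sigma>\<^sup>2 + \<sigma>\<^sup>2 *
  \<nu>\<^sup>2 / |T|\<^sup>2)\<close> for unit fields. Origin of \<open>B\<close>: the curve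
  \<open>s \<mapsto> (h_s(x), B * s)\<close> has velocity \<open>(N, B)\<close>, hence unit normal
  \<open>(B * N, -1) / sqrt (1 + B\<^sup>2)\<close> up to sign. So
  \<open>|\<nu>| = 1 / sqrt (1 + B\<^sup>2)\<close>, and
  \<open>\<mu>\<^sup>2 + \<nu>\<^sup>2 = 1\<close> yields
  \<open>B = |\<mu>| / |\<nu>|\<close>.\<close>

abbreviation D :: "('a::real_normed_vector \<Rightarrow> 'b::real_normed_vector) \<Rightarrow> 'a \<Rightarrow> 'a \<Rightarrow> 'b" where
  "D f x v \<equiv> frechet_derivative f (at x) v"

lemma frechet_derivative_cong_open:
  assumes "open S" "x \<in> S" "\<And>y. y \<in> S \<Longrightarrow> f y = g y"
  shows "frechet_derivative f (at x) = frechet_derivative g (at x)"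
proof -
  have "(f has_derivative F) (at x) \<longleftrightarrow> (g has_derivative F) (at x)" for F
    using assms by (metis has_derivative_transform_within_open)
  then show ?thesis
    unfolding frechet_derivative_def by simp
qed

lemma differentiable_cong_open:
  assumes "open S" "x \<in> S" "\<And>y. y \<in> S \<Longrightarrow> f y = g y" "f differentiable (at x)"
  shows "g differentiable (at x)"
  using assms unfolding differentiable_def by (metis has_derivative_transform_within_open)

lemma Ck_on_SucD: "Ck_on (Suc k) S f \<Longrightarrow> Ck_on k S f"
proof (induction k arbitrary: f)
  case 0
  then show ?case
    by (auto intro!: continuous_at_imp_continuous_on differentiable_imp_continuous_within)
next
  case (Suc k)
  have "Ck_on k S (\<lambda>x. D f x v)" for v
    using Suc.IH Suc.prems by (simp del: Ck_on.simps(2) add: Ck_on.simps(2)[of "Suc k"])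
  then show ?case using Suc.prems by simp
qed

lemma Ck_on_cong:
  assumes "open S" "\<And>x. x \<in> S \<Longrightarrow> f x = g x" "Ck_on k S f"
  shows "Ck_on k S g"
  using assms(2,3)
proof (induction k arbitrary: f g)
  case 0
  then show ?case using continuous_on_cong[of S S f g] by auto
next
  case (Suc k)
  have "D f x v = D g x v" if "x \<in> S" for x v
    using frechet_derivative_cong_open[OF assms(1) that, of f g] Suc.prems by simp
  then have "Ck_on k S (\<lambda>x. D g x v)" for v
    using Suc.IH[of "\<lambda>x. D f x v" "\<lambda>x. D g x v"] Suc.prems by simp
  moreover have "g differentiable at x" if "x \<in> S" for x
    using differentiable_cong_open[OF assms(1) that, of f g] Suc.prems that by simp
  ultimately show ?case by simp
qed

lemma Ck_on_subset: "Ck_on k S f \<Longrightarrow> T \<subseteq> S \<Longrightarrow> Ck_on k T f"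
  by (induction k arbitrary: f) (auto intro: continuous_on_subset)

lemma Ck_on_const [simp]: "Ck_on k S (\<lambda>x. c)"
  by (induction k arbitrary: c) (auto simp: frechet_derivative_const)

lemma bounded_linear_frechet_derivative:
  "f differentiable (at x) \<Longrightarrow> bounded_linear (frechet_derivative f (at x))"
  using frechet_derivative_works has_derivative_bounded_linear by blast

lemma Ck_on_linear:
  assumes "bounded_linear L" shows "Ck_on k S L"
proof (cases k)
  case 0
  then show ?thesis using linear_continuous_on[OF assms] by simp
next
  case (Suc m)
  have d: "(L has_derivative L) (at x)" for x
    using assms bounded_linear_imp_has_derivative by blast
  then have "frechet_derivative L (at x) = L" for x
    by (metis frechet_derivative_at)
  then show ?thesis using Suc d by (auto simp: differentiable_def)
qed

lemma Ck_on_add: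
  assumes "open S" "Ck_on k S f" "Ck_on k S g"
  shows "Ck_on k S (\<lambda>x. f x + g x)"
  using assms(2,3)
proof (induction k arbitrary: f g)
  case 0
  then show ?case by (auto intro: continuous_intros)
next
  case (Suc k)
  have "D f x v + D g x v = D (\<lambda>x. f x + g x) x v" if "x \<in> S" for x v
    using frechet_derivative_at[OF has_derivative_add[of f "frechet_derivative f (at x)" "at x" g
        "frechet_derivative g (at x)"]] Suc.prems that by (simp add: frechet_derivative_works fun_eq_iff)
  then have "Ck_on k S (\<lambda>x. D (\<lambda>x. f x + g x) x v)" for v
    using Ck_on_cong[OF assms(1), of "\<lambda>x. D f x v + D g x v" _ k] Suc.IH Suc.prems by simp
  then show ?case using Suc.prems by simp
qed

lemma Ck_on_sum:
  assumes "open S" "\<And>i. i \<in> I \<Longrightarrow> Ck_on k S (f i)"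
  shows "Ck_on k S (\<lambda>x. \<Sum>i\<in>I. f i x)"
  using assms(2)
  by (induction I rule: infinite_finite_induct) (auto intro!: Ck_on_add[OF assms(1)])

lemma (in bounded_bilinear) frechet_derivative_prod:
  assumes "f differentiable (at x)" "g differentiable (at x)"
  shows "frechet_derivative (\<lambda>x. prod (f x) (g x)) (at x) v = prod (f x) (D g x v) + prod (D f x v) (g x)"
    and "(\<lambda>x. prod (f x) (g x)) differentiable (at x)"
proof -
  have "((\<lambda>x. prod (f x) (g x)) has_derivative
      (\<lambda>v. prod (f x) (D g x v) + prod (D f x v) (g x))) (at x)"
    using FDERIV[of f "frechet_derivative f (at x)" x UNIV g "frechet_derivative g (at x)"] assms
    by (simp add: frechet_derivative_works)
  then show "frechet_derivative (\<lambda>x. prod (f x) (g x)) (at x) v = prod (f x) (D g x v) + prod (D f x v) (g x)"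
    and "(\<lambda>x. prod (f x) (g x)) differentiable (at x)"
    using frechet_derivative_at by (metis, auto simp: differentiable_def)
qed

lemma (in bounded_bilinear) Ck_on_prod:
  assumes "open S" "Ck_on k S f" "Ck_on k S g"
  shows "Ck_on k S (\<lambda>x. prod (f x) (g x))"
  using assms(2,3)
proof (induction k arbitrary: f g)
  case 0
  then show ?case by (auto intro: continuous_on)
next
  case (Suc k)
  have "Ck_on k S (\<lambda>x. prod (f x) (D g x v) + prod (D f x v) (g x))" for v
    using Suc.prems Suc.IH Ck_on_SucD[OF Suc.prems(1)] Ck_on_SucD[OF Suc.prems(2)]
    by (intro Ck_on_add[OF assms(1)]) auto
  then have "Ck_on k S (\<lambda>x. D (\<lambda>x. prod (f x) (g x)) x v)" for v
    by (rule Ck_on_cong[OF assms(1), rotated])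
      (use Suc.prems in \<open>simp add: frechet_derivative_prod\<close>)
  then show ?case using Suc.prems frechet_derivative_prod(2)[of f _ g] by simp
qed

lemmas Ck_on_scaleR = bounded_bilinear.Ck_on_prod[OF bounded_bilinear_scaleR]
lemmas Ck_on_mult = bounded_bilinear.Ck_on_prod[OF bounded_bilinear_mult]
lemmas Ck_on_inner = bounded_bilinear.Ck_on_prod[OF bounded_bilinear_inner]

lemma frechet_derivative_chain:
  assumes "g differentiable (at x)" "f differentiable (at (g x))"
  shows "D (\<lambda>x. f (g x)) x v = D f (g x) (D g x v)" "(\<lambda>x. f (g x)) differentiable (at x)"
proof -
  have "((\<lambda>x. f (g x)) has_derivative (\<lambda>v. D f (g x) (D g x v))) (at x)"
    using has_derivative_compose[of g "frechet_derivative g (at x)" x UNIV f "frechet_derivative f (at (g x))"]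
      assms by (simp add: frechet_derivative_works)
  then show "D (\<lambda>x. f (g x)) x v = D f (g x) (D g x v)" "(\<lambda>x. f (g x)) differentiable (at x)"
    using frechet_derivative_at by (metis, auto simp: differentiable_def)
qed

text \<open>\<open>Ck_on\<close> controls derivatives in fixed directions, whereas the chain rule
  differentiates \<open>f\<close> in the moving direction \<open>D g x v\<close>. Expanding that
  direction in a basis gives a sum of products to which the induction applies.\<close>

lemma Ck_on_compose:
  fixes g :: "'a::real_normed_vector \<Rightarrow> 'b::euclidean_space"
  assumes "open S" "open T" "g ` S \<subseteq> T" "Ck_on k S g" "Ck_on k T f"
  shows "Ck_on k S (\<lambda>x. f (g x))"
  using assms(4,5)
proof (induction k arbitrary: f)
  case 0
  then show ?case
    using assms(3) by (auto intro: continuous_on_compose2)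
next
  case (Suc k)
  have df: "f differentiable (at (g x))" if "x \<in> S" for x
    using Suc.prems assms(3) that by auto
  have "(\<Sum>b\<in>Basis. (D g x v \<bullet> b) *\<^sub>R D f (g x) b) = D f (g x) (D g x v)" if "x \<in> S" for x v
  proof -
    interpret L: bounded_linear "frechet_derivative f (at (g x))"
      using df[OF that] bounded_linear_frechet_derivative by blast
    show ?thesis
      by (subst (2) euclidean_representation[symmetric]) (simp add: L.sum L.scaleR)
  qed
  then have eq: "(\<Sum>b\<in>Basis. (D g x v \<bullet> b) *\<^sub>R D f (g x) b) = D (\<lambda>x. f (g x)) x v" if "x \<in> S" for x v
    using that frechet_derivative_chain(1)[of g x f] df Suc.prems by simp
  have "Ck_on k S (\<lambda>x. D f (g x) b)" for b
    using Suc.IH[of "\<lambda>y. D f y b"] Ck_on_SucD[OF Suc.prems(1)] Suc.prems by simp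
  then have "Ck_on k S (\<lambda>x. \<Sum>b\<in>Basis. (D g x v \<bullet> b) *\<^sub>R D f (g x) b)" for v
    using Suc.prems by (intro Ck_on_sum Ck_on_scaleR Ck_on_inner assms(1)) auto
  then have "Ck_on k S (\<lambda>x. D (\<lambda>x. f (g x)) x v)" for v
    by (rule Ck_on_cong[OF assms(1), rotated]) (simp add: eq)
  then show ?case
    using Suc.prems df frechet_derivative_chain(2)[of g _ f] by auto
qed

lemma Ck_on_compose_linear:
  assumes "open S" "bounded_linear L" "Ck_on k S g"
  shows "Ck_on k S (\<lambda>x. L (g x))"
  using assms(3)
proof (induction k arbitrary: g)
  case 0
  then show ?case using assms(2)
    by (auto intro: continuous_on_compose2[OF linear_continuous_on[OF assms(2), of UNIV]])
next
  case (Suc k)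
  have d: "(L has_derivative L) (at x)" for x
    using assms bounded_linear_imp_has_derivative by blast
  then have L: "frechet_derivative L (at x) = L" "L differentiable (at x)" for x
    by (metis frechet_derivative_at) (use d in \<open>auto simp: differentiable_def\<close>)
  have "Ck_on k S (\<lambda>x. L (D g x v))" for v
    using Suc by simp
  then have "Ck_on k S (\<lambda>x. D (\<lambda>x. L (g x)) x v)" for v
    by (rule Ck_on_cong[OF assms(1), rotated])
      (use Suc.prems L in \<open>simp add: frechet_derivative_chain\<close>)
  then show ?case using Suc.prems L frechet_derivative_chain(2)[of g _ L] by auto
qed

text \<open>Serves as a bootstrap for functions whose derivative is an expression in the function
  itself, such as \<open>exp\<close> and \<open>inverse\<close>.\<close>

lemma Ck_on_Suc_real:
  fixes f f' :: "real \<Rightarrow> real"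
  assumes "open S" and d: "\<And>x. x \<in> S \<Longrightarrow> (f has_real_derivative f' x) (at x)"
    and C: "Ck_on k S f'"
  shows "Ck_on (Suc k) S f"
proof -
  have "f' x * v = D f x v" if "x \<in> S" for x v
  proof -
    have "(f has_derivative (*) (f' x)) (at x)"
      using d[OF that] unfolding has_field_derivative_def .
    then show ?thesis by (metis frechet_derivative_at)
  qed
  moreover have "Ck_on k S (\<lambda>x. f' x * v)" for v
    using Ck_on_mult[OF assms(1) C, of "\<lambda>_. v"] by simp
  ultimately have "Ck_on k S (\<lambda>x. D f x v)" for v
    using Ck_on_cong[OF assms(1), of "\<lambda>x. f' x * v" _ k] by simp
  moreover have "f differentiable (at x)" if "x \<in> S" for x
    using d[OF that] unfolding has_field_derivative_def differentiable_def by blast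
  ultimately show ?thesis by simp
qed

lemma Ck_on_exp_real: "Ck_on k UNIV (exp :: real \<Rightarrow> real)"
proof (induction k)
  case 0
  show ?case by (simp add: continuous_on_exp)
next
  case (Suc k)
  then show ?case by (intro Ck_on_Suc_real[of _ _ exp]) (auto intro: DERIV_exp)
qed

lemma Ck_on_inverse_real: "Ck_on k (-{0}) (inverse :: real \<Rightarrow> real)"
proof (induction k)
  case 0
  show ?case by (auto intro: continuous_intros)
next
  case (Suc k)
  have "Ck_on k (-{0}) (\<lambda>x::real. (-1) * (inverse x * inverse x))"
    by (intro Ck_on_mult Suc Ck_on_const) auto
  then show ?case
    by (intro Ck_on_Suc_real[of _ _ "\<lambda>x. (-1) * (inverse x * inverse x)"])
      (auto intro!: derivative_eq_intros)
qed

lemma Ck_on_inverse: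
  fixes f :: "'a::real_normed_vector \<Rightarrow> real"
  assumes "open S" "Ck_on k S f" "\<And>x. x \<in> S \<Longrightarrow> f x \<noteq> 0"
  shows "Ck_on k S (\<lambda>x. inverse (f x))"
  by (rule Ck_on_compose[OF assms(1) _ _ assms(2) Ck_on_inverse_real]) (use assms(3) in auto)

section \<open>Determinants and linear systems with coefficients of class Ck\<close>

lemma Ck_on_prod_real:
  fixes f :: "'i \<Rightarrow> 'a::real_normed_vector \<Rightarrow> real"
  assumes "open S" "\<And>i. i \<in> I \<Longrightarrow> Ck_on k S (f i)"
  shows "Ck_on k S (\<lambda>x. \<Prod>i\<in>I. f i x)"
  using assms(2)
  by (induction I rule: infinite_finite_induct) (auto intro!: Ck_on_mult[OF assms(1)])

lemma Ck_on_det: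
  fixes M :: "'a::real_normed_vector \<Rightarrow> real^'n^'n"
  assumes "open S" "\<And>i j. Ck_on k S (\<lambda>x. M x $ i $ j)"
  shows "Ck_on k S (\<lambda>x. det (M x))"
  unfolding det_def
  by (intro Ck_on_sum Ck_on_mult Ck_on_prod_real assms Ck_on_const)

lemma Ck_on_vec:
  fixes w :: "'a::real_normed_vector \<Rightarrow> real^'n"
  assumes "open S" "\<And>i. Ck_on k S (\<lambda>x. w x $ i)"
  shows "Ck_on k S w"
proof -
  have "Ck_on k S (\<lambda>x. \<Sum>i\<in>UNIV. w x $ i *\<^sub>R axis i (1::real))"
    by (intro Ck_on_sum Ck_on_scaleR assms Ck_on_const)
  moreover have "(\<Sum>i\<in>UNIV. w x $ i *\<^sub>R axis i (1::real)) = w x" for x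
    using basis_expansion[of "w x"] by (simp add: scalar_mult_eq_scaleR)
  ultimately show ?thesis by simp
qed

text \<open>The normal equations \<open>L\<^sup>t L w = L\<^sup>t b\<close> are solved by Cramer's rule.\<close>

lemma Ck_on_solve:
  fixes L :: "'a::real_normed_vector \<Rightarrow> real^'n \<Rightarrow> 'b::euclidean_space" and w :: "'a \<Rightarrow> real^'n"
  assumes S: "open S" and lin: "\<And>x. x \<in> S \<Longrightarrow> linear (L x)" and inj: "\<And>x. x \<in> S \<Longrightarrow> inj (L x)"
    and L: "\<And>v. Ck_on k S (\<lambda>x. L x v)" and b: "Ck_on k S b"
    and eq: "\<And>x. x \<in> S \<Longrightarrow> L x (w x) = b x"
  shows "Ck_on k S w"
proof -
  define M where "M x = (\<chi> i j. L x (axis i 1) \<bullet> L x (axis j 1))" for x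
  define q where "q x = (\<chi> i. L x (axis i 1) \<bullet> b x)" for x
  have M_mult: "(M x *v v) $ i = L x (axis i 1) \<bullet> L x v" if "x \<in> S" for x v i
  proof -
    interpret linear "L x" by (rule lin[OF that])
    have "L x v = L x (\<Sum>j\<in>UNIV. v $ j *\<^sub>R axis j 1)"
      using basis_expansion[of v] by (simp add: scalar_mult_eq_scaleR)
    then have "L x v = (\<Sum>j\<in>UNIV. v $ j *\<^sub>R L x (axis j 1))"
      by (simp add: sum scaleR)
    then show ?thesis
      by (simp add: M_def matrix_vector_mult_def inner_sum_right mult.commute)
  qed
  \<comment> \<open>\<open>M x\<close> is the Gram matrix of the columns of \<open>L x\<close>: for
    a vector \<open>v\<close> in its kernel, \<open>L x v\<close> has length zero, and
    \<open>L x\<close> is injective.\<close>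
  have det: "det (M x) \<noteq> 0" if "x \<in> S" for x
  proof -
    interpret linear "L x" by (rule lin[OF that])
    have "v = 0" if "M x *v v = 0" for v
    proof -
      have "L x v \<bullet> L x v = (\<Sum>i\<in>UNIV. v $ i * (M x *v v) $ i)"
      proof -
        have "L x v = L x (\<Sum>j\<in>UNIV. v $ j *\<^sub>R axis j 1)"
          using basis_expansion[of v] by (simp add: scalar_mult_eq_scaleR)
        then have "L x v = (\<Sum>j\<in>UNIV. v $ j *\<^sub>R L x (axis j 1))"
          by (simp add: sum scaleR)
        then show ?thesis
          using inner_sum_left[of "\<lambda>j. v $ j *\<^sub>R L x (axis j 1)" UNIV "L x v"]
          by (simp add: M_mult \<open>x \<in> S\<close>)
      qed
      then have "L x v = L x 0" using that by (simp add: zero)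
      then show "v = 0" using injD[OF inj[OF \<open>x \<in> S\<close>], of v 0] by simp
    qed
    then show ?thesis
      by (metis invertible_det_nz invertible_left_inverse matrix_left_invertible_ker)
  qed
  have "M x *v w x = q x" if "x \<in> S" for x
    using M_mult[OF that] eq[OF that] by (simp add: vec_eq_iff q_def)
  then have w: "w x = (\<chi> k. det (\<chi> i j. if j = k then q x $ i else M x $ i $ j) / det (M x))"
    if "x \<in> S" for x
    using cramer[OF det[OF that]] that by blast
  have CM: "Ck_on k S (\<lambda>x. M x $ i $ j)" for i j
    unfolding M_def by (simp add: Ck_on_inner[OF S L L])
  have Cq: "Ck_on k S (\<lambda>x. q x $ i)" for i
    unfolding q_def by (simp add: Ck_on_inner[OF S L b])
  have Cw: "Ck_on k S (\<lambda>x. det (\<chi> i j. if j = l then q x $ i else M x $ i $ j) * inverse (det (M x)))" for l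
  proof (intro Ck_on_mult Ck_on_inverse Ck_on_det S CM det)
    show "Ck_on k S (\<lambda>x. (\<chi> i j. if j = l then q x $ i else M x $ i $ j) $ i $ j)" for i j
      using CM[of i j] Cq[of i] by (cases "j = l") simp_all
  qed auto
  have "Ck_on k S (\<lambda>x. w x $ l)" for l
    by (rule Ck_on_cong[OF S _ Cw[of l]]) (simp add: w divide_inverse)
  then show ?thesis by (rule Ck_on_vec[OF S])
qed

text \<open>The mean value theorem twice: in direction \<open>v\<close> for the difference of two
  parallel edges, then in direction \<open>w\<close> for the derivative along \<open>v\<close>. The
  left side is symmetric in \<open>v\<close> and \<open>w\<close>, which is its use.\<close>

lemma second_difference:
  fixes f :: "'a::real_normed_vector \<Rightarrow> real"
  assumes h: "h > 0" and C: "Ck_on 2 S f"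
    and S: "\<And>s t. 0 \<le> s \<Longrightarrow> s \<le> h \<Longrightarrow> 0 \<le> t \<Longrightarrow> t \<le> h \<Longrightarrow> x + s *\<^sub>R v + t *\<^sub>R w \<in> S"
  shows "\<exists>s t. 0 < s \<and> s < h \<and> 0 < t \<and> t < h \<and>
    f (x + h *\<^sub>R v + h *\<^sub>R w) - f (x + h *\<^sub>R v) - f (x + h *\<^sub>R w) + f x
      = h * h * D (\<lambda>z. D f z v) (x + s *\<^sub>R v + t *\<^sub>R w) w"
proof -
  have line: "((\<lambda>s. F (a + s *\<^sub>R v)) has_real_derivative D F (a + s *\<^sub>R v) v) (at s)"
    if "F differentiable (at (a + s *\<^sub>R v))" for F :: "'a \<Rightarrow> real" and a v s
  proof -
    have F: "(F has_derivative D F (a + s *\<^sub>R v)) (at (a + s *\<^sub>R v))"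
      using that by (simp add: frechet_derivative_works)
    interpret bounded_linear "D F (a + s *\<^sub>R v)"
      using F by (rule has_derivative_bounded_linear)
    have "((\<lambda>s. F (a + s *\<^sub>R v)) has_derivative (\<lambda>t. D F (a + s *\<^sub>R v) (t *\<^sub>R v))) (at s)"
      by (rule has_derivative_compose[where f = "\<lambda>s. a + s *\<^sub>R v", OF _ F])
        (auto intro!: derivative_eq_intros)
    then show ?thesis
      unfolding has_field_derivative_def by (simp add: scaleR mult_commute_abs)
  qed
  have C1: "f differentiable (at y)" if "y \<in> S" for y
    using C that by (simp add: numeral_2_eq_2)
  have C2: "(\<lambda>z. D f z v) differentiable (at y)" if "y \<in> S" for y
    using C that by (simp add: numeral_2_eq_2)
  let ?\<phi> = "\<lambda>s. f (x + h *\<^sub>R w + s *\<^sub>R v) - f (x + s *\<^sub>R v)"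
  have "\<exists>s. 0 < s \<and> s < h \<and>
    ?\<phi> h - ?\<phi> 0 = (h - 0) * (D f (x + h *\<^sub>R w + s *\<^sub>R v) v - D f (x + s *\<^sub>R v) v)"
  proof (rule MVT2[OF h])
    fix s assume s: "0 \<le> s" "s \<le> h"
    show "(?\<phi> has_real_derivative D f (x + h *\<^sub>R w + s *\<^sub>R v) v - D f (x + s *\<^sub>R v) v) (at s)"
      using S[of s h] S[of s 0] s h
      by (intro DERIV_diff line C1) (simp_all add: algebra_simps)
  qed
  then obtain s where s: "0 < s" "s < h"
    "?\<phi> h - ?\<phi> 0 = h * (D f (x + h *\<^sub>R w + s *\<^sub>R v) v - D f (x + s *\<^sub>R v) v)" by auto
  let ?\<psi> = "\<lambda>t. D f (x + s *\<^sub>R v + t *\<^sub>R w) v"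
  have "\<exists>t. 0 < t \<and> t < h \<and> ?\<psi> h - ?\<psi> 0 = (h - 0) * D (\<lambda>z. D f z v) (x + s *\<^sub>R v + t *\<^sub>R w) w"
  proof (rule MVT2[OF h])
    fix t assume t: "0 \<le> t" "t \<le> h"
    show "(?\<psi> has_real_derivative D (\<lambda>z. D f z v) (x + s *\<^sub>R v + t *\<^sub>R w) w) (at t)"
      using S[of s t] s t by (intro line C2) auto
  qed
  then obtain t where t: "0 < t" "t < h"
    "?\<psi> h - ?\<psi> 0 = h * D (\<lambda>z. D f z v) (x + s *\<^sub>R v + t *\<^sub>R w) w" by auto
  have "?\<phi> h - ?\<phi> 0 = h * (?\<psi> h - ?\<psi> 0)"
    using s(3) by (simp add: algebra_simps)
  then show ?thesis using s(1,2) t by (intro exI[of _ s] exI[of _ t]) (simp add: algebra_simps)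
qed

text \<open>One second difference equals \<open>h * h\<close> times either mixed derivative, taken
  at points of a small parallelogram. By continuity both values lie within half the supposed gap of
  their values at \<open>x\<close>, a contradiction.\<close>

lemma symmetric_second_derivative_real:
  fixes f :: "'a::real_normed_vector \<Rightarrow> real"
  assumes S: "open S" "x \<in> S" and C: "Ck_on 2 S f"
  shows "D (\<lambda>z. D f z v) x w = D (\<lambda>z. D f z w) x v"
proof (rule ccontr)
  let ?A = "\<lambda>y. D (\<lambda>z. D f z v) y w" and ?B = "\<lambda>y. D (\<lambda>z. D f z w) y v"
  assume ne: "?A x \<noteq> ?B x"
  define e where "e = \<bar>?A x - ?B x\<bar> / 2"
  have e: "e > 0" using ne by (simp add: e_def)
  have "isCont ?A x" "isCont ?B x"
    using C S by (auto simp: numeral_2_eq_2 continuous_on_eq_continuous_at)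
  then obtain d1 d2 where d: "d1 > 0" "\<And>y. dist y x < d1 \<Longrightarrow> dist (?A y) (?A x) < e"
    "d2 > 0" "\<And>y. dist y x < d2 \<Longrightarrow> dist (?B y) (?B x) < e"
    unfolding continuous_at_eps_delta using e by metis
  obtain d3 where d3: "d3 > 0" "ball x d3 \<subseteq> S"
    using S open_contains_ball by blast
  define m where "m = min d1 (min d2 d3)"
  \<comment> \<open>With this side length the parallelogram stays inside the ball of radius
    \<open>m\<close>: the factor 2 makes the bound strict, the summand 1 covers
    \<open>v = w = 0\<close>.\<close>
  define h where "h = m / (2 * (norm v + norm w + 1))"
  have m: "m > 0" using d d3 by (simp add: m_def)
  have pos: "2 * (norm v + norm w + 1) > 0" by (smt (verit) norm_ge_zero)
  have h: "h > 0" using m pos by (simp add: h_def)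
  have "h * (norm v + norm w) \<le> h * (norm v + norm w + 1)" using h by simp
  also have "\<dots> = m / 2" using pos by (simp add: h_def field_simps)
  finally have hm: "h * (norm v + norm w) < m" using m by simp
  have near: "dist (x + s *\<^sub>R v + t *\<^sub>R w) x < m" if "0 \<le> s" "s \<le> h" "0 \<le> t" "t \<le> h" for s t
  proof -
    have "dist (x + s *\<^sub>R v + t *\<^sub>R w) x = norm (s *\<^sub>R v + t *\<^sub>R w)"
      by (simp add: dist_norm)
    also have "\<dots> \<le> s * norm v + t * norm w"
      using that norm_triangle_ineq[of "s *\<^sub>R v" "t *\<^sub>R w"] by simp
    also have "\<dots> \<le> h * norm v + h * norm w"
      using that by (intro add_mono mult_right_mono) auto
    finally show ?thesis using hm by (simp add: algebra_simps)
  qed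
  have inS: "x + s *\<^sub>R v + t *\<^sub>R w \<in> S" if "0 \<le> s" "s \<le> h" "0 \<le> t" "t \<le> h" for s t
    using near[OF that] d3(2) by (auto simp: m_def dist_commute subset_iff)
  obtain s t where st: "0 < s" "s < h" "0 < t" "t < h"
    "f (x + h *\<^sub>R v + h *\<^sub>R w) - f (x + h *\<^sub>R v) - f (x + h *\<^sub>R w) + f x
      = h * h * ?A (x + s *\<^sub>R v + t *\<^sub>R w)"
    using second_difference[OF h C inS] by blast
  have inS': "x + s *\<^sub>R w + t *\<^sub>R v \<in> S" if "0 \<le> s" "s \<le> h" "0 \<le> t" "t \<le> h" for s t
    using inS[of t s] that by (simp add: algebra_simps)
  obtain s' t' where st': "0 < s'" "s' < h" "0 < t'" "t' < h"
    "f (x + h *\<^sub>R w + h *\<^sub>R v) - f (x + h *\<^sub>R w) - f (x + h *\<^sub>R v) + f x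
      = h * h * ?B (x + s' *\<^sub>R w + t' *\<^sub>R v)"
    using second_difference[OF h C inS'] by blast
  have sw: "x + h *\<^sub>R w + h *\<^sub>R v = x + h *\<^sub>R v + h *\<^sub>R w"
    "x + s' *\<^sub>R w + t' *\<^sub>R v = x + t' *\<^sub>R v + s' *\<^sub>R w" by simp_all
  have "h * h * ?A (x + s *\<^sub>R v + t *\<^sub>R w) = h * h * ?B (x + t' *\<^sub>R v + s' *\<^sub>R w)"
    using st(5) st'(5) unfolding sw by linarith
  then have "?A (x + s *\<^sub>R v + t *\<^sub>R w) = ?B (x + t' *\<^sub>R v + s' *\<^sub>R w)"
    using h by simp
  moreover have "dist (?A (x + s *\<^sub>R v + t *\<^sub>R w)) (?A x) < e"
    using near[of s t] st by (intro d) (auto simp: m_def)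
  moreover have "dist (?B (x + t' *\<^sub>R v + s' *\<^sub>R w)) (?B x) < e"
    using near[of t' s'] st' by (intro d) (auto simp: m_def)
  ultimately show False
    unfolding dist_real_def e_def by (smt (verit) field_sum_of_halves)
qed

lemma frechet_derivative_linear_compose:
  assumes "bounded_linear L" "f differentiable (at x)"
  shows "D (\<lambda>x. L (f x)) x v = L (D f x v)" "(\<lambda>x. L (f x)) differentiable (at x)"
proof -
  have "((\<lambda>x. L (f x)) has_derivative (\<lambda>v. L (D f x v))) (at x)"
    using bounded_linear.has_derivative[OF assms(1), of f "frechet_derivative f (at x)" "at x"] assms(2)
    by (simp add: frechet_derivative_works)
  then show "D (\<lambda>x. L (f x)) x v = L (D f x v)" "(\<lambda>x. L (f x)) differentiable (at x)"
    using frechet_derivative_at by (metis, auto simp: differentiable_def)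
qed

lemma symmetric_second_derivative:
  fixes f :: "'a::real_normed_vector \<Rightarrow> 'b::euclidean_space"
  assumes S: "open S" "x \<in> S" and C: "Ck_on 2 S f"
  shows "D (\<lambda>z. D f z v) x w = D (\<lambda>z. D f z w) x v"
proof (rule euclidean_eqI)
  fix b :: 'b assume "b \<in> Basis"
  have L: "bounded_linear (\<lambda>y::'b. y \<bullet> b)" by (rule bounded_linear_inner_left)
  have C1: "f differentiable (at y)" "(\<lambda>z. D f z v) differentiable (at y)" if "y \<in> S" for y v
    using C that by (simp_all add: numeral_2_eq_2)
  have "D (\<lambda>z. D f z v) x w \<bullet> b = D (\<lambda>z. D (\<lambda>y. f y \<bullet> b) z v) x w" for v w
  proof -
    have "D (\<lambda>z. D f z v) x w \<bullet> b = D (\<lambda>z. D f z v \<bullet> b) x w"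
      using frechet_derivative_linear_compose(1)[OF L C1(2)[OF S(2)]] by simp
    also have "\<dots> = D (\<lambda>z. D (\<lambda>y. f y \<bullet> b) z v) x w"
      using frechet_derivative_cong_open[OF S, of "\<lambda>z. D f z v \<bullet> b" "\<lambda>z. D (\<lambda>y. f y \<bullet> b) z v"]
        frechet_derivative_linear_compose(1)[OF L C1(1)] by simp
    finally show ?thesis .
  qed
  moreover have "Ck_on 2 S (\<lambda>y. f y \<bullet> b)"
    by (rule Ck_on_compose_linear[OF S(1) L C])
  ultimately show "D (\<lambda>z. D f z v) x w \<bullet> b = D (\<lambda>z. D f z w) x v \<bullet> b"
    using symmetric_second_derivative_real[OF S] by metis
qed

section \<open>Closure properties of smooth maps\<close>

lemma smooth_on_const: "smooth_on S (\<lambda>x. c)"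
  by (simp add: smooth_on_def)

lemma smooth_on_add: "open S \<Longrightarrow> smooth_on S f \<Longrightarrow> smooth_on S g \<Longrightarrow> smooth_on S (\<lambda>x. f x + g x)"
  by (simp add: smooth_on_def Ck_on_add)

lemma smooth_on_sum: "open S \<Longrightarrow> (\<And>i. i \<in> I \<Longrightarrow> smooth_on S (f i)) \<Longrightarrow> smooth_on S (\<lambda>x. \<Sum>i\<in>I. f i x)"
  by (simp add: smooth_on_def Ck_on_sum)

lemma smooth_on_linear: "open S \<Longrightarrow> bounded_linear L \<Longrightarrow> smooth_on S f \<Longrightarrow> smooth_on S (\<lambda>x. L (f x))"
  by (simp add: smooth_on_def Ck_on_compose_linear)

lemma smooth_on_minus: "open S \<Longrightarrow> smooth_on S f \<Longrightarrow> smooth_on S (\<lambda>x. - f x)"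
  using smooth_on_linear[OF _ bounded_linear_minus[OF bounded_linear_ident]] .

lemma smooth_on_diff: "open S \<Longrightarrow> smooth_on S f \<Longrightarrow> smooth_on S g \<Longrightarrow> smooth_on S (\<lambda>x. f x - g x)"
  using smooth_on_add[of S f "\<lambda>x. - g x"] smooth_on_minus[of S g] by simp

lemma smooth_on_Pair:
  assumes "open S" "smooth_on S f" "smooth_on S g"
  shows "smooth_on S (\<lambda>x. (f x, g x))"
proof -
  have "smooth_on S (\<lambda>x. (f x, 0) + (0, g x))"
    by (intro smooth_on_add smooth_on_linear[of S "\<lambda>y. (y, 0)"] smooth_on_linear[of S "\<lambda>y. (0, y)"] assms)
      (intro bounded_linear_intros)+
  then show ?thesis by simp
qed

lemma smooth_on_bilinear:
  "open S \<Longrightarrow> bounded_bilinear p \<Longrightarrow> smooth_on S f \<Longrightarrow> smooth_on S g \<Longrightarrow> smooth_on S (\<lambda>x. p (f x) (g x))"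
  by (simp add: smooth_on_def bounded_bilinear.Ck_on_prod)

lemmas smooth_on_scaleR = smooth_on_bilinear[OF _ bounded_bilinear_scaleR]
lemmas smooth_on_mult = smooth_on_bilinear[OF _ bounded_bilinear_mult]

lemma smooth_on_inverse:
  fixes f :: "'a::real_normed_vector \<Rightarrow> real"
  shows "open S \<Longrightarrow> smooth_on S f \<Longrightarrow> (\<And>x. x \<in> S \<Longrightarrow> f x \<noteq> 0) \<Longrightarrow> smooth_on S (\<lambda>x. inverse (f x))"
  by (simp add: smooth_on_def Ck_on_inverse)

lemma smooth_on_compose:
  fixes g :: "'a::real_normed_vector \<Rightarrow> 'b::euclidean_space"
  shows "open S \<Longrightarrow> open T \<Longrightarrow> g ` S \<subseteq> T \<Longrightarrow> smooth_on S g \<Longrightarrow> smooth_on T f \<Longrightarrow> smooth_on S (\<lambda>x. f (g x))"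
  by (simp add: smooth_on_def Ck_on_compose)

lemma smooth_on_exp:
  fixes f :: "'a::real_normed_vector \<Rightarrow> real"
  shows "open S \<Longrightarrow> smooth_on S f \<Longrightarrow> smooth_on S (\<lambda>x. exp (f x))"
  using smooth_on_compose[of S UNIV f exp] Ck_on_exp_real by (simp add: smooth_on_def)

lemma smooth_on_cong: "open S \<Longrightarrow> (\<And>x. x \<in> S \<Longrightarrow> f x = g x) \<Longrightarrow> smooth_on S f \<Longrightarrow> smooth_on S g"
  unfolding smooth_on_def using Ck_on_cong by blast

lemma smooth_on_subset: "smooth_on S f \<Longrightarrow> T \<subseteq> S \<Longrightarrow> smooth_on T f"
  unfolding smooth_on_def using Ck_on_subset by blast

lemma smooth_on_D: "smooth_on S f \<Longrightarrow> smooth_on S (\<lambda>x. D f x v)"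
  unfolding smooth_on_def by (metis Ck_on.simps(2))

lemma smooth_on_differentiable: "smooth_on S f \<Longrightarrow> x \<in> S \<Longrightarrow> f differentiable (at x)"
  unfolding smooth_on_def by (metis Ck_on.simps(2))

lemma smooth_on_continuous_on: "smooth_on S f \<Longrightarrow> continuous_on S f"
  unfolding smooth_on_def by (metis Ck_on.simps(1))

lemma smooth_on_solve:
  fixes L :: "'a::real_normed_vector \<Rightarrow> real^'n \<Rightarrow> 'b::euclidean_space" and w :: "'a \<Rightarrow> real^'n"
  assumes "open S" "\<And>x. x \<in> S \<Longrightarrow> linear (L x)" "\<And>x. x \<in> S \<Longrightarrow> inj (L x)"
    "\<And>v. smooth_on S (\<lambda>x. L x v)" "smooth_on S b" "\<And>x. x \<in> S \<Longrightarrow> L x (w x) = b x"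
  shows "smooth_on S w"
  using assms unfolding smooth_on_def by (metis Ck_on_solve)

section \<open>Vector fields and their commutators\<close>

text \<open>For a vector field \<open>Y\<close> this differentiates coordinate components, so
  \<open>lie X Y - lie Y X\<close> is the Lie bracket. For vector-valued maps it is the derivative
  in the flat space.\<close>

definition lie :: "('a::euclidean_space \<Rightarrow> 'a) \<Rightarrow> ('a \<Rightarrow> 'b::real_normed_vector) \<Rightarrow> 'a \<Rightarrow> 'b" where
  "lie X f x = D f x (X x)"

lemma linear_D: "f differentiable (at x) \<Longrightarrow> linear (D f x)"
  using bounded_linear_frechet_derivative bounded_linear.linear by blast

lemma D_expand:
  fixes f :: "'a::euclidean_space \<Rightarrow> 'b::real_normed_vector"
  assumes "f differentiable (at x)"
  shows "D f x v = (\<Sum>b\<in>Basis. (v \<bullet> b) *\<^sub>R D f x b)"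
proof -
  interpret linear "D f x" using assms by (rule linear_D)
  have "D f x (\<Sum>b\<in>Basis. (v \<bullet> b) *\<^sub>R b) = (\<Sum>b\<in>Basis. (v \<bullet> b) *\<^sub>R D f x b)"
    by (simp only: sum scaleR)
  then show ?thesis by (simp only: euclidean_representation)
qed

lemma smooth_on_lie:
  assumes "open S" "smooth_on S X" "smooth_on S f"
  shows "smooth_on S (lie X f)"
proof -
  have "smooth_on S (\<lambda>x. \<Sum>b\<in>Basis. (X x \<bullet> b) *\<^sub>R D f x b)"
    by (intro smooth_on_sum smooth_on_scaleR smooth_on_D smooth_on_linear[OF _ bounded_linear_inner_left] assms)
  then show ?thesis
    by (rule smooth_on_cong[OF assms(1), rotated])
      (simp add: lie_def D_expand[symmetric] smooth_on_differentiable[OF assms(3)])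
qed

lemma lie_cong:
  "open S \<Longrightarrow> x \<in> S \<Longrightarrow> (\<And>y. y \<in> S \<Longrightarrow> f y = g y) \<Longrightarrow> lie X f x = lie X g x"
  unfolding lie_def using frechet_derivative_cong_open by metis

lemma lie_const [simp]: "lie X (\<lambda>x. c) x = 0"
  by (simp add: lie_def)

lemma lie_bilinear:
  assumes "bounded_bilinear p" "f differentiable (at x)" "g differentiable (at x)"
  shows "lie X (\<lambda>x. p (f x) (g x)) x = p (lie X f x) (g x) + p (f x) (lie X g x)"
  unfolding lie_def using bounded_bilinear.frechet_derivative_prod(1)[OF assms] by (simp add: add.commute)

lemma lie_linear:
  assumes "bounded_linear L" "f differentiable (at x)"
  shows "lie X (\<lambda>x. L (f x)) x = L (lie X f x)"
  unfolding lie_def using frechet_derivative_linear_compose(1)[OF assms] .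

lemma lie_diff:
  assumes "f differentiable (at x)" "g differentiable (at x)"
  shows "lie X (\<lambda>x. f x - g x) x = lie X f x - lie X g x"
  using frechet_derivative_at[OF has_derivative_diff[of f "frechet_derivative f (at x)" "at x" g
        "frechet_derivative g (at x)"]] assms unfolding lie_def by (simp add: frechet_derivative_works fun_eq_iff)

text \<open>The Hessian of \<open>f\<close> enters both iterated derivatives symmetrically and
  cancels. Applied to the immersion this is vanishing torsion, applied to the unit normal it
  contains the Codazzi equation.\<close>

lemma lie_commutator:
  fixes f :: "'a::euclidean_space \<Rightarrow> 'b::euclidean_space"
  assumes S: "open S" "x \<in> S" and X: "smooth_on S X" and Y: "smooth_on S Y" and f: "smooth_on S f"
  shows "lie X (lie Y f) x - lie Y (lie X f) x = D f x (lie X Y x - lie Y X x)"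
proof -
  define H where "H v w = D (\<lambda>y. D f y v) x w" for v w
  have sym: "H v w = H w v" for v w
    unfolding H_def using symmetric_second_derivative[OF S] f by (auto simp: smooth_on_def)
  have lin: "linear (H v)" for v
    unfolding H_def by (rule linear_D) (rule smooth_on_differentiable[OF smooth_on_D[OF f] S(2)])
  have *: "lie X (lie Y f) x = D f x (lie X Y x) + H (X x) (Y x)" if Y: "smooth_on S Y" for X Y
  proof -
    have dY: "(\<lambda>y. Y y \<bullet> b) differentiable (at x)" for b
      by (rule frechet_derivative_linear_compose(2)[OF bounded_linear_inner_left
            smooth_on_differentiable[OF Y S(2)]])
    have df: "(\<lambda>y. D f y b) differentiable (at x)" for b
      by (rule smooth_on_differentiable[OF smooth_on_D[OF f] S(2)])
    have dp: "(\<lambda>y. (Y y \<bullet> b) *\<^sub>R D f y b) differentiable (at x)" for b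
      by (rule bounded_bilinear.frechet_derivative_prod(2)[OF bounded_bilinear_scaleR dY df])
    have "lie X (lie Y f) x = lie X (\<lambda>y. \<Sum>b\<in>Basis. (Y y \<bullet> b) *\<^sub>R D f y b) x"
      by (rule lie_cong[OF S]) (simp add: lie_def D_expand[symmetric] smooth_on_differentiable[OF f])
    also have "\<dots> = (\<Sum>b\<in>Basis. lie X (\<lambda>y. (Y y \<bullet> b) *\<^sub>R D f y b) x)"
    proof -
      have "((\<lambda>y. \<Sum>b\<in>Basis. (Y y \<bullet> b) *\<^sub>R D f y b) has_derivative
          (\<lambda>v. \<Sum>b\<in>Basis. D (\<lambda>y. (Y y \<bullet> b) *\<^sub>R D f y b) x v)) (at x)"
        using dp by (intro has_derivative_sum) (simp add: frechet_derivative_works)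
      from fun_cong[OF frechet_derivative_at[OF this], of "X x"] show ?thesis
        by (simp add: lie_def)
    qed
    also have "\<dots> = (\<Sum>b\<in>Basis. (lie X Y x \<bullet> b) *\<^sub>R D f x b + (Y x \<bullet> b) *\<^sub>R H b (X x))"
    proof (rule sum.cong[OF refl])
      fix b :: 'a
      have "lie X (\<lambda>y. Y y \<bullet> b) x = lie X Y x \<bullet> b"
        by (rule lie_linear[OF bounded_linear_inner_left smooth_on_differentiable[OF Y S(2)]])
      then show "lie X (\<lambda>y. (Y y \<bullet> b) *\<^sub>R D f y b) x = (lie X Y x \<bullet> b) *\<^sub>R D f x b + (Y x \<bullet> b) *\<^sub>R H b (X x)"
        unfolding lie_bilinear[OF bounded_bilinear_scaleR dY df] by (simp add: H_def lie_def)
    qed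
    also have "\<dots> = D f x (lie X Y x) + (\<Sum>b\<in>Basis. (Y x \<bullet> b) *\<^sub>R H (X x) b)"
      by (simp add: sum.distrib D_expand[OF smooth_on_differentiable[OF f S(2)], symmetric] sym[of _ "X x"])
    also have "(\<Sum>b\<in>Basis. (Y x \<bullet> b) *\<^sub>R H (X x) b) = H (X x) (Y x)"
    proof -
      interpret linear "H (X x)" by (rule lin)
      have "H (X x) (\<Sum>b\<in>Basis. (Y x \<bullet> b) *\<^sub>R b) = (\<Sum>b\<in>Basis. (Y x \<bullet> b) *\<^sub>R H (X x) b)"
        by (simp only: sum scaleR)
      then show ?thesis by (simp only: euclidean_representation)
    qed
    finally show ?thesis .
  qed
  interpret linear "D f x" by (rule linear_D[OF smooth_on_differentiable[OF f S(2)]])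
  show ?thesis
    unfolding *[OF X] *[OF Y] diff using sym by simp
qed

section \<open>The smooth inverse function theorem\<close>

text \<open>Smoothness of the inverse \<open>g\<close> is a bootstrap: \<open>D g y v\<close> solves
  a linear system with matrix \<open>D F (g y)\<close>, whose entries are of class Ck as soon as
  \<open>g\<close> is, so \<open>Ck_on_solve\<close> raises the order by one.\<close>

lemma smooth_inverse_function:
  fixes G :: "real^'n \<Rightarrow> 'd::euclidean_space"
  assumes dim: "DIM('d) = CARD('n)" and U: "open U" "p \<in> U" and G: "smooth_on U G" and inj: "inj (D G p)"
  obtains U' V H where "open U'" "U' \<subseteq> U" "p \<in> U'" "open V" "homeomorphism U' V G H" "smooth_on V H"
proof -
  \<comment> \<open>The inverse function theorem concerns maps of a space to itself, so the target
    is first identified linearly with \<open>real^'n\<close>.\<close>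
  obtain \<iota> :: "'d \<Rightarrow> real^'n" and \<iota>' where \<iota>: "linear \<iota>" "linear \<iota>'" "\<And>x. \<iota>' (\<iota> x) = x" "\<And>y. \<iota> (\<iota>' y) = y"
  proof -
    have "DIM('d) = DIM(real^'n)" using dim by simp
    from isomorphisms_UNIV_UNIV[OF this] that show thesis by metis
  qed
  have b\<iota>: "bounded_linear \<iota>" "bounded_linear \<iota>'"
    using \<iota> by (simp_all add: linear_linear)
  define F where "F x = \<iota> (G x)" for x
  have F: "smooth_on U F" unfolding F_def using smooth_on_linear[OF U(1) b\<iota>(1) G] .
  have DF: "D F p v = \<iota> (D G p v)" for v
    unfolding F_def using frechet_derivative_linear_compose(1)[OF b\<iota>(1) smooth_on_differentiable[OF G U(2)]] .
  define F' where "F' x = Blinfun (D F x)" for x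
  have F': "blinfun_apply (F' x) = D F x" if "x \<in> U" for x
    unfolding F'_def using bounded_linear_frechet_derivative[OF smooth_on_differentiable[OF F that]]
    by (simp add: bounded_linear_Blinfun_apply)
  have lin: "linear (D F p)" by (rule linear_D[OF smooth_on_differentiable[OF F U(2)]])
  have injF: "inj (D F p)"
    using inj \<iota>(3) unfolding inj_def DF by metis
  obtain K where K: "linear K" "K \<circ> D F p = id"
    using linear_injective_left_inverse[OF lin injF] by auto
  have IFT: "open U" "\<And>x. x \<in> U \<Longrightarrow> (F has_derivative (blinfun_apply (F' x))) (at x)" "continuous_on U F'"
    "p \<in> U" "Blinfun K o\<^sub>L F' p = id_blinfun"
  proof -
    show "continuous_on U F'"
    proof (rule continuous_on_blinfun_componentwise)
      fix i :: "real^'n"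
      show "continuous_on U (\<lambda>x. blinfun_apply (F' x) i)"
        using smooth_on_continuous_on[OF smooth_on_D[OF F, of i]] F' by (simp cong: continuous_on_cong)
    qed
    show "Blinfun K o\<^sub>L F' p = id_blinfun"
      using K by (intro blinfun_eqI)
        (simp add: F'[OF U(2)] bounded_linear_Blinfun_apply linear_linear fun_eq_iff)
    show "(F has_derivative (blinfun_apply (F' x))) (at x)" if "x \<in> U" for x
      using smooth_on_differentiable[OF F that] F'[OF that] by (simp add: frechet_derivative_works)
  qed (use U in auto)
  obtain U' V g g' where *: "open U'" "U' \<subseteq> U" "p \<in> U'" "open V" "F p \<in> V" "homeomorphism U' V F g"
    and dg: "\<And>y. y \<in> V \<Longrightarrow> (g has_derivative (g' y)) (at y)"
    and g': "\<And>y. y \<in> V \<Longrightarrow> g' y = inv (blinfun_apply (F'(g y)))"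
    and bij: "\<And>y. y \<in> V \<Longrightarrow> bij (blinfun_apply (F'(g y)))"
    using inverse_function_theorem[OF IFT] by metis
  have gU: "g y \<in> U" if "y \<in> V" for y
    using *(2,6) that by (auto simp: homeomorphism_def)
  have "Ck_on k V g" for k
  proof (induction k)
    case 0
    then show ?case using *(6) by (simp add: homeomorphism_def)
  next
    case (Suc k)
    have "Ck_on k V (\<lambda>y. D g y v)" for v
    proof (rule Ck_on_solve[where L = "\<lambda>y. D F (g y)" and b = "\<lambda>y. v"])
      fix y assume y: "y \<in> V"
      show "linear (D F (g y))"
        by (rule linear_D[OF smooth_on_differentiable[OF F gU[OF y]]])
      show "inj (D F (g y))"
        using bij[OF y] F'[OF gU[OF y]] by (simp add: bij_is_inj)
      have "D g y v = inv (D F (g y)) v"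
        using frechet_derivative_at[OF dg[OF y]] g'[OF y] F'[OF gU[OF y]] by metis
      then show "D F (g y) (D g y v) = v"
        using bij[OF y] F'[OF gU[OF y]] by (simp add: bij_is_surj surj_f_inv_f)
    next
      fix v
      show "Ck_on k V (\<lambda>y. D F (g y) v)"
        by (rule Ck_on_compose[OF *(4) U(1) _ Suc])
          (use gU smooth_on_D[OF F] in \<open>auto simp: smooth_on_def\<close>)
    qed (use * in auto)
    then show ?case using dg by (auto simp: differentiable_def)
  qed
  then have g: "smooth_on V g" by (simp add: smooth_on_def)
  have oV: "open (\<iota> -` V)"
    using b\<iota>(1) *(4) by (intro continuous_open_vimage) (auto intro: linear_continuous_at)
  show ?thesis
  proof
    show "open (\<iota> -` V)" by (rule oV)
    show "smooth_on (\<iota> -` V) (\<lambda>y. g (\<iota> y))"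
      by (rule smooth_on_compose[OF oV *(4) _ _ g])
        (use Ck_on_linear[OF b\<iota>(1)] in \<open>auto simp: smooth_on_def\<close>)
    have cG: "continuous_on U' G"
      using smooth_on_continuous_on[OF G] *(2) continuous_on_subset by blast
    have cg: "continuous_on (\<iota> -` V) (\<lambda>y. g (\<iota> y))"
      by (rule continuous_on_compose2[of V g])
        (use *(6) linear_continuous_on[OF b\<iota>(1)] in \<open>auto simp: homeomorphism_def\<close>)
    show "homeomorphism U' (\<iota> -` V) G (\<lambda>y. g (\<iota> y))"
    proof (rule homeomorphismI[OF cG cg])
      show "G ` U' \<subseteq> \<iota> -` V" "(\<lambda>y. g (\<iota> y)) ` (\<iota> -` V) \<subseteq> U'"
        using *(6) by (auto simp: homeomorphism_def F_def)
      show "g (\<iota> (G x)) = x" if "x \<in> U'" for x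
        using *(6) that by (auto simp: homeomorphism_def F_def)
      show "G (g (\<iota> y)) = y" if "y \<in> \<iota> -` V" for y
      proof -
        have "\<iota> (G (g (\<iota> y))) = \<iota> y"
          using *(6) that by (auto simp: homeomorphism_def F_def)
        then show ?thesis by (metis \<iota>(3))
      qed
    qed
  qed (use * in auto)
qed

section \<open>Self-adjoint operators\<close>

locale self_adjoint_operator =
  fixes g :: "'a::euclidean_space \<Rightarrow> 'a \<Rightarrow> real" and A :: "'a \<Rightarrow> 'a"
  assumes bilinear_g: "bilinear g" and sym_g: "g v w = g w v" and pos_g: "v \<noteq> 0 \<Longrightarrow> g v v > 0"
    and linear_A: "linear A" and self_adjoint: "g (A v) w = g v (A w)"
begin

lemmas g_simps = bilinear_ladd[OF bilinear_g] bilinear_radd[OF bilinear_g] bilinear_lmul[OF bilinear_g]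
  bilinear_rmul[OF bilinear_g] bilinear_lsub[OF bilinear_g] bilinear_rsub[OF bilinear_g]
  bilinear_lzero[OF bilinear_g] bilinear_rzero[OF bilinear_g]

lemmas A_simps = linear_add[OF linear_A] linear_diff[OF linear_A] linear_scale[OF linear_A] linear_0[OF linear_A]

lemma g_eq_0_iff: "g v v = 0 \<longleftrightarrow> v = 0"
  using pos_g[of v] g_simps by fastforce

text \<open>A maximum \<open>y\<close> of the Rayleigh quotient on the Euclidean unit sphere of
  \<open>W\<close> is an eigenvector: the form \<open>b\<close> is positive semidefinite on
  \<open>W\<close> and vanishes at \<open>y\<close>, hence \<open>b y z = 0\<close> for the residual
  \<open>z\<close>, and \<open>b y z\<close> is the squared \<open>g\<close>-length of
  \<open>z\<close>.\<close>

lemma invariant_subspace_eigenvector: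
  assumes W: "subspace W" "x \<in> W" "x \<noteq> 0" and inv: "\<And>v. v \<in> W \<Longrightarrow> A v \<in> W"
  shows "\<exists>v\<in>W. v \<noteq> 0 \<and> (\<exists>\<mu>. A v = \<mu> *\<^sub>R v)"
proof -
  define K where "K = W \<inter> sphere 0 1"
  have bg: "bounded_bilinear g" using bilinear_g by (simp add: bilinear_conv_bounded_bilinear)
  have bA: "bounded_linear A" using linear_A by (simp add: linear_linear)
  have cont: "continuous_on K (\<lambda>v. g (A v) v / g v v)"
  proof (intro continuous_on_divide bounded_bilinear.continuous_on[OF bg] linear_continuous_on bA continuous_on_id
      bounded_linear_ident)
    show "\<forall>v\<in>K. g v v \<noteq> 0" unfolding g_eq_0_iff by (auto simp: K_def)
  qed
  have "compact K"
    unfolding K_def by (simp add: closed_Int_compact closed_subspace W)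
  moreover have "x /\<^sub>R norm x \<in> K"
    using W by (simp add: K_def subspace_scale)
  ultimately obtain y where y: "y \<in> K" "\<And>v. v \<in> K \<Longrightarrow> g (A v) v / g v v \<le> g (A y) y / g y y"
    using continuous_attains_sup[OF _ _ cont] by blast
  define \<mu> where "\<mu> = g (A y) y / g y y"
  have yW: "y \<in> W" "y \<noteq> 0" using y(1) by (auto simp: K_def)
  define b where "b v w = \<mu> * g v w - g (A v) w" for v w
  have b_psd: "b v v \<ge> 0" if "v \<in> W" for v
  proof (cases "v = 0")
    case True
    then show ?thesis by (simp add: b_def g_simps A_simps)
  next
    case False
    have "v /\<^sub>R norm v \<in> K"
      using that W(1) False by (simp add: K_def subspace_scale)
    from y(2)[OF this] have "g (A v) v / g v v \<le> \<mu>"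
      using False by (simp add: A_simps g_simps \<mu>_def)
    then show ?thesis using pos_g[OF False] by (simp add: b_def field_simps)
  qed
  have byy: "b y y = 0"
    using g_eq_0_iff yW by (simp add: b_def \<mu>_def)
  define z where "z = \<mu> *\<^sub>R y - A y"
  have zW: "z \<in> W" unfolding z_def using W(1) yW inv by (simp add: subspace_diff subspace_scale)
  define \<beta> where "\<beta> = b y z"
  define \<gamma> where "\<gamma> = b z z"
  have \<gamma>: "\<gamma> \<ge> 0" unfolding \<gamma>_def by (rule b_psd[OF zW])
  have bzy: "b z y = \<beta>"
    unfolding \<beta>_def b_def using self_adjoint[of z y] sym_g by simp
  have "\<beta> = 0"
  proof (rule ccontr)
    assume "\<beta> \<noteq> 0"
    \<comment> \<open>This makes the linear term win in
      \<open>2 * \<epsilon> * \<beta> + \<epsilon>\<^sup>2 * \<gamma>\<close>; the summand 1 keeps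
      the denominator positive when \<open>\<gamma> = 0\<close>.\<close>
    define \<epsilon> where "\<epsilon> = - \<beta> / (\<gamma> + 1)"
    have "y + \<epsilon> *\<^sub>R z \<in> W" using W(1) yW zW by (simp add: subspace_add subspace_scale)
    from b_psd[OF this] have "0 \<le> b y y + \<epsilon> * (b y z + b z y) + \<epsilon>\<^sup>2 * b z z"
      by (simp add: b_def g_simps A_simps algebra_simps power2_eq_square)
    then have "0 \<le> 2 * \<epsilon> * \<beta> + \<epsilon>\<^sup>2 * \<gamma>"
      using byy bzy by (simp add: \<beta>_def \<gamma>_def)
    then have "0 \<le> (\<gamma> + 1)\<^sup>2 * (2 * \<epsilon> * \<beta> + \<epsilon>\<^sup>2 * \<gamma>)" by simp
    also have "\<dots> = 2 * (\<gamma> + 1) * ((\<gamma> + 1) * \<epsilon>) * \<beta> + ((\<gamma> + 1) * \<epsilon>)\<^sup>2 * \<gamma>"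
      by (simp add: algebra_simps power2_eq_square)
    also have "(\<gamma> + 1) * \<epsilon> = - \<beta>" using \<gamma> by (simp add: \<epsilon>_def)
    also have "2 * (\<gamma> + 1) * - \<beta> * \<beta> + (- \<beta>)\<^sup>2 * \<gamma> = - (\<beta>\<^sup>2 * (\<gamma> + 2))"
      by (simp add: algebra_simps power2_eq_square)
    also have "\<dots> < 0" using \<gamma> \<open>\<beta> \<noteq> 0\<close> by simp
    finally show False by simp
  qed
  moreover have "\<beta> = g z z"
    unfolding \<beta>_def b_def by (subst (3) z_def) (simp add: g_simps)
  ultimately have "z = 0" using g_eq_0_iff by simp
  then show ?thesis using yW unfolding z_def by (metis eq_iff_diff_eq_0)
qed

lemma eigenvectors_orthogonal:
  assumes "A v = \<mu> *\<^sub>R v" "A w = \<kappa> *\<^sub>R w" "\<mu> \<noteq> \<kappa>"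
  shows "g v w = 0"
  using self_adjoint[of v w] assms by (simp add: g_simps)

text \<open>One eigenvector is chosen per eigenvalue; these are pairwise
  \<open>g\<close>-orthogonal, hence independent, so the dimension bounds their number.\<close>

lemma finite_eigenvalues: "finite {\<mu>. \<exists>v. v \<noteq> 0 \<and> A v = \<mu> *\<^sub>R v}" (is "finite ?E")
proof -
  obtain e where e: "\<And>\<mu>. \<mu> \<in> ?E \<Longrightarrow> e \<mu> \<noteq> 0 \<and> A (e \<mu>) = \<mu> *\<^sub>R e \<mu>"
    using bchoice[of ?E "\<lambda>\<mu> v. v \<noteq> 0 \<and> A v = \<mu> *\<^sub>R v"] by auto
  have inj: "inj_on e ?E"
    using e by (intro inj_onI) (metis scaleR_cancel_right)
  have "independent (e ` ?E)"
    unfolding independent_explicit_module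
  proof (intro allI impI)
    fix t u v
    assume t: "finite t" "t \<subseteq> e ` ?E" "(\<Sum>v\<in>t. u v *\<^sub>R v) = 0" "v \<in> t"
    have orth: "g w v = 0" if w: "w \<in> t" "w \<noteq> v" for w
    proof -
      obtain \<mu> \<kappa> where "w = e \<mu>" "\<mu> \<in> ?E" "v = e \<kappa>" "\<kappa> \<in> ?E"
        using w(1) t by blast
      then show ?thesis
        using e[of \<mu>] e[of \<kappa>] w(2) eigenvectors_orthogonal[of w \<mu> v \<kappa>] by auto
    qed
    have "g (\<Sum>w\<in>t. u w *\<^sub>R w) v = (\<Sum>w\<in>t. u w * g w v)"
    proof -
      have "linear (\<lambda>x. g x v)" using bilinear_g by (simp add: bilinear_def)
      from linear_sum[OF this, of "\<lambda>w. u w *\<^sub>R w" t] show ?thesis by (simp add: g_simps)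
    qed
    also have "\<dots> = (\<Sum>w\<in>t. if w = v then u v * g v v else 0)"
      by (rule sum.cong) (auto simp: orth)
    also have "\<dots> = u v * g v v" using t by simp
    finally have "u v * g v v = 0" using t by (simp add: g_simps)
    moreover have "v \<noteq> 0"
    proof -
      obtain \<kappa> where "v = e \<kappa>" "\<kappa> \<in> ?E" using t by blast
      then show ?thesis using e[of \<kappa>] by simp
    qed
    ultimately show "u v = 0" using g_eq_0_iff by simp
  qed
  then show ?thesis
    using independent_imp_finite finite_imageD[OF _ inj] by blast
qed

end

text \<open>The polynomial with roots \<open>ls\<close>, evaluated at \<open>A\<close>. Up to a
  constant it plays the role of a spectral projection, and it depends smoothly on
  \<open>A\<close>.\<close>

primrec shifted_product :: "('a::real_vector \<Rightarrow> 'a) \<Rightarrow> real list \<Rightarrow> 'a \<Rightarrow> 'a" where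
  "shifted_product A [] v = v"
| "shifted_product A (l # ls) v = A (shifted_product A ls v) - l *\<^sub>R shifted_product A ls v"

lemma shifted_product_eigenvector:
  assumes "linear A" "A v = \<mu> *\<^sub>R v"
  shows "shifted_product A ls v = (\<Prod>l\<leftarrow>ls. \<mu> - l) *\<^sub>R v"
  using assms by (induction ls) (simp_all add: linear_scale algebra_simps)

lemma linear_shifted_product: "linear A \<Longrightarrow> linear (shifted_product A ls)"
proof (induction ls)
  case Nil
  then show ?case by (simp add: linear_iff)
next
  case (Cons l ls)
  then show ?case by (simp add: linear_iff algebra_simps)
qed

lemma shifted_product_commute:
  assumes "linear A" shows "A (shifted_product A ls v) = shifted_product A ls (A v)"
  by (induction ls) (simp_all add: linear_diff[OF assms] linear_scale[OF assms])

text \<open>The range is invariant, so if nonzero it contains an eigenvector \<open>y\<close>.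
  Self-adjointness moves the whole product onto \<open>y\<close>, where the factor of its own
  eigenvalue vanishes, and \<open>y\<close> becomes orthogonal to itself.\<close>

lemma (in self_adjoint_operator) shifted_product_eq_0:
  assumes "\<And>\<mu> v. v \<noteq> 0 \<Longrightarrow> A v = \<mu> *\<^sub>R v \<Longrightarrow> \<mu> \<in> set ls"
  shows "shifted_product A ls v = 0"
proof (rule ccontr)
  assume "shifted_product A ls v \<noteq> 0"
  moreover have "subspace (range (shifted_product A ls))"
    using linear_subspace_image[OF linear_shifted_product[OF linear_A] subspace_UNIV] .
  ultimately obtain y \<mu> where y: "y \<in> range (shifted_product A ls)" "y \<noteq> 0" "A y = \<mu> *\<^sub>R y"
    using invariant_subspace_eigenvector[of "range (shifted_product A ls)"]
      shifted_product_commute[OF linear_A] by blast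
  then obtain z where z: "y = shifted_product A ls z" by blast
  have adj: "g (shifted_product A ls' z) y = (\<Prod>l\<leftarrow>ls'. \<mu> - l) * g z y" for ls'
    by (induction ls') (simp_all add: g_simps self_adjoint y(3) algebra_simps)
  have "(\<Prod>l\<leftarrow>ls. \<mu> - l) = 0"
    using assms[OF y(2,3)] by (force simp: prod_list_zero_iff)
  then have "g y y = 0" using adj[of ls] z by simp
  then show False using y(2) g_eq_0_iff by simp
qed

section \<open>A hypersurface in a chart\<close>

lemma bounded_bilinear_ip2: "bounded_bilinear (ip2 c)"
  unfolding bilinear_conv_bounded_bilinear[symmetric] bilinear_def
  by (auto intro!: linearI simp: ip2_def ip1_def algebra_simps inner_add_left inner_add_right)

lemma ip2_commute: "ip2 c x y = ip2 c y x"
  by (simp add: ip2_def ip1_def inner_commute)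

lemmas ip2_simps = bounded_bilinear.add_left[OF bounded_bilinear_ip2] bounded_bilinear.add_right[OF bounded_bilinear_ip2]
  bounded_bilinear.diff_left[OF bounded_bilinear_ip2] bounded_bilinear.diff_right[OF bounded_bilinear_ip2]
  bounded_bilinear.minus_left[OF bounded_bilinear_ip2] bounded_bilinear.minus_right[OF bounded_bilinear_ip2]
  bounded_bilinear.scaleR_left[OF bounded_bilinear_ip2] bounded_bilinear.scaleR_right[OF bounded_bilinear_ip2]
  bounded_bilinear.zero_left[OF bounded_bilinear_ip2] bounded_bilinear.zero_right[OF bounded_bilinear_ip2]

lemma ip2_dt: "ip2 c x dt = snd x" "ip2 c dt x = snd x"
  by (simp_all add: ip2_def ip1_def dt_def)

text \<open>Kept inside \<open>'n flat2\<close> so that the position in the space form, which is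
  also the normal of the product space, can be paired with other vectors by
  \<open>ip2\<close>.\<close>

definition space_part :: "'n::finite flat2 \<Rightarrow> 'n flat2" where
  "space_part x = (fst x, 0)"

lemma bounded_linear_space_part: "bounded_linear space_part"
  unfolding space_part_def by (intro bounded_linear_intros)

lemma space_part_eq: "space_part x = x - snd x *\<^sub>R dt"
  by (simp add: space_part_def dt_def prod_eq_iff)

text \<open>Here \<open>\<phi>\<close> and \<open>e\<close> are the immersion and its unit normal in the coordinates of a chart with image
  \<open>U\<close>; \<open>P\<close> is the position in the space form, and \<open>nu\<close>, \<open>T\<close>, \<open>sh\<close>, \<open>gg\<close> are the angle function, the
  field \<open>T\<close>, the shape operator and the metric.\<close>

locale immersed_chart =
  fixes c :: real and U :: "(real^'n::finite) set" and \<phi> e :: "real^'n \<Rightarrow> 'n flat2"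
  assumes c: "c \<in> {1, -1}" and open_U: "open U"
    and smooth_\<phi>: "smooth_on U \<phi>" and smooth_e: "smooth_on U e"
    and on_quadric: "u \<in> U \<Longrightarrow> ip1 c (fst (\<phi> u)) (fst (\<phi> u)) = c"
    and e_unit: "u \<in> U \<Longrightarrow> ip2 c (e u) (e u) = 1"
    and e_tangent: "u \<in> U \<Longrightarrow> ip2 c (e u) (fst (\<phi> u), 0) = 0"
    and e_normal: "u \<in> U \<Longrightarrow> ip2 c (e u) (D \<phi> u v) = 0"
    and immersion: "u \<in> U \<Longrightarrow> v \<noteq> 0 \<Longrightarrow> ip2 c (D \<phi> u v) (D \<phi> u v) > 0"
begin

definition P where "P u = space_part (\<phi> u)"
definition nu where "nu u = snd (e u)"
definition T where "T u = (THE w. dt = D \<phi> u w + nu u *\<^sub>R e u)"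
definition sh where "sh u v = (THE w. D \<phi> u w = - tangent_proj c (\<phi> u) (D e u v))"
definition gg where "gg u v w = ip2 c (D \<phi> u v) (D \<phi> u w)"

section \<open>Orthogonality relations between position, unit normal and tangent vectors\<close>

lemma cc: "c * c = 1" using c by auto

lemma smooth_P: "smooth_on U P"
  unfolding P_def using smooth_on_linear[OF open_U bounded_linear_space_part smooth_\<phi>] .

lemma smooth_nu: "smooth_on U nu"
  unfolding nu_def using smooth_on_linear[OF open_U bounded_linear_snd smooth_e] .

lemma smooth_ip2: "smooth_on U f \<Longrightarrow> smooth_on U h \<Longrightarrow> smooth_on U (\<lambda>u. ip2 c (f u) (h u))"
  by (rule smooth_on_bilinear[OF open_U bounded_bilinear_ip2])

lemma lin: "u \<in> U \<Longrightarrow> linear (D \<phi> u)"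
  by (rule linear_D[OF smooth_on_differentiable[OF smooth_\<phi>]])

lemma lin_e: "u \<in> U \<Longrightarrow> linear (D e u)"
  by (rule linear_D[OF smooth_on_differentiable[OF smooth_e]])

lemmas lin_simps = linear_add[OF lin] linear_diff[OF lin] linear_scale[OF lin] linear_0[OF lin] linear_neg[OF lin]

lemma D_eq_iff: "u \<in> U \<Longrightarrow> D \<phi> u v = D \<phi> u w \<longleftrightarrow> v = w"
proof
  assume u: "u \<in> U" and eq: "D \<phi> u v = D \<phi> u w"
  show "v = w"
  proof (rule ccontr)
    assume "v \<noteq> w"
    then have "ip2 c (D \<phi> u (v - w)) (D \<phi> u (v - w)) > 0" using immersion[OF u] by simp
    then show False using eq by (simp add: lin_simps[OF u] ip2_simps)
  qed
qed simp

lemma inj_D: "u \<in> U \<Longrightarrow> inj (D \<phi> u)"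
  by (simp add: inj_def D_eq_iff)

lemma PP: "u \<in> U \<Longrightarrow> ip2 c (P u) (P u) = c"
  by (simp add: P_def ip2_def space_part_def on_quadric)

lemma eP: "u \<in> U \<Longrightarrow> ip2 c (e u) (P u) = 0"
  by (simp add: P_def e_tangent space_part_def)

lemma lie_ip2:
  assumes "u \<in> U" "smooth_on U f" "smooth_on U h"
  shows "lie X (\<lambda>u. ip2 c (f u) (h u)) u = ip2 c (lie X f u) (h u) + ip2 c (f u) (lie X h u)"
  by (rule lie_bilinear[OF bounded_bilinear_ip2]) (use assms smooth_on_differentiable in blast)+

lemma lie_ip2_const:
  assumes "u \<in> U" "smooth_on U f" "smooth_on U h" "\<And>u. u \<in> U \<Longrightarrow> ip2 c (f u) (h u) = k"
  shows "ip2 c (lie X f u) (h u) = - ip2 c (f u) (lie X h u)"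
proof -
  have "lie X (\<lambda>u. ip2 c (f u) (h u)) u = lie X (\<lambda>u. k) u"
    by (rule lie_cong[OF open_U assms(1)]) (use assms(4) in auto)
  then show ?thesis using lie_ip2[OF assms(1-3), of X] by simp
qed

lemma D_ip2_const:
  assumes "u \<in> U" "smooth_on U f" "smooth_on U h" "\<And>u. u \<in> U \<Longrightarrow> ip2 c (f u) (h u) = k"
  shows "ip2 c (D f u v) (h u) = - ip2 c (f u) (D h u v)"
  using lie_ip2_const[OF assms, of "\<lambda>_. v"] by (simp add: lie_def)

lemma D_P: "u \<in> U \<Longrightarrow> D P u v = space_part (D \<phi> u v)"
  unfolding P_def
  by (rule frechet_derivative_linear_compose(1)[OF bounded_linear_space_part smooth_on_differentiable[OF smooth_\<phi>]])

lemma ip2_space_part: "ip2 c (space_part x) (space_part y) = ip2 c (space_part x) y"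
  by (simp add: space_part_def ip2_def)

text \<open>Comes from differentiating \<open>ip2 c (P u) (P u) = c\<close>; the height component of
  \<open>D \<phi> u v\<close> is invisible to \<open>P u\<close>.\<close>

lemma P_D: assumes u: "u \<in> U" shows "ip2 c (P u) (D \<phi> u v) = 0"
proof -
  have "ip2 c (D P u v) (P u) = ip2 c (P u) (D \<phi> u v)" "ip2 c (P u) (D P u v) = ip2 c (P u) (D \<phi> u v)"
    unfolding D_P[OF u] P_def by (metis ip2_commute ip2_space_part)+
  then show ?thesis using D_ip2_const[OF u smooth_P smooth_P PP, of v] by simp
qed

lemma D_P': "u \<in> U \<Longrightarrow> ip2 c (D \<phi> u v) (P u) = 0"
  using P_D ip2_commute by metis

lemma D_e: "u \<in> U \<Longrightarrow> ip2 c (D \<phi> u v) (e u) = 0"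
  using e_normal ip2_commute by metis

lemma Pe: "u \<in> U \<Longrightarrow> ip2 c (P u) (e u) = 0"
  using eP ip2_commute by metis

text \<open>A dimension count: pairing with \<open>e\<close> and \<open>P\<close> recovers the two
  scalar coefficients, so \<open>L\<close> is injective between spaces of dimension n + 2. The
  factor \<open>c\<close> appears because \<open>P\<close> has square \<open>c\<close>, which is its
  own inverse.\<close>

lemma frame:
  assumes u: "u \<in> U"
  shows "\<exists>w. y = D \<phi> u w + ip2 c y (e u) *\<^sub>R e u + (c * ip2 c y (P u)) *\<^sub>R P u"
proof -
  define L where "L z = D \<phi> u (fst z) + fst (snd z) *\<^sub>R e u + snd (snd z) *\<^sub>R P u" for z :: "(real^'n) \<times> real \<times> real"
  have ipe: "ip2 c (L z) (e u) = fst (snd z)" and ipP: "ip2 c (L z) (P u) = c * snd (snd z)" for z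
    using u by (simp_all add: L_def ip2_simps D_e D_P' e_unit eP Pe PP)
  have linL: "linear L"
    by (intro linearI) (simp_all add: L_def lin_simps[OF u] algebra_simps)
  have "inj L"
  proof (subst linear_injective_0[OF linL], intro allI impI)
    fix z assume z: "L z = 0"
    have "fst (snd z) = 0" "c * snd (snd z) = 0"
      using ipe[of z] ipP[of z] z by (simp_all add: ip2_simps)
    moreover from this have "snd (snd z) = 0" using c by auto
    moreover from calculation have "D \<phi> u (fst z) = D \<phi> u 0"
      using z lin_simps(4)[OF u] by (simp add: L_def)
    ultimately show "z = 0" using D_eq_iff[OF u] by (simp add: prod_eq_iff)
  qed
  then have "dim (range L) = DIM('n flat2)"
    using dim_image_eq[of L UNIV] linL by (simp add: inj_on_def)
  then have "span (range L) = UNIV" by (rule dim_eq_full[THEN iffD1])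
  moreover have "span (range L) = range L"
    using linear_subspace_image[OF linL subspace_UNIV] span_eq_iff by blast
  ultimately obtain z where z: "y = L z" by (metis UNIV_I imageE)
  have "c * ip2 c y (P u) = snd (snd z)"
    unfolding z ipP using cc by (simp add: mult.assoc[symmetric])
  then show ?thesis
    using ipe[of z] by (intro exI[of _ "fst z"]) (simp add: z[symmetric], simp add: z L_def)
qed

section \<open>The field T and the shape operator\<close>

lemma D_T: assumes u: "u \<in> U" shows "D \<phi> u (T u) = dt - nu u *\<^sub>R e u"
proof -
  obtain w where "dt = D \<phi> u w + ip2 c dt (e u) *\<^sub>R e u + (c * ip2 c dt (P u)) *\<^sub>R P u"
    using frame[OF u] by blast
  moreover have "ip2 c dt (P u) = 0" by (simp add: ip2_dt P_def space_part_def)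
  ultimately have w: "dt = D \<phi> u w + nu u *\<^sub>R e u" by (simp add: ip2_dt nu_def)
  have "T u = w"
    unfolding T_def
  proof (rule the_equality)
    show "dt = D \<phi> u w + nu u *\<^sub>R e u" by (rule w)
    fix x assume "dt = D \<phi> u x + nu u *\<^sub>R e u"
    then show "x = w" using w D_eq_iff[OF u] by (metis add_right_cancel)
  qed
  then show ?thesis using w by (simp add: algebra_simps)
qed

lemma gg_T: "u \<in> U \<Longrightarrow> gg u v (T u) = snd (D \<phi> u v)"
  by (simp add: gg_def D_T ip2_simps ip2_dt D_e)

lemma gg_TT: "u \<in> U \<Longrightarrow> gg u (T u) (T u) = 1 - (nu u)\<^sup>2"
  by (simp add: gg_T D_T nu_def dt_def power2_eq_square)

lemma D_P_eq: "u \<in> U \<Longrightarrow> D P u v = D \<phi> u v - gg u v (T u) *\<^sub>R dt"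
  by (simp add: D_P space_part_eq gg_T)

text \<open>Comes from differentiating the orthogonality of \<open>e\<close> and \<open>P\<close>:
  only the height component, in which \<open>D P\<close> differs from \<open>D \<phi>\<close>,
  contributes.\<close>

lemma De_P: "u \<in> U \<Longrightarrow> ip2 c (D e u v) (P u) = nu u * gg u v (T u)"
  using D_ip2_const[OF _ smooth_e smooth_P eP, of u v]
  by (simp add: D_P_eq ip2_simps e_normal ip2_dt nu_def)

lemma De_e: "u \<in> U \<Longrightarrow> ip2 c (D e u v) (e u) = 0"
  using D_ip2_const[OF _ smooth_e smooth_e e_unit, of u v] ip2_commute[of c "e u" "D e u v"] by simp

lemma tangent_proj_De: "u \<in> U \<Longrightarrow> tangent_proj c (\<phi> u) (D e u v) = D e u v - (c * nu u * gg u v (T u)) *\<^sub>R P u"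
  using De_P[of u v] by (simp add: tangent_proj_def P_def space_part_def)

text \<open>The Weingarten formula in the flat space. As \<open>e\<close> is a unit field,
  \<open>D e\<close> has no \<open>e\<close>-component, so by \<open>frame\<close> it is tangent up
  to a multiple of \<open>P\<close>, and that multiple is what \<open>tangent_proj\<close>
  removes.\<close>

lemma D_sh: assumes u: "u \<in> U" shows "D \<phi> u (sh u v) = - D e u v + (c * nu u * gg u v (T u)) *\<^sub>R P u"
proof -
  obtain w where w0: "D e u v = D \<phi> u w + ip2 c (D e u v) (e u) *\<^sub>R e u + (c * ip2 c (D e u v) (P u)) *\<^sub>R P u"
    using frame[OF u] by blast
  then have "D \<phi> u w = D e u v - (c * nu u * gg u v (T u)) *\<^sub>R P u"
    unfolding De_e[OF u] De_P[OF u] by (simp add: algebra_simps)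
  then have w: "D \<phi> u (- w) = - tangent_proj c (\<phi> u) (D e u v)"
    unfolding tangent_proj_De[OF u] lin_simps[OF u] by simp
  have "sh u v = - w"
    unfolding sh_def
  proof (rule the_equality)
    show "D \<phi> u (- w) = - tangent_proj c (\<phi> u) (D e u v)" by (rule w)
  qed (metis w D_eq_iff[OF u])
  then show ?thesis using w by (simp add: tangent_proj_De[OF u])
qed

lemma De_eq: "u \<in> U \<Longrightarrow> D e u v = - D \<phi> u (sh u v) + (c * nu u * gg u v (T u)) *\<^sub>R P u"
  by (simp add: D_sh)

lemma linear_sh: assumes u: "u \<in> U" shows "linear (sh u)"
proof (rule linearI)
  show "sh u (a + b) = sh u a + sh u b" for a b
    by (subst D_eq_iff[OF u, symmetric])
      (simp add: lin_simps[OF u] D_sh[OF u] linear_add[OF lin_e[OF u]] gg_T[OF u] algebra_simps)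
  show "sh u (r *\<^sub>R a) = r *\<^sub>R sh u a" for r a
    by (subst D_eq_iff[OF u, symmetric])
      (simp add: lin_simps[OF u] D_sh[OF u] linear_scale[OF lin_e[OF u]] gg_T[OF u] algebra_simps)
qed

text \<open>Differentiating the orthogonality of \<open>e\<close> and \<open>D \<phi> u v\<close>
  for a fixed coordinate vector \<open>v\<close> identifies the second fundamental form with the
  normal part of the Hessian of \<open>\<phi>\<close>. Self-adjointness is then the symmetry of
  second derivatives.\<close>

lemma gg_sh: assumes u: "u \<in> U" shows "gg u (sh u w) v = ip2 c (e u) (D (\<lambda>u. D \<phi> u v) u w)"
  using D_ip2_const[OF u smooth_e smooth_on_D[OF smooth_\<phi>, of v] e_normal, of w]
  by (simp add: gg_def D_sh[OF u] ip2_simps P_D[OF u])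

lemma gg_commute: "gg u v w = gg u w v"
  by (simp add: gg_def ip2_commute)

lemma self_adjoint_sh: assumes u: "u \<in> U" shows "self_adjoint_operator (gg u) (sh u)"
proof (rule self_adjoint_operator.intro)
  show "bilinear (gg u)"
    by (auto intro!: linearI simp: bilinear_def gg_def lin_simps[OF u] ip2_simps)
  show "gg u v w = gg u w v" for v w by (rule gg_commute)
  show "v \<noteq> 0 \<Longrightarrow> 0 < gg u v v" for v using immersion[OF u] by (simp add: gg_def)
  show "linear (sh u)" by (rule linear_sh[OF u])
  show "gg u (sh u v) w = gg u v (sh u w)" for v w
    using symmetric_second_derivative[OF open_U u, of \<phi> v w] smooth_\<phi>
    by (simp add: gg_commute[of u v] gg_sh[OF u] smooth_on_def)
qed

lemma smooth_gg: "smooth_on U X \<Longrightarrow> smooth_on U Y \<Longrightarrow> smooth_on U (\<lambda>u. gg u (X u) (Y u))"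
  using smooth_ip2[OF smooth_on_lie[OF open_U _ smooth_\<phi>] smooth_on_lie[OF open_U _ smooth_\<phi>], of X Y]
  by (simp add: gg_def lie_def)

text \<open>\<open>T\<close> and \<open>sh\<close> are defined by unique existence, so their
  smoothness has to come from the linear equations \<open>D_T\<close> and \<open>D_sh\<close>
  through \<open>smooth_on_solve\<close>.\<close>

lemma smooth_T: "smooth_on U T"
proof (rule smooth_on_solve[where L = "D \<phi>" and b = "\<lambda>u. dt - nu u *\<^sub>R e u"])
  show "smooth_on U (\<lambda>u. dt - nu u *\<^sub>R e u)"
    by (intro smooth_on_diff smooth_on_scaleR smooth_on_const open_U smooth_nu smooth_e)
qed (use lin inj_D D_T smooth_on_D[OF smooth_\<phi>] open_U in auto)

lemma smooth_sh: assumes X: "smooth_on U X" shows "smooth_on U (\<lambda>u. sh u (X u))"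
proof (rule smooth_on_solve[where L = "D \<phi>" and b = "\<lambda>u. - lie X e u + (c * nu u * gg u (X u) (T u)) *\<^sub>R P u"])
  show "smooth_on U (\<lambda>u. - lie X e u + (c * nu u * gg u (X u) (T u)) *\<^sub>R P u)"
    by (intro smooth_on_add smooth_on_minus smooth_on_lie smooth_on_scaleR smooth_on_mult smooth_gg
        smooth_on_const open_U smooth_nu smooth_e smooth_T smooth_P X)
qed (use lin inj_D D_sh smooth_on_D[OF smooth_\<phi>] open_U in \<open>auto simp: lie_def\<close>)

lemma smooth_shifted_product:
  assumes X: "smooth_on U X" shows "smooth_on U (\<lambda>u. shifted_product (sh u) ls (X u))"
proof (induction ls)
  case Nil
  then show ?case using X by simp
next
  case (Cons l ls)
  then show ?case
    by (simp, intro smooth_on_diff open_U smooth_sh smooth_on_scaleR smooth_on_const)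
qed

text \<open>Orthogonality to \<open>T\<close> is built in, so that the direction of \<open>T\<close>
  is excluded even where its curvature equals \<open>\<mu>\<close>. Zeros of the field are
  allowed.\<close>

definition eigfield where
  "eigfield \<mu> X \<longleftrightarrow> smooth_on U X \<and> (\<forall>u\<in>U. sh u (X u) = \<mu> *\<^sub>R X u \<and> gg u (X u) (T u) = 0)"

end

section \<open>Constant principal curvatures\<close>

text \<open>The set \<open>\<Lambda>\<close> is the same at all points, while the curvature
  \<open>lam\<close> of \<open>T\<close> may still vary; its vanishing is derived once
  \<open>nu\<close> is known to be constant.\<close>

locale constant_curvature_chart = immersed_chart c U \<phi> e
  for c U and \<phi> e :: "real^'n::finite \<Rightarrow> 'n flat2" +
  fixes \<Lambda> :: "real set" and lam
  assumes nu_nonzero: "u \<in> U \<Longrightarrow> nu u \<noteq> 0"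
    and T_nonzero: "u \<in> U \<Longrightarrow> T u \<noteq> 0"
    and sh_T: "u \<in> U \<Longrightarrow> sh u (T u) = lam u *\<^sub>R T u"
    and spectrum: "u \<in> U \<Longrightarrow> {\<mu>. \<exists>v. v \<noteq> 0 \<and> sh u v = \<mu> *\<^sub>R v} = \<Lambda>"
begin

lemma gg_TT_pos: "u \<in> U \<Longrightarrow> gg u (T u) (T u) > 0"
  using immersion T_nonzero by (simp add: gg_def)

text \<open>Each factor of the product over the other eigenvalues kills an eigenspace, so applying the product
  to a constant vector gives an eigenvector field.\<close>

lemma eigfield_extension:
  assumes p: "p \<in> U" and mu: "\<mu> \<in> \<Lambda>" and x: "sh p x = \<mu> *\<^sub>R x" "gg p x (T p) = 0"
  shows "\<exists>X. eigfield \<mu> X \<and> X p = x"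
proof -
  have fin: "finite \<Lambda>"
    using self_adjoint_operator.finite_eigenvalues[OF self_adjoint_sh[OF p]] spectrum[OF p] by simp
  obtain ls where ls: "set ls = \<Lambda> - {\<mu>}" using finite_list[OF finite_Diff[OF fin]] by metis
  define k where "k = (\<Prod>l\<leftarrow>ls. \<mu> - l)"
  have k: "k \<noteq> 0" unfolding k_def prod_list_zero_iff set_map ls by (simp add: image_iff)
  \<comment> \<open>At \<open>p\<close> the product multiplies the eigenvector \<open>x\<close> by
    \<open>k\<close>, so the division gives \<open>X p = x\<close>.\<close>
  define X where "X u = shifted_product (sh u) ls (x /\<^sub>R k)" for u
  have X: "smooth_on U X"
    unfolding X_def by (rule smooth_shifted_product[OF smooth_on_const])
  have shX: "sh u (X u) = \<mu> *\<^sub>R X u" if "u \<in> U" for u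
  proof -
    have "shifted_product (sh u) (\<mu> # ls) (x /\<^sub>R k) = 0"
    proof (rule self_adjoint_operator.shifted_product_eq_0[OF self_adjoint_sh[OF that]])
      fix \<kappa> v assume "v \<noteq> 0" "sh u v = \<kappa> *\<^sub>R v"
      then have "\<kappa> \<in> \<Lambda>" using spectrum[OF that] by blast
      then show "\<kappa> \<in> set (\<mu> # ls)" using ls mu by auto
    qed
    then show ?thesis by (simp add: X_def)
  qed
  have Xp: "X p = x"
    unfolding X_def using k x
    by (subst shifted_product_eigenvector[OF linear_sh[OF p], of _ \<mu>])
      (simp_all add: linear_scale[OF linear_sh[OF p]] k_def)
  \<comment> \<open>Removing the \<open>T\<close>-component preserves the eigenvector equation: if
    \<open>\<mu> = lam u\<close>, then \<open>T u\<close> lies in the same eigenspace, and otherwise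
    the component is already zero.\<close>
  define Y where "Y u = X u - (gg u (X u) (T u) * inverse (gg u (T u) (T u))) *\<^sub>R T u" for u
  have Y: "smooth_on U Y"
    unfolding Y_def
    by (intro smooth_on_diff smooth_on_scaleR smooth_on_mult smooth_on_inverse smooth_gg open_U X smooth_T)
      (use gg_TT_pos in force)
  have shY: "sh u (Y u) = \<mu> *\<^sub>R Y u \<and> gg u (Y u) (T u) = 0" if u: "u \<in> U" for u
  proof
    interpret A: self_adjoint_operator "gg u" "sh u" by (rule self_adjoint_sh[OF u])
    show "gg u (Y u) (T u) = 0" using gg_TT_pos[OF u] by (simp add: Y_def A.g_simps)
    show "sh u (Y u) = \<mu> *\<^sub>R Y u"
    proof (cases "\<mu> = lam u")
      case True
      then show ?thesis by (simp add: Y_def A.A_simps shX[OF u] sh_T[OF u] algebra_simps)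
    next
      case False
      then have "gg u (X u) (T u) = 0"
        by (rule A.eigenvectors_orthogonal[OF shX[OF u] sh_T[OF u]])
      then show ?thesis by (simp add: Y_def shX[OF u])
    qed
  qed
  have "Y p = x" using x(2) by (simp add: Y_def Xp)
  then show ?thesis using Y shY unfolding eigfield_def by blast
qed

section \<open>Eigenfields and the Codazzi equation\<close>

lemma smooth_lie_\<phi>: "smooth_on U X \<Longrightarrow> smooth_on U (lie X \<phi>)"
  by (rule smooth_on_lie[OF open_U _ smooth_\<phi>])

lemma eigfieldD:
  assumes "eigfield \<mu> X"
  shows "smooth_on U X" "smooth_on U (lie X \<phi>)"
    and "u \<in> U \<Longrightarrow> sh u (X u) = \<mu> *\<^sub>R X u" "u \<in> U \<Longrightarrow> gg u (X u) (T u) = 0"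
    and "u \<in> U \<Longrightarrow> lie X e u = (- \<mu>) *\<^sub>R lie X \<phi> u" "u \<in> U \<Longrightarrow> lie X P u = lie X \<phi> u"
    and "u \<in> U \<Longrightarrow> snd (lie X \<phi> u) = 0"
  using assms smooth_lie_\<phi>
  by (auto simp: eigfield_def lie_def De_eq lin_simps D_P_eq gg_T[symmetric])

lemma lie_\<phi>_orthogonal:
  assumes "u \<in> U"
  shows "ip2 c (e u) (lie X \<phi> u) = 0" "ip2 c (lie X \<phi> u) (e u) = 0"
    "ip2 c (P u) (lie X \<phi> u) = 0" "ip2 c (lie X \<phi> u) (P u) = 0"
  using assms by (simp_all add: lie_def e_normal D_e P_D D_P')

lemma eigenvectors_gg:
  assumes "u \<in> U" "sh u v = \<mu> *\<^sub>R v" "sh u w = \<kappa> *\<^sub>R w" "\<mu> \<noteq> \<kappa>"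
  shows "gg u v w = 0"
  using self_adjoint_operator.eigenvectors_orthogonal[OF self_adjoint_sh[OF assms(1)] assms(2-4)] .

lemma commutator_\<phi>:
  "u \<in> U \<Longrightarrow> smooth_on U X \<Longrightarrow> smooth_on U Y \<Longrightarrow>
    lie X (lie Y \<phi>) u - lie Y (lie X \<phi>) u = D \<phi> u (lie X Y u - lie Y X u)"
  by (rule lie_commutator[OF open_U _ _ _ smooth_\<phi>])

lemma commutator_e:
  "u \<in> U \<Longrightarrow> smooth_on U X \<Longrightarrow> smooth_on U Y \<Longrightarrow>
    lie X (lie Y e) u - lie Y (lie X e) u = D e u (lie X Y u - lie Y X u)"
  by (rule lie_commutator[OF open_U _ _ _ smooth_e])

lemma lie_lie_e:
  assumes "eigfield \<mu> Y" "u \<in> U"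
  shows "lie X (lie Y e) u = (- \<mu>) *\<^sub>R lie X (lie Y \<phi>) u"
proof -
  have "lie X (lie Y e) u = lie X (\<lambda>u. (- \<mu>) *\<^sub>R lie Y \<phi> u) u"
    by (rule lie_cong[OF open_U assms(2)]) (rule eigfieldD(5)[OF assms(1)])
  also have "\<dots> = (- \<mu>) *\<^sub>R lie X (lie Y \<phi>) u"
    by (rule lie_linear[OF bounded_linear_scaleR_right
          smooth_on_differentiable[OF eigfieldD(2)[OF assms(1)] assms(2)]])
  finally show ?thesis .
qed

lemma ip2_De_D: "u \<in> U \<Longrightarrow> ip2 c (D e u v) (D \<phi> u w) = - gg u (sh u v) w"
  by (simp add: De_eq ip2_simps gg_def P_D)

lemma gg_sh_eigenvector:
  "u \<in> U \<Longrightarrow> sh u x = \<mu> *\<^sub>R x \<Longrightarrow> gg u (sh u v) x = \<mu> * gg u v x"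
  using self_adjoint_operator.self_adjoint[OF self_adjoint_sh, of u v x]
  by (simp add: self_adjoint_operator.g_simps[OF self_adjoint_sh])

text \<open>The Codazzi equation in the directions \<open>X\<close>, \<open>T\<close>: expand the commutator of the two fields on the
  normal \<open>e\<close> and pair it with \<open>X\<close>.\<close>

lemma curvature_equation:
  assumes X: "eigfield \<mu> X" and p: "p \<in> U" and Xp: "X p \<noteq> 0"
  shows "\<mu>\<^sup>2 - lam p * \<mu> + c * gg p (T p) (T p) = 0"
proof -
  note XD = eigfieldD[OF X]
  define Z where "Z u = sh u (T u)" for u
  have Z: "smooth_on U Z" unfolding Z_def by (rule smooth_sh[OF smooth_T])
  define q where "q u = c * nu u * gg u (T u) (T u)" for u
  have q: "smooth_on U q"
    unfolding q_def by (intro smooth_on_mult smooth_on_const open_U smooth_nu smooth_gg smooth_T)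
  define R where "R = lie X \<phi> p"
  define r where "r = ip2 c R R"
  define y where "y = ip2 c (lie T (lie X \<phi>) p) R"
  define K where "K = lie X T p - lie T X p"
  have r: "r > 0" unfolding r_def R_def lie_def using immersion[OF p Xp] .
  have gTX: "ip2 c (lie T \<phi> u) (lie X \<phi> u) = 0" if "u \<in> U" for u
    using XD(4)[OF that] by (simp add: gg_def lie_def ip2_commute)
  have gZX: "ip2 c (lie Z \<phi> u) (lie X \<phi> u) = 0" if "u \<in> U" for u
    using gTX[OF that] by (simp add: lie_def Z_def sh_T[OF that] lin_simps[OF that] ip2_simps)
  have A1: "ip2 c (lie X (lie T \<phi>) p) R = nu p * \<mu> * r"
  proof -
    have "lie X (lie T \<phi>) p = lie X (\<lambda>u. dt - nu u *\<^sub>R e u) p"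
      by (rule lie_cong[OF open_U p]) (simp add: lie_def D_T)
    also have "\<dots> = - (lie X nu p *\<^sub>R e p + nu p *\<^sub>R lie X e p)"
      using smooth_on_differentiable[OF smooth_nu p] smooth_on_differentiable[OF smooth_e p]
        smooth_on_differentiable[OF smooth_on_scaleR[OF open_U smooth_nu smooth_e] p]
      by (simp add: lie_diff lie_bilinear[OF bounded_bilinear_scaleR])
    finally show ?thesis
      by (simp add: ip2_simps R_def lie_\<phi>_orthogonal[OF p] XD(5)[OF p] r_def)
  qed
  \<comment> \<open>Orthogonality moves the derivative from \<open>Z\<close> to \<open>X\<close>;
    now \<open>Z\<close> is only evaluated at \<open>p\<close>, where it is \<open>lam p\<close>
    times \<open>T\<close>, and moving the derivative back reduces the claim to
    \<open>A1\<close>.\<close>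
  have A2: "ip2 c (lie X (lie Z \<phi>) p) R = lam p * (nu p * \<mu> * r)"
  proof -
    have "ip2 c (lie X (lie Z \<phi>) p) R = - ip2 c (lie Z \<phi> p) (lie X (lie X \<phi>) p)"
      unfolding R_def by (rule lie_ip2_const[OF p smooth_lie_\<phi>[OF Z] XD(2) gZX])
    also have "\<dots> = lam p * - ip2 c (lie T \<phi> p) (lie X (lie X \<phi>) p)"
      by (simp add: lie_def[of Z] lie_def[of T] Z_def sh_T[OF p] lin_simps[OF p] ip2_simps)
    also have "- ip2 c (lie T \<phi> p) (lie X (lie X \<phi>) p) = ip2 c (lie X (lie T \<phi>) p) R"
      unfolding R_def by (rule lie_ip2_const[OF p smooth_lie_\<phi>[OF smooth_T] XD(2) gTX, symmetric])
    finally show ?thesis unfolding A1 .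
  qed
  have A3: "ip2 c (lie X (lie T e) p) R = - (lam p * (nu p * \<mu> * r)) + q p * r"
  proof -
    have "lie X (lie T e) p = lie X (\<lambda>u. q u *\<^sub>R P u - lie Z \<phi> u) p"
      by (rule lie_cong[OF open_U p]) (simp add: lie_def De_eq q_def Z_def)
    also have "\<dots> = lie X q p *\<^sub>R P p + q p *\<^sub>R lie X P p - lie X (lie Z \<phi>) p"
      using smooth_on_differentiable[OF q p] smooth_on_differentiable[OF smooth_P p]
        smooth_on_differentiable[OF smooth_on_scaleR[OF open_U q smooth_P] p]
        smooth_on_differentiable[OF smooth_lie_\<phi>[OF Z] p]
      by (simp add: lie_diff lie_bilinear[OF bounded_bilinear_scaleR])
    finally show ?thesis
      by (simp add: ip2_simps A2) (simp add: R_def lie_\<phi>_orthogonal[OF p] XD(6)[OF p] r_def)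
  qed
  have A4: "ip2 c (lie T (lie X e) p) R = - \<mu> * y"
    unfolding lie_lie_e[OF X p] y_def by (simp add: ip2_simps)
  have A5: "ip2 c (D e p K) R = - \<mu> * ip2 c (D \<phi> p K) R"
    using ip2_De_D[OF p, of K "X p"] gg_sh_eigenvector[OF p XD(3)[OF p], of K]
    by (simp add: R_def lie_def gg_def)
  \<comment> \<open>The unknown \<open>y\<close>, from the derivative of \<open>X\<close> along
    \<open>T\<close>, occurs in both commutators and drops out when \<open>A5\<close> compares
    them.\<close>
  have "ip2 c (D \<phi> p K) R = nu p * \<mu> * r - y"
    using commutator_\<phi>[OF p XD(1) smooth_T] A1 unfolding y_def K_def by (metis ip2_simps(3))
  moreover have "ip2 c (D e p K) R = - (lam p * (nu p * \<mu> * r)) + q p * r + \<mu> * y"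
    using commutator_e[OF p XD(1) smooth_T] A3 A4 unfolding K_def
    by (metis diff_minus_eq_add ip2_simps(3) mult_minus_left)
  ultimately have "- \<mu> * (nu p * \<mu> * r - y) = - (lam p * (nu p * \<mu> * r)) + q p * r + \<mu> * y"
    using A5 by simp
  then have "nu p * r * (\<mu>\<^sup>2 - lam p * \<mu> + c * gg p (T p) (T p)) = 0"
    by (simp add: q_def algebra_simps power2_eq_square)
  then show ?thesis using r nu_nonzero[OF p] by simp
qed

section \<open>The possible values of the angle function\<close>

lemma lam_in_spectrum: "u \<in> U \<Longrightarrow> lam u \<in> \<Lambda>"
  using spectrum[of u] sh_T[of u] T_nonzero[of u] by blast

lemma orthogonal_eigenvalue:
  assumes p: "p \<in> U" and x: "x \<noteq> 0" "sh p x = \<mu> *\<^sub>R x" "gg p x (T p) = 0"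
  shows "\<mu> \<in> \<Lambda>" "\<mu>\<^sup>2 - lam p * \<mu> + c * gg p (T p) (T p) = 0"
proof -
  show mu: "\<mu> \<in> \<Lambda>" using x spectrum[OF p] by blast
  then obtain X where "eigfield \<mu> X" "X p = x"
    using eigfield_extension[OF p _ x(2,3)] by blast
  then show "\<mu>\<^sup>2 - lam p * \<mu> + c * gg p (T p) (T p) = 0"
    using curvature_equation p x(1) by blast
qed

lemma finite_\<Lambda>: "u \<in> U \<Longrightarrow> finite \<Lambda>"
  using self_adjoint_operator.finite_eigenvalues[OF self_adjoint_sh, of u] spectrum by simp

text \<open>The orthogonal complement of \<open>T\<close> is invariant because \<open>T\<close> is
  an eigenvector, and it is nonzero in dimension at least two.\<close>

lemma exists_orthogonal_eigenvector:
  assumes p: "p \<in> U" and n: "CARD('n) \<ge> 2"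
  shows "\<exists>x \<mu>. x \<noteq> 0 \<and> sh p x = \<mu> *\<^sub>R x \<and> gg p x (T p) = 0"
proof -
  interpret A: self_adjoint_operator "gg p" "sh p" by (rule self_adjoint_sh[OF p])
  define W where "W = {v. gg p v (T p) = 0}"
  have W: "subspace W" by (auto simp: W_def subspace_def A.g_simps)
  have "dim (span {T p}) < DIM(real^'n)"
    using n dim_le_card'[of "{T p}"] by (simp add: dim_span)
  then have "span {T p} \<noteq> UNIV" by (metis dim_UNIV less_irrefl)
  then obtain v where v: "v \<notin> span {T p}" by blast
  define x where "x = v - (gg p v (T p) / gg p (T p) (T p)) *\<^sub>R T p"
  have "x \<in> W" using gg_TT_pos[OF p] by (simp add: W_def x_def A.g_simps)
  moreover have "x \<noteq> 0"
    using v span_scale[OF span_base[of "T p" "{T p}"], of "gg p v (T p) / gg p (T p) (T p)"]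
    by (auto simp: x_def)
  moreover have "sh p w \<in> W" if "w \<in> W" for w
    using that gg_sh_eigenvector[OF p sh_T[OF p], of w] by (simp add: W_def)
  ultimately obtain y \<mu> where "y \<in> W" "y \<noteq> 0" "sh p y = \<mu> *\<^sub>R y"
    using A.invariant_subspace_eigenvector[OF W, of x] by blast
  then show ?thesis by (auto simp: W_def)
qed

text \<open>The curvature equation solved for the square of \<open>nu\<close> by means of
  \<open>c * c = 1\<close>. Which pair of eigenvalues occurs may depend on \<open>p\<close>, but the
  finite set of candidates depends neither on the point nor on the chart.\<close>

lemma nu_square_range:
  assumes p: "p \<in> U" and n: "CARD('n) \<ge> 2"
  shows "(nu p)\<^sup>2 \<in> (\<lambda>(\<mu>, \<kappa>). 1 + c * (\<mu>\<^sup>2 - \<kappa> * \<mu>)) ` (\<Lambda> \<times> \<Lambda>)"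
proof -
  obtain x \<mu> where x: "x \<noteq> 0" "sh p x = \<mu> *\<^sub>R x" "gg p x (T p) = 0"
    using exists_orthogonal_eigenvector[OF assms] by blast
  have "c * (\<mu>\<^sup>2 - lam p * \<mu> + c * (1 - (nu p)\<^sup>2)) = 0"
    using orthogonal_eigenvalue(2)[OF p x] gg_TT[OF p] by simp
  then have "c * (\<mu>\<^sup>2 - lam p * \<mu>) + (c * c) * (1 - (nu p)\<^sup>2) = 0"
    by (simp add: algebra_simps)
  then have "(nu p)\<^sup>2 = 1 + c * (\<mu>\<^sup>2 - lam p * \<mu>)"
    unfolding cc by simp
  then show ?thesis
    using lam_in_spectrum[OF p] orthogonal_eigenvalue(1)[OF p x] by force
qed

lemma D_nu: "u \<in> U \<Longrightarrow> D nu u v = - lam u * gg u v (T u)"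
proof -
  assume u: "u \<in> U"
  have "D nu u v = snd (D e u v)"
    unfolding nu_def
    by (rule frechet_derivative_linear_compose(1)[OF bounded_linear_snd smooth_on_differentiable[OF smooth_e u]])
  also have "\<dots> = - gg u (sh u v) (T u)"
    by (simp add: De_eq[OF u] gg_T[OF u] P_def space_part_def)
  also have "\<dots> = - lam u * gg u v (T u)"
    using gg_sh_eigenvector[OF u sh_T[OF u], of v] by simp
  finally show ?thesis .
qed

lemma lam_eq_0:
  assumes u: "u \<in> U" and nu: "\<And>u. u \<in> U \<Longrightarrow> nu u = n0"
  shows "lam u = 0"
proof -
  have "D nu u (T u) = 0"
    using frechet_derivative_cong_open[OF open_U u, of nu "\<lambda>_. n0"] nu by simp
  then show ?thesis using D_nu[OF u, of "T u"] gg_TT_pos[OF u] by simp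
qed

text \<open>Let \<alpha> and \<beta> be the pairings of the two iterated derivatives with
  \<open>x\<close>. The commutator on the immersion shows that \<open>gg u K x\<close> is \<alpha> -
  \<beta>, the one on the normal that it is -(\<alpha> + \<beta>); hence \<alpha> = 0. The sign of
  \<open>\<sigma>\<close> is free, so the two eigenspaces can be exchanged.\<close>

lemma lie_orthogonal_mixed:
  assumes \<sigma>: "\<sigma> \<noteq> 0" and X: "eigfield \<sigma> X" and Y: "eigfield (- \<sigma>) Y" and u: "u \<in> U"
    and x: "sh u x = \<sigma> *\<^sub>R x"
  shows "ip2 c (lie X (lie Y \<phi>) u) (D \<phi> u x) = 0"
proof -
  define K where "K = lie X Y u - lie Y X u"
  have 1: "ip2 c (lie X (lie Y \<phi>) u) (D \<phi> u x) - ip2 c (lie Y (lie X \<phi>) u) (D \<phi> u x) = gg u K x"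
    unfolding gg_def K_def commutator_\<phi>[OF u eigfieldD(1)[OF X] eigfieldD(1)[OF Y], symmetric]
    by (simp add: ip2_simps)
  have "\<sigma> *\<^sub>R lie X (lie Y \<phi>) u + \<sigma> *\<^sub>R lie Y (lie X \<phi>) u = D e u K"
    using commutator_e[OF u eigfieldD(1)[OF X] eigfieldD(1)[OF Y]]
    by (simp add: K_def lie_lie_e[OF X u] lie_lie_e[OF Y u])
  from arg_cong[OF this, of "\<lambda>z. ip2 c z (D \<phi> u x)"]
  have "\<sigma> * ip2 c (lie X (lie Y \<phi>) u) (D \<phi> u x) + \<sigma> * ip2 c (lie Y (lie X \<phi>) u) (D \<phi> u x)
      = - gg u (sh u K) x"
    unfolding ip2_De_D[OF u] by (simp add: ip2_simps)
  also have "\<dots> = - \<sigma> * gg u K x" using gg_sh_eigenvector[OF u x] by simp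
  finally have "\<sigma> * (2 * ip2 c (lie X (lie Y \<phi>) u) (D \<phi> u x)) = 0"
    unfolding 1[symmetric] by (simp add: algebra_simps)
  then show ?thesis using \<sigma> by simp
qed

text \<open>Differentiating the orthogonality of \<open>Y'\<close> and an eigenfield through
  \<open>x\<close> along \<open>Y\<close> leads to the mixed case with the two signs
  exchanged.\<close>

lemma lie_orthogonal_same:
  assumes \<sigma>: "\<sigma> \<noteq> 0" "\<sigma> \<in> \<Lambda>" and Y: "eigfield (- \<sigma>) Y" and Y': "eigfield (- \<sigma>) Y'" and u: "u \<in> U"
    and x: "sh u x = \<sigma> *\<^sub>R x" "gg u x (T u) = 0"
  shows "ip2 c (lie Y (lie Y' \<phi>) u) (D \<phi> u x) = 0"
proof -
  obtain X where X: "eigfield \<sigma> X" "X u = x"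
    using eigfield_extension[OF u \<sigma>(2) x] by blast
  have "ip2 c (lie Y' \<phi> v) (lie X \<phi> v) = 0" if "v \<in> U" for v
    using eigenvectors_gg[OF that eigfieldD(3)[OF Y' that] eigfieldD(3)[OF X(1) that]] \<sigma>(1)
    by (simp add: lie_def gg_def)
  from lie_ip2_const[OF u eigfieldD(2)[OF Y'] eigfieldD(2)[OF X(1)] this, of Y]
  have "ip2 c (lie Y (lie Y' \<phi>) u) (D \<phi> u x) = - ip2 c (lie Y (lie X \<phi>) u) (D \<phi> u (Y' u))"
    using X(2) by (simp add: lie_def[of X \<phi> u] lie_def[of Y' \<phi> u] ip2_commute)
  also have "\<dots> = 0"
    using lie_orthogonal_mixed[of "- \<sigma>" Y X u "Y' u"] \<sigma>(1) X(1) Y u eigfieldD(3)[OF Y' u] by simp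
  finally show ?thesis .
qed

text \<open>This is parallelism of the \<open>- \<sigma>\<close>-eigenspaces, up to components
  outside the complement of \<open>T\<close>. By \<open>sq\<close>, half of the identity plus or
  minus \<open>sh u\<close> divided by \<open>\<sigma>\<close> projects that complement onto the two
  eigenspaces, which splits \<open>v\<close> into the mixed case and the equal case.\<close>

lemma lie_orthogonal:
  assumes \<sigma>: "\<sigma> \<noteq> 0" "\<sigma> \<in> \<Lambda>" "- \<sigma> \<in> \<Lambda>" and Y: "eigfield (- \<sigma>) Y" and u: "u \<in> U"
    and sq: "\<And>v. gg u v (T u) = 0 \<Longrightarrow> sh u (sh u v) = \<sigma>\<^sup>2 *\<^sub>R v"
    and x: "sh u x = \<sigma> *\<^sub>R x" "gg u x (T u) = 0" and v: "gg u v (T u) = 0"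
  shows "ip2 c (D (lie Y \<phi>) u v) (D \<phi> u x) = 0"
proof -
  interpret A: self_adjoint_operator "gg u" "sh u" by (rule self_adjoint_sh[OF u])
  have ggs: "gg u (sh u v) (T u) = 0"
    using gg_sh_eigenvector[OF u sh_T[OF u], of v] v by simp
  define a where "a = (1 / (2 * \<sigma>)) *\<^sub>R (\<sigma> *\<^sub>R v + sh u v)"
  define b where "b = (1 / (2 * \<sigma>)) *\<^sub>R (\<sigma> *\<^sub>R v - sh u v)"
  have "a + b = v" using \<sigma>(1)
    by (simp add: a_def b_def scaleR_add_right[symmetric] scaleR_2[symmetric] algebra_simps)
  have a: "sh u a = \<sigma> *\<^sub>R a" "gg u a (T u) = 0" and b: "sh u b = (- \<sigma>) *\<^sub>R b" "gg u b (T u) = 0"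
    using ggs v by (simp_all add: a_def b_def A.A_simps A.g_simps sq power2_eq_square algebra_simps)
  obtain X' where X': "eigfield \<sigma> X'" "X' u = a"
    using eigfield_extension[OF u \<sigma>(2) a] by blast
  obtain Y' where Y': "eigfield (- \<sigma>) Y'" "Y' u = b"
    using eigfield_extension[OF u \<sigma>(3) b] by blast
  have "D (lie Y \<phi>) u v = lie X' (lie Y \<phi>) u + lie Y' (lie Y \<phi>) u"
    using linear_add[OF linear_D[OF smooth_on_differentiable[OF eigfieldD(2)[OF Y] u]], of a b]
    by (simp add: lie_def[of X'] lie_def[of Y'] X'(2) Y'(2) \<open>a + b = v\<close>)
  then show ?thesis
    using lie_orthogonal_mixed[OF \<sigma>(1) X'(1) Y u x(1)] lie_orthogonal_same[OF \<sigma>(1,2) Y'(1) Y u x]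
    by (simp add: ip2_simps)
qed

lemma snd_lie:
  assumes "smooth_on U h" "\<And>u. u \<in> U \<Longrightarrow> snd (h u) = 0" "u \<in> U"
  shows "snd (lie X h u) = 0"
proof -
  have "snd (lie X h u) = lie X (\<lambda>u. snd (h u)) u"
    by (rule lie_linear[OF bounded_linear_snd smooth_on_differentiable[OF assms(1,3)], symmetric])
  also have "\<dots> = lie X (\<lambda>u. 0) u" by (rule lie_cong[OF open_U assms(3)]) (rule assms(2))
  finally show ?thesis by simp
qed

text \<open>Both sides of the Gauss equation for a mixed plane: differentiating \<open>ip2 c (lie Y (lie Y \<phi>)) (lie X \<phi>) = 0\<close>
  along \<open>X\<close> shows that \<open>a\<close> and \<open>b\<close> are orthogonal, while their components along \<open>e\<close>, \<open>P\<close> and \<open>T\<close>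
  contribute a negative product.\<close>

lemma no_opposite_curvatures:
  assumes c: "c = -1" and \<sigma>: "\<sigma> \<noteq> 0" "\<sigma> \<in> \<Lambda>" "- \<sigma> \<in> \<Lambda>" and p: "p \<in> U"
    and sq: "\<And>u v. u \<in> U \<Longrightarrow> gg u v (T u) = 0 \<Longrightarrow> sh u (sh u v) = \<sigma>\<^sup>2 *\<^sub>R v"
    and x: "x \<noteq> 0" "sh p x = \<sigma> *\<^sub>R x" "gg p x (T p) = 0"
    and y: "y \<noteq> 0" "sh p y = (- \<sigma>) *\<^sub>R y" "gg p y (T p) = 0"
  shows False
proof -
  interpret A: self_adjoint_operator "gg p" "sh p" by (rule self_adjoint_sh[OF p])
  obtain X where X: "eigfield \<sigma> X" "X p = x" using eigfield_extension[OF p \<sigma>(2) x(2,3)] by blast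
  obtain Y where Y: "eigfield (- \<sigma>) Y" "Y p = y" using eigfield_extension[OF p \<sigma>(3) y(2,3)] by blast
  have m\<sigma>: "- \<sigma> \<noteq> 0" "- (- \<sigma>) = \<sigma>" using \<sigma>(1) by simp_all
  note XD = eigfieldD[OF X(1)] and YD = eigfieldD[OF Y(1)]
  define K where "K = lie X Y p - lie Y X p"
  define a where "a = lie Y (lie Y \<phi>) p"
  define b where "b = lie X (lie X \<phi>) p"
  have smXY: "smooth_on U (lie X (lie Y \<phi>))" "smooth_on U (lie Y (lie Y \<phi>))"
    using smooth_on_lie[OF open_U] XD YD by blast+
  have sndXY: "snd (lie X (lie Y \<phi>) p) = 0" "snd (lie Y (lie X \<phi>) p) = 0" "snd a = 0" "snd b = 0"
    unfolding a_def b_def using snd_lie XD YD p by blast+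
  have K: "D \<phi> p K = lie X (lie Y \<phi>) p - lie Y (lie X \<phi>) p"
    unfolding K_def by (rule commutator_\<phi>[OF p XD(1) YD(1), symmetric])
  have KT: "gg p K (T p) = 0" by (simp add: gg_T[OF p] K sndXY)
  \<comment> \<open>The \<open>- \<sigma>\<close>-part of \<open>K\<close>: the commutators on
    \<open>\<phi>\<close> and on \<open>e\<close> give the difference and the sum of the two mixed
    derivatives, and solving for \<open>lie X (lie Y \<phi>) p\<close> shows it to be tangent, with
    coordinates \<open>w\<close>.\<close>
  define w where "w = (1 / (2 * \<sigma>)) *\<^sub>R (\<sigma> *\<^sub>R K - sh p K)"
  have XY: "lie X (lie Y \<phi>) p = D \<phi> p w"
  proof -
    have "\<sigma> *\<^sub>R lie X (lie Y \<phi>) p + \<sigma> *\<^sub>R lie Y (lie X \<phi>) p = D e p K"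
      using commutator_e[OF p XD(1) YD(1)]
      by (simp add: K_def lie_lie_e[OF X(1) p] lie_lie_e[OF Y(1) p])
    also have "\<dots> = - D \<phi> p (sh p K)" by (simp add: De_eq[OF p] KT)
    finally have "D \<phi> p (sh p K) = - (\<sigma> *\<^sub>R lie X (lie Y \<phi>) p + \<sigma> *\<^sub>R lie Y (lie X \<phi>) p)"
      by simp
    then have "D \<phi> p (\<sigma> *\<^sub>R K - sh p K) = (2 * \<sigma>) *\<^sub>R lie X (lie Y \<phi>) p"
      unfolding mult_2 scaleR_add_left by (simp add: lin_simps[OF p] K scaleR_diff_right)
    then show ?thesis using \<sigma>(1) by (simp add: w_def lin_simps[OF p])
  qed
  have w: "sh p w = (- \<sigma>) *\<^sub>R w"
    using sq[OF p KT] by (simp add: w_def A.A_simps power2_eq_square algebra_simps)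
  have "ip2 c (lie Y (lie X \<phi>) p) (D \<phi> p w) = 0"
    using lie_orthogonal_mixed[of "- \<sigma>" Y X p w] m\<sigma> X(1) Y(1) p w by simp
  moreover have "ip2 c (lie X (lie Y \<phi>) v) (lie X \<phi> v) = 0" if "v \<in> U" for v
    using lie_orthogonal_mixed[OF \<sigma>(1) X(1) Y(1) that XD(3)[OF that]] by (simp add: lie_def[of X \<phi>])
  from lie_ip2_const[OF p smXY(1) XD(2) this, of Y]
  have "ip2 c (lie Y (lie X (lie Y \<phi>)) p) (lie X \<phi> p) = - ip2 c (lie Y (lie X \<phi>) p) (D \<phi> p w)"
    by (simp add: XY ip2_commute)
  ultimately have H3: "ip2 c (lie Y (lie X (lie Y \<phi>)) p) (lie X \<phi> p) = 0" by simp
  have H4: "ip2 c (D (lie Y \<phi>) p K) (lie X \<phi> p) = 0"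
    using lie_orthogonal[OF \<sigma> Y(1) p sq[OF p] x(2,3) KT] by (simp add: lie_def[of X \<phi>] X(2))
  \<comment> \<open>The commutator is now applied to the map \<open>lie Y \<phi>\<close>, which
    brings in the curvature of the mixed plane; by \<open>H3\<close> and \<open>H4\<close> the other
    two terms pair to zero with \<open>X\<close>.\<close>
  have "lie X (lie Y (lie Y \<phi>)) p - lie Y (lie X (lie Y \<phi>)) p = D (lie Y \<phi>) p K"
    unfolding K_def by (rule lie_commutator[OF open_U p XD(1) YD(1) YD(2)])
  then have H2: "ip2 c (lie X (lie Y (lie Y \<phi>)) p) (lie X \<phi> p) = 0"
    using H3 H4 by (metis diff_zero ip2_simps(3))
  have "ip2 c (lie Y (lie Y \<phi>) v) (lie X \<phi> v) = 0" if "v \<in> U" for v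
    using lie_orthogonal_same[OF \<sigma>(1,2) Y(1) Y(1) that XD(3,4)[OF that]]
    by (simp add: lie_def[of X \<phi>])
  from lie_ip2_const[OF p smXY(2) XD(2) this, of X]
  have ab: "ip2 c a b = 0" using H2 by (simp add: a_def b_def)
  define x2 where "x2 = gg p x x"
  define y2 where "y2 = gg p y y"
  have pos: "x2 > 0" "y2 > 0" using x y A.pos_g by (simp_all add: x2_def y2_def)
  have x2: "ip2 c (lie X \<phi> p) (lie X \<phi> p) = x2" and y2: "ip2 c (lie Y \<phi> p) (lie Y \<phi> p) = y2"
    by (simp_all add: x2_def y2_def gg_def lie_def X(2) Y(2))
  \<comment> \<open>The components along \<open>e\<close> and \<open>P\<close> come from
    differentiating the orthogonality of \<open>lie X \<phi>\<close> and \<open>lie Y \<phi>\<close>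
    to them; the opposite signs of the two curvatures are felt only along \<open>e\<close>.\<close>
  have ae: "ip2 c a (e p) = - \<sigma> * y2"
    using lie_ip2_const[OF p YD(2) smooth_e lie_\<phi>_orthogonal(2), of Y]
    by (simp add: a_def YD(5)[OF p] ip2_simps y2)
  have be: "ip2 c b (e p) = \<sigma> * x2"
    using lie_ip2_const[OF p XD(2) smooth_e lie_\<phi>_orthogonal(2), of X]
    by (simp add: b_def XD(5)[OF p] ip2_simps x2)
  have aP: "ip2 c a (P p) = - y2"
    using lie_ip2_const[OF p YD(2) smooth_P lie_\<phi>_orthogonal(4), of Y]
    by (simp add: a_def YD(6)[OF p] ip2_simps y2)
  have bP: "ip2 c b (P p) = - x2"
    using lie_ip2_const[OF p XD(2) smooth_P lie_\<phi>_orthogonal(4), of X]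
    by (simp add: b_def XD(6)[OF p] ip2_simps x2)
  obtain z where z: "a = D \<phi> p z + ip2 c a (e p) *\<^sub>R e p + (c * ip2 c a (P p)) *\<^sub>R P p"
    using frame[OF p] by blast
  define t2 where "t2 = gg p (T p) (T p)"
  have t2: "t2 > 0" using gg_TT_pos[OF p] by (simp add: t2_def)
  have sndP: "snd (P p) = 0" by (simp add: P_def space_part_def)
  \<comment> \<open>The height component of \<open>a\<close> is zero, so its tangential part needs a
    \<open>T\<close>-component that compensates the height of the
    \<open>e\<close>-component.\<close>
  have "snd a = gg p z (T p) - \<sigma> * y2 * nu p"
    using arg_cong[OF z, of snd] by (simp add: gg_T[OF p] ae nu_def sndP)
  then have zT: "gg p z (T p) = \<sigma> * y2 * nu p" using sndXY by simp
  define \<omega> where "\<omega> = gg p z (T p) / t2"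
  define z' where "z' = z - \<omega> *\<^sub>R T p"
  have z'T: "gg p z' (T p) = 0" using t2 by (simp add: z'_def A.g_simps \<omega>_def t2_def)
  have shz'T: "gg p (sh p z') (T p) = 0"
    using gg_sh_eigenvector[OF p sh_T[OF p], of z'] z'T by simp
  define zp where "zp = (1 / (2 * \<sigma>)) *\<^sub>R (\<sigma> *\<^sub>R z' + sh p z')"
  define zm where "zm = (1 / (2 * \<sigma>)) *\<^sub>R (\<sigma> *\<^sub>R z' - sh p z')"
  have zsum: "z = zp + zm + \<omega> *\<^sub>R T p"
  proof -
    have "zp + zm = z'"
      using \<sigma>(1) by (simp add: zp_def zm_def scaleR_add_right[symmetric] scaleR_2[symmetric] algebra_simps)
    then show ?thesis by (simp add: z'_def)
  qed
  have zp: "sh p zp = \<sigma> *\<^sub>R zp" "gg p zp (T p) = 0" and zm: "sh p zm = (- \<sigma>) *\<^sub>R zm" "gg p zm (T p) = 0"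
    using z'T shz'T sq[OF p z'T]
    by (simp_all add: zp_def zm_def A.A_simps A.g_simps power2_eq_square algebra_simps)
  \<comment> \<open>The vector \<open>a\<close> has no part in the
    \<open>\<sigma>\<close>-eigenspace orthogonal to \<open>T\<close>, and \<open>b\<close> below
    none in the \<open>- \<sigma>\<close>-eigenspace, so only the directions \<open>T\<close>,
    \<open>e\<close> and \<open>P\<close> contribute to the product of \<open>a\<close> and
    \<open>b\<close>.\<close>
  have "ip2 c a (D \<phi> p zp) = 0"
    unfolding a_def by (rule lie_orthogonal_same[OF \<sigma>(1,2) Y(1) Y(1) p zp])
  then have "gg p z zp = 0"
    by (subst (asm) z) (simp add: ip2_simps e_normal[OF p] P_D[OF p] gg_def)
  moreover have "gg p zm zp = 0"
    by (rule eigenvectors_gg[OF p zm(1) zp(1)]) (use \<sigma>(1) in simp)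
  ultimately have "gg p zp zp = 0"
    using zp(2) gg_commute[of p zp "T p"] by (simp add: zsum A.g_simps)
  then have "zp = 0" using A.g_eq_0_iff by simp
  have "ip2 c b (D \<phi> p zm) = 0"
    unfolding b_def
    by (rule lie_orthogonal_same[OF m\<sigma>(1) \<sigma>(3) _ _ p zm]) (use X(1) in simp_all)
  moreover have "ip2 c b (D \<phi> p (T p)) = - nu p * (\<sigma> * x2)"
    by (simp add: D_T[OF p] ip2_simps ip2_dt sndXY be)
  ultimately have "ip2 c b (D \<phi> p z) = - \<omega> * nu p * (\<sigma> * x2)"
    by (simp add: zsum \<open>zp = 0\<close> lin_simps[OF p] ip2_simps)
  moreover have "ip2 c b a = ip2 c b (D \<phi> p z) + ip2 c a (e p) * ip2 c b (e p)
      + c * ip2 c a (P p) * ip2 c b (P p)"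
    by (subst (1) z) (simp add: ip2_simps)
  moreover have "ip2 c b a = 0" using ab ip2_commute by metis
  ultimately have "0 = - \<omega> * nu p * (\<sigma> * x2) + (- \<sigma> * y2) * (\<sigma> * x2) + c * (- y2) * (- x2)"
    unfolding ae be aP bP by simp
  then have "\<omega> * nu p * (\<sigma> * x2) + \<sigma> * y2 * (\<sigma> * x2) + y2 * x2 = 0"
    using c by simp
  moreover have "\<omega> * nu p * (\<sigma> * x2) = (\<sigma> * nu p)\<^sup>2 * (y2 * x2) / t2"
    by (simp add: \<omega>_def zT power2_eq_square)
  \<comment> \<open>The summands stem from \<open>T\<close>, \<open>e\<close> and \<open>P\<close>.
    For \<open>c = -1\<close> they all have the same sign, and the last one is strictly
    positive.\<close>
  ultimately have "(\<sigma> * nu p)\<^sup>2 * (y2 * x2) / t2 + \<sigma>\<^sup>2 * (y2 * x2) + y2 * x2 = 0"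
    by (simp add: power2_eq_square algebra_simps)
  moreover have "(\<sigma> * nu p)\<^sup>2 * (y2 * x2) / t2 \<ge> 0" "\<sigma>\<^sup>2 * (y2 * x2) \<ge> 0" "y2 * x2 > 0"
    using pos t2 by simp_all
  ultimately show False by linarith
qed

text \<open>The lightlike normal of the horospheres, with the factor that compensates the motion in the
  direction of \<open>T\<close>.\<close>

lemma horosphere_normal_constant:
  assumes c: "c = -1" and nu: "\<And>u. u \<in> U \<Longrightarrow> nu u = n0" and \<mu>: "\<mu>\<^sup>2 = 1 - n0\<^sup>2" "\<mu> \<noteq> 0"
    and umb: "\<And>u v. u \<in> U \<Longrightarrow> gg u v (T u) = 0 \<Longrightarrow> sh u v = \<mu> *\<^sub>R v" and u: "u \<in> U"
  shows "((\<lambda>u. exp (n0 / \<mu> * snd (\<phi> u)) *\<^sub>R (P u + (1 / \<mu>) *\<^sub>R space_part (e u))) has_derivative (\<lambda>v. 0)) (at u)"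
proof -
  interpret A: self_adjoint_operator "gg u" "sh u" by (rule self_adjoint_sh[OF u])
  have d: "(\<phi> has_derivative D \<phi> u) (at u)" "(P has_derivative D P u) (at u)" "(e has_derivative D e u) (at u)"
    using smooth_on_differentiable[OF smooth_\<phi> u] smooth_on_differentiable[OF smooth_P u]
      smooth_on_differentiable[OF smooth_e u] by (simp_all add: frechet_derivative_works)
  let ?E = "exp (n0 / \<mu> * snd (\<phi> u))"
  have 1: "((\<lambda>u. exp (n0 / \<mu> * snd (\<phi> u)) *\<^sub>R (P u + (1 / \<mu>) *\<^sub>R space_part (e u))) has_derivative
    (\<lambda>v. ?E *\<^sub>R (D P u v + (1 / \<mu>) *\<^sub>R space_part (D e u v)) +
      (n0 / \<mu> * snd (D \<phi> u v) * ?E) *\<^sub>R (P u + (1 / \<mu>) *\<^sub>R space_part (e u)))) (at u)"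
    using \<mu>(2)
    by (auto intro!: derivative_eq_intros d bounded_linear.has_derivative[OF bounded_linear_space_part])
  have gTT: "gg u (T u) (T u) = \<mu>\<^sup>2" using gg_TT[OF u] nu[OF u] \<mu> by simp
  \<comment> \<open>Differentiation turns the lightlike vector into a multiple of itself, at exactly
    the rate that the exponential factor cancels.\<close>
  have "D P u v + (1 / \<mu>) *\<^sub>R space_part (D e u v)
      = - (n0 / \<mu> * snd (D \<phi> u v)) *\<^sub>R (P u + (1 / \<mu>) *\<^sub>R space_part (e u))" for v
  proof -
    define s where "s = snd (D \<phi> u v)"
    have s: "gg u v (T u) = s" by (simp add: s_def gg_T[OF u])
    \<comment> \<open>The part of \<open>v\<close> orthogonal to \<open>T\<close>, where the shape
      operator is \<open>\<mu>\<close>; on \<open>T\<close> it is zero. The denominator is the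
      squared length of \<open>T\<close>.\<close>
    define x where "x = v - (s / \<mu>\<^sup>2) *\<^sub>R T u"
    have "gg u x (T u) = 0" using \<mu>(2) by (simp add: x_def A.g_simps gTT s)
    from umb[OF u this] have "sh u x = \<mu> *\<^sub>R x" .
    moreover have "sh u (T u) = 0" using sh_T[OF u] lam_eq_0[OF u nu] by simp
    ultimately have "sh u v = \<mu> *\<^sub>R (v - (s / \<mu>\<^sup>2) *\<^sub>R T u)"
      by (simp add: x_def A.A_simps)
    note shv = this
    have cns: "c * n0 * s = - (n0 * s)" using c by simp
    have De: "D e u v = - \<mu> *\<^sub>R D \<phi> u v + (s / \<mu>) *\<^sub>R (dt - n0 *\<^sub>R e u) - (n0 * s) *\<^sub>R P u"
      unfolding De_eq[OF u] s nu[OF u] cns shv lin_simps[OF u] D_T[OF u]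
      using \<mu>(2) by (simp add: algebra_simps power2_eq_square)
    have "D P u v + (1 / \<mu>) *\<^sub>R space_part (D e u v) =
        - (s * n0 / \<mu>\<^sup>2) *\<^sub>R space_part (e u) - (n0 * s / \<mu>) *\<^sub>R P u"
      using \<mu>(2) unfolding D_P[OF u] De
      by (simp add: space_part_def P_def dt_def prod_eq_iff algebra_simps power2_eq_square)
    also have "\<dots> = - (n0 / \<mu> * s) *\<^sub>R (P u + (1 / \<mu>) *\<^sub>R space_part (e u))"
      by (simp add: algebra_simps power2_eq_square)
    finally show ?thesis by (simp add: s_def)
  qed
  then have "?E *\<^sub>R (D P u v + (1 / \<mu>) *\<^sub>R space_part (D e u v)) +
      (n0 / \<mu> * snd (D \<phi> u v) * ?E) *\<^sub>R (P u + (1 / \<mu>) *\<^sub>R space_part (e u)) = 0" for v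
    by simp
  with 1 show ?thesis by simp
qed

lemma hyperbolic:
  assumes n: "CARD('n) \<ge> 2" and u: "u \<in> U" and nu: "\<And>u. u \<in> U \<Longrightarrow> nu u = n0"
  shows "c = -1"
proof (rule ccontr)
  assume "c \<noteq> -1"
  then have "c = 1" using c by simp
  obtain x \<mu> where "x \<noteq> 0" "sh u x = \<mu> *\<^sub>R x" "gg u x (T u) = 0"
    using exists_orthogonal_eigenvector[OF u n] by blast
  from orthogonal_eigenvalue(2)[OF u this] have "\<mu>\<^sup>2 + 1 * gg u (T u) (T u) = 0"
    using lam_eq_0[OF u nu] \<open>c = 1\<close> by simp
  then show False using gg_TT_pos[OF u] zero_le_power2[of \<mu>] by linarith
qed

section \<open>The shape operator when the angle function is constant\<close>

lemma nu_bound: "u \<in> U \<Longrightarrow> (nu u)\<^sup>2 < 1"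
  using gg_TT_pos gg_TT by force

lemma orthogonal_eigenvalue_square:
  assumes n: "CARD('n) \<ge> 2" and u: "u \<in> U" and nu: "\<And>u. u \<in> U \<Longrightarrow> nu u = n0"
    and x: "x \<noteq> 0" "sh u x = \<mu> *\<^sub>R x" "gg u x (T u) = 0"
  shows "\<mu>\<^sup>2 = 1 - n0\<^sup>2"
proof -
  have "c * gg u (T u) (T u) = n0\<^sup>2 - 1"
    using hyperbolic[OF n u nu] gg_TT[OF u] nu[OF u] by simp
  then show ?thesis
    using orthogonal_eigenvalue(2)[OF u x] lam_eq_0[OF u nu] by simp
qed

lemma gg_sh_T: "u \<in> U \<Longrightarrow> gg u v (T u) = 0 \<Longrightarrow> gg u (sh u v) (T u) = 0"
  using gg_sh_eigenvector[OF _ sh_T, of u v] by simp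

lemma eigenvector_orthogonal_T:
  assumes u: "u \<in> U" and nu: "\<And>u. u \<in> U \<Longrightarrow> nu u = n0" and x: "sh u x = \<mu> *\<^sub>R x" "\<mu> \<noteq> 0"
  shows "gg u x (T u) = 0"
  by (rule eigenvectors_gg[OF u x(1) sh_T[OF u]]) (use lam_eq_0[OF u nu] x(2) in simp)

text \<open>The eigenvalues are among 0, \<open>t\<close> and \<open>- t\<close>, so the
  corresponding cubic in \<open>sh u\<close> vanishes. Its quadratic factor sends \<open>v\<close>
  to a vector \<open>z\<close> in the kernel and orthogonal to \<open>T\<close>; if nonzero,
  \<open>z\<close> would have eigenvalue 0 with square \<open>1 - n0\<^sup>2 > 0\<close>.\<close>

lemma sh_sh:
  assumes n: "CARD('n) \<ge> 2" and u: "u \<in> U" and nu: "\<And>u. u \<in> U \<Longrightarrow> nu u = n0"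
    and v: "gg u v (T u) = 0"
  shows "sh u (sh u v) = (1 - n0\<^sup>2) *\<^sub>R v"
proof -
  interpret A: self_adjoint_operator "gg u" "sh u" by (rule self_adjoint_sh[OF u])
  define t where "t = sqrt (1 - n0\<^sup>2)"
  have t: "t\<^sup>2 = 1 - n0\<^sup>2" using nu_bound[OF u] nu[OF u] by (simp add: t_def)
  have "shifted_product (sh u) [0, t, - t] v = 0"
  proof (rule A.shifted_product_eq_0)
    fix \<mu> x assume x: "x \<noteq> 0" "sh u x = \<mu> *\<^sub>R x"
    show "\<mu> \<in> set [0, t, - t]"
    proof (cases "\<mu> = 0")
      case False
      have "\<mu>\<^sup>2 = t\<^sup>2"
        unfolding t
        by (rule orthogonal_eigenvalue_square[OF n u nu x eigenvector_orthogonal_T[OF u nu x(2) False]])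
      then show ?thesis by (auto simp: power2_eq_iff)
    qed simp
  qed
  then have "sh u (sh u (sh u v) - (t * t) *\<^sub>R v) = 0"
    by (simp add: A.A_simps algebra_simps)
  moreover define z where "z = sh u (sh u v) - (t * t) *\<^sub>R v"
  ultimately have "sh u z = 0 *\<^sub>R z" by simp
  moreover have "gg u z (T u) = 0"
    using gg_sh_T[OF u gg_sh_T[OF u v]] v by (simp add: z_def A.g_simps)
  ultimately have "z \<noteq> 0 \<Longrightarrow> (0::real)\<^sup>2 = 1 - n0\<^sup>2"
    using orthogonal_eigenvalue_square[OF n u nu] by blast
  then have "z = 0" using nu_bound[OF u] nu[OF u] by auto
  then show ?thesis unfolding t[symmetric] by (simp add: z_def power2_eq_square)
qed

lemma opposite_not_in_spectrum:
  assumes n: "CARD('n) \<ge> 2" and u: "u \<in> U" and nu: "\<And>u. u \<in> U \<Longrightarrow> nu u = n0"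
    and \<mu>: "\<mu> \<in> \<Lambda>" "\<mu> \<noteq> 0"
  shows "- \<mu> \<notin> \<Lambda>"
proof
  assume m: "- \<mu> \<in> \<Lambda>"
  obtain x where x: "x \<noteq> 0" "sh u x = \<mu> *\<^sub>R x" using \<mu>(1) spectrum[OF u] by blast
  obtain y where y: "y \<noteq> 0" "sh u y = (- \<mu>) *\<^sub>R y" using m spectrum[OF u] by blast
  have xT: "gg u x (T u) = 0" by (rule eigenvector_orthogonal_T[OF u nu x(2) \<mu>(2)])
  have yT: "gg u y (T u) = 0" by (rule eigenvector_orthogonal_T[OF u nu y(2)]) (use \<mu>(2) in auto)
  have "sh v (sh v w) = \<mu>\<^sup>2 *\<^sub>R w" if "v \<in> U" "gg v w (T v) = 0" for v w
    using sh_sh[OF n that(1) nu that(2)] orthogonal_eigenvalue_square[OF n u nu x xT] by simp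
  from no_opposite_curvatures[OF hyperbolic[OF n u nu] \<mu>(2,1) m u this x xT y yT]
  show False by blast
qed

text \<open>On the complement of \<open>T\<close>, \<open>sh_sh\<close> factors into
  \<open>sh u\<close> plus \<open>\<mu>\<close> and \<open>sh u\<close> minus \<open>\<mu>\<close>,
  and the first factor is injective.\<close>

lemma umbilical:
  assumes n: "CARD('n) \<ge> 2" and u: "u \<in> U" and nu: "\<And>u. u \<in> U \<Longrightarrow> nu u = n0"
    and \<mu>: "\<mu>\<^sup>2 = 1 - n0\<^sup>2" "- \<mu> \<notin> \<Lambda>" and v: "gg u v (T u) = 0"
  shows "sh u v = \<mu> *\<^sub>R v"
proof -
  interpret A: self_adjoint_operator "gg u" "sh u" by (rule self_adjoint_sh[OF u])
  define z where "z = sh u v - \<mu> *\<^sub>R v"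
  have "sh u z = (- \<mu>) *\<^sub>R z"
    using sh_sh[OF n u nu v] unfolding \<mu>(1)[symmetric]
    by (simp add: z_def A.A_simps power2_eq_square algebra_simps)
  then have "z = 0" using \<mu>(2) spectrum[OF u] by blast
  then show ?thesis by (simp add: z_def)
qed

lemma dim_eigenspace:
  assumes n: "CARD('n) \<ge> 2" and u: "u \<in> U" and nu: "\<And>u. u \<in> U \<Longrightarrow> nu u = n0"
    and \<mu>: "\<mu>\<^sup>2 = 1 - n0\<^sup>2" "- \<mu> \<notin> \<Lambda>"
  shows "dim {v. sh u v = \<mu> *\<^sub>R v} = CARD('n) - 1"
proof -
  interpret A: self_adjoint_operator "gg u" "sh u" by (rule self_adjoint_sh[OF u])
  have "\<mu> \<noteq> 0" using \<mu>(1) nu_bound[OF u] nu[OF u] by auto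
  then have eq: "{v. sh u v = \<mu> *\<^sub>R v} = {v. gg u v (T u) = 0}"
    using umbilical[OF n u nu \<mu>] eigenvector_orthogonal_T[OF u nu] by blast
  have l: "linear (\<lambda>v. gg u v (T u))" using A.bilinear_g by (simp add: bilinear_def)
  \<comment> \<open>The complement of \<open>T\<close> with respect to \<open>gg u\<close> is
    rewritten through its Euclidean normal, to which the dimension formula for hyperplanes
    applies.\<close>
  define a where "a = adjoint (\<lambda>v. gg u v (T u)) 1"
  have a: "a \<bullet> v = gg u v (T u)" for v
    using adjoint_works[OF l, of v 1] by (simp add: a_def inner_commute)
  have "a \<noteq> 0" using a[of "T u"] gg_TT_pos[OF u] by auto
  from dim_hyperplane[OF this] show ?thesis unfolding eq a by simp
qed

end

section \<open>Horospheres in the hyperboloid model\<close>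

lemma bounded_bilinear_ip1: "bounded_bilinear (ip1 c)"
  unfolding bilinear_conv_bounded_bilinear[symmetric] bilinear_def
  by (auto intro!: linearI simp: ip1_def algebra_simps inner_add_left inner_add_right)

lemma ip1_commute: "ip1 c x y = ip1 c y x"
  by (simp add: ip1_def inner_commute)

lemmas ip1_simps = bounded_bilinear.add_left[OF bounded_bilinear_ip1] bounded_bilinear.add_right[OF bounded_bilinear_ip1]
  bounded_bilinear.diff_left[OF bounded_bilinear_ip1] bounded_bilinear.diff_right[OF bounded_bilinear_ip1]
  bounded_bilinear.minus_left[OF bounded_bilinear_ip1] bounded_bilinear.minus_right[OF bounded_bilinear_ip1]
  bounded_bilinear.scaleR_left[OF bounded_bilinear_ip1] bounded_bilinear.scaleR_right[OF bounded_bilinear_ip1]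
  bounded_bilinear.zero_left[OF bounded_bilinear_ip1] bounded_bilinear.zero_right[OF bounded_bilinear_ip1]

text \<open>By Cauchy-Schwarz for the space components, a lightlike vector with nonpositive time
  component pairs nonnegatively with every point of the hyperboloid.\<close>

lemma lightlike_future:
  assumes F: "F \<in> space_form (-1)" and w: "ip1 (-1) w w = 0" and Fw: "ip1 (-1) F w < 0"
  shows "fst w > 0"
proof (rule ccontr)
  assume "\<not> fst w > 0"
  then have w0: "fst w \<le> 0" by simp
  have "(norm (snd w))\<^sup>2 = (fst w)\<^sup>2"
    using w unfolding power2_norm_eq_inner by (simp add: ip1_def power2_eq_square)
  then have nw: "norm (snd w) = - fst w"
    using power2_eq_imp_eq[of "norm (snd w)" "- fst w"] w0 by simp
  have "(norm (snd F))\<^sup>2 = (fst F)\<^sup>2 - 1" and F': "fst F > 0"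
    using F unfolding power2_norm_eq_inner by (auto simp: space_form_def ip1_def power2_eq_square)
  then have "norm (snd F) \<le> fst F" using power2_le_imp_le[of "norm (snd F)" "fst F"] by simp
  then have "norm (snd F) * norm (snd w) \<le> fst F * - fst w"
    unfolding nw using w0 by (intro mult_right_mono) auto
  moreover have "\<bar>snd F \<bullet> snd w\<bar> \<le> norm (snd F) * norm (snd w)" by (rule Cauchy_Schwarz_ineq2)
  ultimately show False using Fw by (simp add: ip1_def)
qed

text \<open>The upper half space coordinates adapted to the lightlike vector \<open>w\<close>: with \<open>w'\<close> lightlike and
  \<open>ip1 (-1) w w' = -1\<close>, the points \<open>horopoint \<beta> x\<close> of the hyperboloid make up the horosphere
  \<open>ip1 (-1) _ w = - \<beta>\<close>.\<close>

locale horosphere_coordinates =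
  fixes w :: "'n::finite flat1" and J :: "real^'k::finite \<Rightarrow> real^'n"
  assumes w: "ip1 (-1) w w = 0" and w_future: "fst w > 0"
    and linear_J: "linear J" and norm_J: "norm (J x) = norm x"
    and range_J: "range J = {y. snd w \<bullet> y = 0}"
begin

text \<open>The reflection of \<open>w\<close> in the time axis, scaled so that the two lightlike
  vectors pair to -1.\<close>

definition w' :: "'n flat1" where "w' = (1 / (2 * (fst w)\<^sup>2)) *\<^sub>R (fst w, - snd w)"

text \<open>The coefficient of \<open>w\<close> is forced by the square -1 once the other two terms
  are chosen. The factor \<open>\<beta>\<close> before \<open>J x\<close> makes fixed
  \<open>x\<close> and varying \<open>\<beta>\<close> trace a geodesic orthogonal to the
  horospheres.\<close>

definition horopoint :: "real \<Rightarrow> real^'k \<Rightarrow> 'n flat1" where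
  "horopoint \<beta> x = ((1 + \<beta>\<^sup>2 * (x \<bullet> x)) / (2 * \<beta>)) *\<^sub>R w + \<beta> *\<^sub>R w' + (0, \<beta> *\<^sub>R J x)"

definition J' where "J' = adjoint J"

lemma linear_J': "linear J'" unfolding J'_def by (rule adjoint_linear[OF linear_J])

lemma inner_J: "J x \<bullet> J y = x \<bullet> y"
  by (simp add: dot_norm linear_add[OF linear_J, symmetric] norm_J)

lemma J'_J [simp]: "J' (J x) = x"
proof -
  have "y \<bullet> J' (J x) = y \<bullet> x" for y
    unfolding J'_def adjoint_works[OF linear_J] by (rule inner_J)
  then show ?thesis by (metis vector_eq_ldot)
qed

lemma w_J [simp]: "snd w \<bullet> J x = 0" "J x \<bullet> snd w = 0"
  using range_J by (auto simp: inner_commute)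

lemma J'_w [simp]: "J' (snd w) = 0"
proof -
  have "y \<bullet> J' (snd w) = 0" for y
    unfolding J'_def adjoint_works[OF linear_J] by simp
  then show ?thesis by (metis inner_eq_zero_iff)
qed

lemma J_J': "snd w \<bullet> y = 0 \<Longrightarrow> J (J' y) = y"
  using range_J J'_J by (metis (mono_tags, lifting) mem_Collect_eq rangeE)

lemma ww: "snd w \<bullet> snd w = (fst w)\<^sup>2"
  using w by (simp add: ip1_def power2_eq_square)

lemma ip1_w: "ip1 (-1) w w' = -1" "ip1 (-1) w' w = -1" "ip1 (-1) w' w' = 0"
  "ip1 (-1) w (0, J x) = 0" "ip1 (-1) (0, J x) w = 0" "ip1 (-1) w' (0, J x) = 0" "ip1 (-1) (0, J x) w' = 0"
  "ip1 (-1) (0, J x) (0, J y) = x \<bullet> y"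
  using ww w_future by (simp_all add: w'_def ip1_def inner_J inner_commute field_simps power2_eq_square)

lemma horopoint_ip1: "\<beta> \<noteq> 0 \<Longrightarrow> ip1 (-1) (horopoint \<beta> x) (horopoint \<beta> x) = -1"
proof -
  assume b: "\<beta> \<noteq> 0"
  have e: "(0, \<beta> *\<^sub>R J x) = \<beta> *\<^sub>R (0::real, J x)" by simp
  show ?thesis
    unfolding horopoint_def e using b
    by (simp add: ip1_simps ip1_w w field_simps power2_eq_square del: scaleR_Pair)
qed

lemma horopoint_w: "\<beta> \<noteq> 0 \<Longrightarrow> ip1 (-1) (horopoint \<beta> x) w = - \<beta>"
proof -
  assume b: "\<beta> \<noteq> 0"
  have e: "(0, \<beta> *\<^sub>R J x) = \<beta> *\<^sub>R (0::real, J x)" by simp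
  show ?thesis
    unfolding horopoint_def e using b by (simp add: ip1_simps ip1_w w del: scaleR_Pair)
qed

lemma horopoint_space_form: "\<beta> > 0 \<Longrightarrow> horopoint \<beta> x \<in> space_form (-1)"
  using horopoint_ip1[of \<beta> x] w_future
  by (simp add: space_form_def) (simp add: horopoint_def w'_def add_pos_pos add_pos_nonneg)

lemma J'_horopoint: "J' (snd (horopoint \<beta> x)) = \<beta> *\<^sub>R x"
  by (simp add: horopoint_def w'_def linear_add[OF linear_J'] linear_scale[OF linear_J']
      linear_diff[OF linear_J'])

text \<open>The coordinate is read off the component of \<open>snd F\<close> orthogonal to
  \<open>snd w\<close>. The hyperboloid equation is then linear in \<open>fst F\<close>, since the
  squares cancel, and determines the remaining component.\<close>

lemma horopoint_surj:
  assumes F: "F \<in> space_form (-1)" and Fw: "ip1 (-1) F w = - \<beta>" and b: "\<beta> > 0"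
  shows "horopoint \<beta> (J' (snd F) /\<^sub>R \<beta>) = F"
proof -
  define W where "W = fst w"
  have W: "W > 0" using w_future by (simp add: W_def)
  define q where "q = snd F \<bullet> snd w"
  have q: "q = fst F * W - \<beta>" using Fw by (simp add: ip1_def q_def W_def)
  define z where "z = snd F - (q / W\<^sup>2) *\<^sub>R snd w"
  have wz: "snd w \<bullet> z = 0"
    using W ww by (simp add: z_def W_def inner_diff_right q_def inner_commute)
  define y where "y = J' (snd F)"
  have "J' z = y" by (simp add: z_def y_def linear_diff[OF linear_J'] linear_scale[OF linear_J'])
  then have Jy: "J y = z" using J_J'[OF wz] by simp
  have "snd F = z + (q / W\<^sup>2) *\<^sub>R snd w" by (simp add: z_def)
  then have "snd F \<bullet> snd F = y \<bullet> y + q\<^sup>2 / W\<^sup>2"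
    using W ww wz inner_J[of y y]
    by (simp add: Jy inner_add_left inner_add_right inner_commute W_def field_simps power2_eq_square)
  then have "- (fst F)\<^sup>2 + (y \<bullet> y + (fst F * W - \<beta>)\<^sup>2 / W\<^sup>2) = -1"
    using F by (simp add: space_form_def ip1_def power2_eq_square q)
  then have "2 * fst F * \<beta> * W = \<beta>\<^sup>2 + (1 + y \<bullet> y) * W\<^sup>2"
    using W by (simp add: field_simps power2_eq_square)
  then have F0: "fst F = (1 + y \<bullet> y) / (2 * \<beta>) * W + \<beta> / (2 * W)"
    using W b by (simp add: field_simps power2_eq_square)
  have hp: "horopoint \<beta> (y /\<^sub>R \<beta>) = ((1 + y \<bullet> y) / (2 * \<beta>)) *\<^sub>R w + \<beta> *\<^sub>R w' + (0, z)"
  proof -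
    have "\<beta>\<^sup>2 * ((y /\<^sub>R \<beta>) \<bullet> (y /\<^sub>R \<beta>)) = y \<bullet> y"
      using b by (simp add: power2_eq_square field_simps)
    then show ?thesis
      using b unfolding horopoint_def by (simp add: linear_scale[OF linear_J] Jy)
  qed
  have "fst (horopoint \<beta> (y /\<^sub>R \<beta>)) = fst F"
    unfolding hp F0 w'_def using W by (simp add: W_def[symmetric] power2_eq_square)
  moreover have "snd (horopoint \<beta> (y /\<^sub>R \<beta>)) = snd F"
  proof -
    have "(1 + y \<bullet> y) / (2 * \<beta>) - \<beta> / (2 * W\<^sup>2) = q / W\<^sup>2"
      unfolding q F0 using W b by (simp add: field_simps power2_eq_square)
    then have "((1 + y \<bullet> y) / (2 * \<beta>)) *\<^sub>R snd w - (\<beta> / (2 * W\<^sup>2)) *\<^sub>R snd w = (q / W\<^sup>2) *\<^sub>R snd w"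
      by (metis scaleR_diff_left)
    then show ?thesis unfolding hp w'_def z_def by (simp add: W_def[symmetric])
  qed
  ultimately show ?thesis by (simp add: prod_eq_iff y_def)
qed

section \<open>The parallel family of horospheres\<close>

definition h where "h = horopoint 1"
text \<open>\<open>w - h x\<close> is a unit vector orthogonal to \<open>h x\<close>, because
  \<open>w\<close> is lightlike and pairs to -1 with \<open>h x\<close>. The sign
  \<open>\<sigma>\<close> selects the side, so that increasing \<open>s\<close> can mean either
  direction.\<close>

definition N where "N \<sigma> x = \<sigma> *\<^sub>R (w - h x)" for \<sigma> :: real

lemma h_eq: "h x = ((1 + x \<bullet> x) / 2) *\<^sub>R w + w' + (0, J x)"
  by (simp add: h_def horopoint_def)

lemma horopoint_exp: "horopoint (exp (- t)) x = exp (- t) *\<^sub>R h x + sinh t *\<^sub>R w"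
proof -
  have "(1 + (exp (- t))\<^sup>2 * (x \<bullet> x)) / (2 * exp (- t)) = exp (- t) * ((1 + x \<bullet> x) / 2) + sinh t"
    by (simp add: sinh_field_def exp_minus field_simps power2_eq_square)
  then have "horopoint (exp (- t)) x
      = (exp (- t) * ((1 + x \<bullet> x) / 2) + sinh t) *\<^sub>R w + exp (- t) *\<^sub>R w' + (0, exp (- t) *\<^sub>R J x)"
    unfolding horopoint_def by simp
  also have "\<dots> = exp (- t) *\<^sub>R h x + sinh t *\<^sub>R w"
  proof -
    have "exp (- t) *\<^sub>R h x = (exp (- t) * ((1 + x \<bullet> x) / 2)) *\<^sub>R w + exp (- t) *\<^sub>R w' + (0, exp (- t) *\<^sub>R J x)"
      by (simp add: h_eq scaleR_add_right)
    then show ?thesis by (simp add: scaleR_add_left)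
  qed
  finally show ?thesis .
qed

text \<open>For \<open>\<sigma>\<close> equal to 1 or -1, \<open>cosh s - \<sigma> * sinh s\<close>
  is a single exponential, so moving by \<open>s\<close> along the normals rescales the level
  \<open>\<beta>\<close> and fixes the coordinate \<open>x\<close>.\<close>

lemma parallel_eq:
  assumes "\<sigma> \<in> {1, -1}"
  shows "parallel h (N \<sigma>) s x = exp (- (\<sigma> * s)) *\<^sub>R h x + sinh (\<sigma> * s) *\<^sub>R w"
    and "parallel h (N \<sigma>) s x = horopoint (exp (- (\<sigma> * s))) x"
proof -
  have "cosh s - \<sigma> * sinh s = exp (- (\<sigma> * s))" "\<sigma> * sinh s = sinh (\<sigma> * s)"
    using assms cosh_minus_sinh[of s] cosh_plus_sinh[of s] by auto
  then show 1: "parallel h (N \<sigma>) s x = exp (- (\<sigma> * s)) *\<^sub>R h x + sinh (\<sigma> * s) *\<^sub>R w"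
    by (simp add: parallel_def N_def algebra_simps)
  show "parallel h (N \<sigma>) s x = horopoint (exp (- (\<sigma> * s))) x"
    unfolding 1 horopoint_exp ..
qed

lemma h_has_derivative: "(h has_derivative (\<lambda>v. (x \<bullet> v) *\<^sub>R w + (0, J v))) (at x)"
proof -
  have J: "(J has_derivative J) (at x)"
    using linear_J bounded_linear_imp_has_derivative linear_linear by blast
  have "((\<lambda>x. ((1 + x \<bullet> x) / 2) *\<^sub>R w + w' + (0, J x)) has_derivative (\<lambda>v. (x \<bullet> v) *\<^sub>R w + (0, J v))) (at x)"
    by (auto intro!: derivative_eq_intros J simp: inner_commute)
  then show ?thesis unfolding h_eq[abs_def] by (simp add: h_eq)
qed

lemma smooth_h: "smooth_on UNIV h"
proof -
  have J: "smooth_on UNIV (\<lambda>x. (0::real, J x))"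
  proof (rule smooth_on_linear[OF open_UNIV, of "\<lambda>x. (0, J x)" "\<lambda>x. x"])
    show "bounded_linear (\<lambda>x. (0::real, J x))"
      using linear_J by (intro bounded_linear_intros) (simp add: linear_linear)
    show "smooth_on UNIV (\<lambda>x. x)"
      by (simp add: smooth_on_def Ck_on_linear[OF bounded_linear_ident])
  qed
  have id: "smooth_on UNIV (\<lambda>x::real^'k. x)"
    by (simp add: smooth_on_def Ck_on_linear[OF bounded_linear_ident])
  have "smooth_on UNIV (\<lambda>x. ((1/2) * (1 + x \<bullet> x)) *\<^sub>R w + w' + (0, J x))"
    by (intro smooth_on_add smooth_on_scaleR smooth_on_mult smooth_on_const J id
        smooth_on_bilinear[OF _ bounded_bilinear_inner] open_UNIV)
  then show ?thesis by (simp add: h_eq[abs_def])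
qed

lemma horosphere_patch:
  assumes \<sigma>: "\<sigma> \<in> {1, -1}" and V: "open V" "connected V"
  shows "hyperbolic_hypersurface V (parallel h (N \<sigma>) s) (parallel (N \<sigma>) h s)"
proof -
  let ?p = "parallel h (N \<sigma>) s" and ?q = "parallel (N \<sigma>) h s"
  have \<sigma>2: "\<sigma> * \<sigma> = 1" using \<sigma> by auto
  have smN: "smooth_on UNIV (N \<sigma>)"
    unfolding N_def[abs_def] by (intro smooth_on_scaleR smooth_on_diff smooth_on_const smooth_h open_UNIV)
  have smp: "smooth_on UNIV ?p" "smooth_on UNIV ?q"
    unfolding parallel_def[abs_def]
    by (intro smooth_on_add smooth_on_scaleR smooth_on_const smooth_h smN open_UNIV)+
  have hh: "ip1 (-1) (h x) (h x) = -1" "ip1 (-1) (h x) w = -1" "ip1 (-1) w (h x) = -1" for x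
    using horopoint_ip1[of 1 x] horopoint_w[of 1 x] ip1_commute[of "-1" w "h x"] by (simp_all add: h_def)
  have NN: "ip1 (-1) (N \<sigma> x) (N \<sigma> x) = 1" "ip1 (-1) (N \<sigma> x) (h x) = 0" "ip1 (-1) (h x) (N \<sigma> x) = 0" for x
    using \<sigma>2 by (simp_all add: N_def ip1_simps hh w)
  \<comment> \<open>The \<open>w\<close>-term does not depend on \<open>x\<close>, so the tangent
    spaces of all members of the family are that of \<open>h\<close>, and two orthogonality checks
    serve every \<open>s\<close>.\<close>
  have Dp: "D ?p x v = exp (- (\<sigma> * s)) *\<^sub>R ((x \<bullet> v) *\<^sub>R w + (0, J v))" for x v
  proof -
    have "(?p has_derivative (\<lambda>v. exp (- (\<sigma> * s)) *\<^sub>R ((x \<bullet> v) *\<^sub>R w + (0, J v)))) (at x)"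
      unfolding parallel_eq(1)[OF \<sigma>, abs_def] by (auto intro!: derivative_eq_intros h_has_derivative)
    from fun_cong[OF frechet_derivative_at[OF this], of v] show ?thesis by (rule sym)
  qed
  have hD: "ip1 (-1) (h x) ((x \<bullet> v) *\<^sub>R w + (0, J v)) = 0" for x v
    by (simp add: ip1_simps hh) (simp add: h_eq ip1_simps ip1_w)
  have wD: "ip1 (-1) w ((x \<bullet> v) *\<^sub>R w + (0, J v)) = 0" for x v
    by (simp add: ip1_simps w ip1_w)
  have cs: "cosh s * cosh s - sinh s * sinh s = 1"
    using cosh_square_eq[of s] by (simp add: power2_eq_square)
  show ?thesis
    unfolding hyperbolic_hypersurface_def
  proof (intro conjI ballI allI V)
    show "smooth_on V ?p" "smooth_on V ?q" using smp smooth_on_subset by blast+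
    show "?p ` V \<subseteq> space_form (-1)"
      unfolding parallel_eq(2)[OF \<sigma>, abs_def] using horopoint_space_form by auto
    fix x
    show "inj (D ?p x)"
    proof (rule injI)
      fix v v' assume "D ?p x v = D ?p x v'"
      then have eq: "(x \<bullet> v) *\<^sub>R w + (0, J v) = (x \<bullet> v') *\<^sub>R w + (0, J v')" by (simp add: Dp)
      from arg_cong[OF this, of fst] have "x \<bullet> v = x \<bullet> v'" using w_future by simp
      with arg_cong[OF eq, of snd] have "J v = J v'" by simp
      then show "v = v'" using J'_J by metis
    qed
    show "ip1 (-1) (?q x) (?q x) = 1" "ip1 (-1) (?q x) (?p x) = 0"
      using cs by (simp_all add: parallel_def ip1_simps hh NN mult.commute)
    have "ip1 (-1) (?q x) d = 0" if "ip1 (-1) (h x) d = 0" "ip1 (-1) w d = 0" for d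
      by (simp add: parallel_def N_def ip1_simps that)
    from this[OF hD wD] show "ip1 (-1) (?q x) (D ?p x v) = 0" for v
      unfolding Dp by (simp only: ip1_simps(8)) simp
  qed
qed

lemma parallel_horospheres_patch:
  assumes \<sigma>: "\<sigma> \<in> {1, -1}" and V: "open V" "connected V"
  shows "parallel_horospheres V I h (N \<sigma>)"
proof -
  have "hyperbolic_hypersurface V h (N \<sigma>)"
    using horosphere_patch[OF assms, of 0] by (simp add: parallel_def[abs_def])
  moreover have "\<exists>H. horosphere H \<and> openin (top_of_set H) (parallel h (N \<sigma>) s ` V)" for s
  proof -
    define \<beta> where "\<beta> = exp (- (\<sigma> * s))"
    have b: "\<beta> > 0" by (simp add: \<beta>_def)
    define H where "H = {x \<in> space_form (-1). ip1 (-1) x w = - \<beta>}"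
    have "horopoint \<beta> 0 \<in> H"
      using horopoint_space_form[OF b] horopoint_w[of \<beta>] b by (simp add: H_def)
    moreover have "w \<noteq> 0" using w_future by auto
    ultimately have "horosphere H"
      unfolding horosphere_def using w H_def by blast
    \<comment> \<open>The parametrization has a continuous left inverse on the horosphere, so the
      image of \<open>V\<close> is a preimage of \<open>V\<close> and hence relatively open.\<close>
    moreover have "parallel h (N \<sigma>) s ` V = H \<inter> (\<lambda>F. J' (snd F) /\<^sub>R \<beta>) -` V"
    proof (intro equalityI subsetI)
      fix F assume "F \<in> parallel h (N \<sigma>) s ` V"
      then obtain x where x: "x \<in> V" "F = horopoint \<beta> x"
        unfolding parallel_eq(2)[OF \<sigma>] \<beta>_def by blast
      then show "F \<in> H \<inter> (\<lambda>F. J' (snd F) /\<^sub>R \<beta>) -` V"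
        using b horopoint_space_form[OF b] horopoint_w[of \<beta>] by (simp add: H_def J'_horopoint)
    next
      fix F assume F: "F \<in> H \<inter> (\<lambda>F. J' (snd F) /\<^sub>R \<beta>) -` V"
      then have "F = horopoint \<beta> (J' (snd F) /\<^sub>R \<beta>)"
        using horopoint_surj[OF _ _ b] by (simp add: H_def)
      then show "F \<in> parallel h (N \<sigma>) s ` V"
        using F unfolding parallel_eq(2)[OF \<sigma>, abs_def] \<beta>_def[symmetric] by blast
    qed
    moreover have "openin (top_of_set H) (H \<inter> (\<lambda>F. J' (snd F) /\<^sub>R \<beta>) -` V)"
    proof (rule continuous_openin_preimage_gen[OF _ V(1)])
      have "bounded_linear J'" using linear_J' by (simp add: linear_linear)
      then have "continuous_on UNIV J'" by (rule linear_continuous_on)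
      then show "continuous_on H (\<lambda>F. J' (snd F) /\<^sub>R \<beta>)"
        by (intro continuous_intros continuous_on_compose2[of UNIV J' H snd]) auto
    qed
    ultimately show ?thesis by (intro exI[of _ H]) simp
  qed
  ultimately show ?thesis
    unfolding parallel_horospheres_def using horosphere_patch[OF assms] by blast
qed

lemma parallel_inverse:
  assumes \<sigma>: "\<sigma> \<in> {1, -1}" and F: "F \<in> space_form (-1)" "ip1 (-1) F w = - exp (- (\<sigma> * s))"
  shows "parallel h (N \<sigma>) s (exp (\<sigma> * s) *\<^sub>R J' (snd F)) = F"
  using horopoint_surj[OF F] unfolding parallel_eq(2)[OF \<sigma>] by (simp add: exp_minus)

lemma parallel_differentiable:
  assumes \<sigma>: "\<sigma> \<in> {1, -1}"
  shows "(\<lambda>z. parallel h (N \<sigma>) (snd z) (fst z)) differentiable (at z)"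
proof -
  have "((\<lambda>z. h (fst z)) has_derivative (\<lambda>v. (fst z \<bullet> fst v) *\<^sub>R w + (0, J (fst v)))) (at z)"
    by (rule has_derivative_compose[OF _ h_has_derivative]) (auto intro!: derivative_eq_intros)
  then have "(\<lambda>z. h (fst z)) differentiable (at z)" by (auto simp: differentiable_def)
  moreover have "(\<lambda>z. exp (- (\<sigma> * snd z))) differentiable (at z)" "(\<lambda>z. sinh (\<sigma> * snd z)) differentiable (at z)"
    unfolding differentiable_def sinh_field_def by (rule exI, auto intro!: derivative_eq_intros)+
  ultimately show ?thesis
    unfolding parallel_eq(1)[OF \<sigma>, abs_def] by (auto intro!: derivative_intros)
qed

end

text \<open>A lightlike \<open>w\<close> with \<open>fst w > 0\<close> has nonzero space part, whose
  orthogonal hyperplane has dimension \<open>CARD('k)\<close> and is therefore a linear isometric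
  image of \<open>real^'k\<close>.\<close>

lemma horosphere_coordinates_exist:
  fixes w :: "'n::finite flat1"
  assumes k: "CARD('n) = CARD('k::finite) + 1" and w: "ip1 (-1) w w = 0" "fst w > 0"
  obtains J :: "real^'k \<Rightarrow> real^'n" where "horosphere_coordinates w J"
proof -
  have "snd w \<bullet> snd w = fst w * fst w" using w by (simp add: ip1_def)
  then have "snd w \<noteq> 0" using w(2) by auto
  from dim_hyperplane[OF this] have "dim (UNIV :: (real^'k) set) = dim {y. snd w \<bullet> y = 0}"
    using k by simp
  then obtain J :: "real^'k \<Rightarrow> real^'n" where "linear J" "J ` UNIV = {y. snd w \<bullet> y = 0}"
      "\<And>x. x \<in> UNIV \<Longrightarrow> norm (J x) = norm x"
    using isometry_subspaces[OF subspace_UNIV subspace_hyperplane] by blast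
  then have "horosphere_coordinates w J"
    using w by (intro horosphere_coordinates.intro) simp_all
  then show ?thesis by (rule that)
qed

section \<open>From charts to the manifold\<close>

lemma chart_facts:
  assumes "smooth_atlas \<A>" "\<kappa> \<in> \<A>"
  shows "open (fst \<kappa>)" "open (chart_image \<kappa>)"
    and "homeomorphism (fst \<kappa>) (chart_image \<kappa>) (snd \<kappa>) (chart_inv \<kappa>)"
    and "p \<in> fst \<kappa> \<Longrightarrow> snd \<kappa> p \<in> chart_image \<kappa>" "p \<in> fst \<kappa> \<Longrightarrow> chart_inv \<kappa> (snd \<kappa> p) = p"
    and "u \<in> chart_image \<kappa> \<Longrightarrow> chart_inv \<kappa> u \<in> fst \<kappa>" "u \<in> chart_image \<kappa> \<Longrightarrow> snd \<kappa> (chart_inv \<kappa> u) = u"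
    and "open O' \<Longrightarrow> open (snd \<kappa> ` (fst \<kappa> \<inter> O'))"
proof -
  show o: "open (fst \<kappa>)" "open (chart_image \<kappa>)"
    and hom: "homeomorphism (fst \<kappa>) (chart_image \<kappa>) (snd \<kappa>) (chart_inv \<kappa>)"
    using assms by (auto simp: smooth_atlas_def)
  show "p \<in> fst \<kappa> \<Longrightarrow> snd \<kappa> p \<in> chart_image \<kappa>" "p \<in> fst \<kappa> \<Longrightarrow> chart_inv \<kappa> (snd \<kappa> p) = p"
    "u \<in> chart_image \<kappa> \<Longrightarrow> chart_inv \<kappa> u \<in> fst \<kappa>" "u \<in> chart_image \<kappa> \<Longrightarrow> snd \<kappa> (chart_inv \<kappa> u) = u"
    using hom by (auto simp: homeomorphism_def)
  assume "open O'"
  then have "openin (top_of_set (fst \<kappa>)) (fst \<kappa> \<inter> O')" by blast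
  from homeomorphism_imp_open_map[OF hom this] show "open (snd \<kappa> ` (fst \<kappa> \<inter> O'))"
    using o(2) openin_open_trans by blast
qed

text \<open>The inverse of the parametrization is \<open>G \<circ> snd \<kappa>\<close>; in any
  other chart both directions become smooth by composition with a transition map.\<close>

lemma diffeo_from_chart:
  fixes \<A> :: "('m::{t2_space, second_countable_topology}, 'e::euclidean_space) chart set"
    and G :: "'e \<Rightarrow> 'd::euclidean_space"
  assumes \<A>: "smooth_atlas \<A>" "\<kappa> \<in> \<A>" and U: "open U" "U \<subseteq> chart_image \<kappa>" and V: "open V"
    and hom: "homeomorphism U V G H" and G: "smooth_on U G" and H: "smooth_on V H"
    and W: "open W" "W \<subseteq> V"
  shows "diffeo_onto_open \<A> W (chart_inv \<kappa> \<circ> H)"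
proof -
  let ?\<psi> = "chart_inv \<kappa> \<circ> H"
  note \<kappa> = chart_facts[OF \<A>]
  have HW: "H ` W \<subseteq> U" using hom W(2) by (auto simp: homeomorphism_def)
  have GH: "G (H x) = x" if "x \<in> V" for x using hom that by (auto simp: homeomorphism_def)
  have oH: "open (H ` W)"
    using homeomorphism_imp_open_map[OF homeomorphism_symD[OF hom], of W] U(1) V W
    by (metis open_openin openin_open_trans openin_subset subtopology_UNIV open_subset)
  have hom2: "homeomorphism (chart_image \<kappa>) (fst \<kappa>) (chart_inv \<kappa>) (snd \<kappa>)"
    by (rule homeomorphism_symD[OF \<kappa>(3)])
  have "openin (top_of_set (fst \<kappa>)) (chart_inv \<kappa> ` (H ` W))"
    by (rule homeomorphism_imp_open_map[OF hom2 open_subset[OF _ oH]]) (use HW U(2) in blast)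
  then have o\<psi>: "open (?\<psi> ` W)"
    using \<kappa>(1) openin_open_trans by (metis image_comp)
  have \<psi>W: "?\<psi> ` W \<subseteq> fst \<kappa>" using HW U(2) \<kappa>(6) by auto
  have inv: "(G \<circ> snd \<kappa>) (?\<psi> x) = x" if "x \<in> W" for x
    using that HW U(2) \<kappa>(7) GH W(2) by (auto simp: subset_iff image_iff)
  have inv_into: "inv_into W ?\<psi> y = (G \<circ> snd \<kappa>) y" if y: "y \<in> ?\<psi> ` W" for y
  proof -
    obtain x where x: "x \<in> W" "y = ?\<psi> x" using y by blast
    have "inj_on ?\<psi> W" by (rule inj_on_inverseI) (rule inv)
    then show ?thesis using x inv by (metis inv_into_f_f)
  qed
  have "homeomorphism W (H ` W) H G"
    by (rule homeomorphism_of_subsets[OF homeomorphism_symD[OF hom] W(2) HW refl])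
  moreover have "homeomorphism (H ` W) (chart_inv \<kappa> ` (H ` W)) (chart_inv \<kappa>) (snd \<kappa>)"
    by (rule homeomorphism_of_subsets[OF hom2 _ _ refl, of _ "fst \<kappa>"]) (use HW U(2) in auto)
  ultimately have "homeomorphism W (chart_inv \<kappa> ` (H ` W)) ?\<psi> (G \<circ> snd \<kappa>)"
    by (rule homeomorphism_compose)
  then have h\<psi>: "homeomorphism W (?\<psi> ` W) ?\<psi> (inv_into W ?\<psi>)"
    by (rule homeomorphism_cong) (auto simp: image_comp inv_into)
  have c\<psi>: "continuous_on W ?\<psi>" using h\<psi> by (simp add: homeomorphism_def)
  show ?thesis
    unfolding diffeo_onto_open_def
  proof (intro conjI ballI W(1) o\<psi> h\<psi>)
    show "?\<psi> ` W \<subseteq> carrier_of \<A>" using \<psi>W \<A>(2) by (auto simp: carrier_of_def)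
    fix \<kappa>' assume \<kappa>'A: "\<kappa>' \<in> \<A>"
    note \<kappa>' = chart_facts[OF \<A>(1) \<kappa>'A]
    have tr: "smooth_on (snd \<kappa> ` (fst \<kappa> \<inter> fst \<kappa>')) (snd \<kappa>' \<circ> chart_inv \<kappa>)"
      "smooth_on (snd \<kappa>' ` (fst \<kappa>' \<inter> fst \<kappa>)) (snd \<kappa> \<circ> chart_inv \<kappa>')"
      using \<A> \<kappa>'A by (auto simp: smooth_atlas_def)
    show "smooth_on (W \<inter> ?\<psi> -` fst \<kappa>') (snd \<kappa>' \<circ> ?\<psi>)"
    proof -
      have "smooth_on (W \<inter> ?\<psi> -` fst \<kappa>') (\<lambda>x. (snd \<kappa>' \<circ> chart_inv \<kappa>) (H x))"
      proof (rule smooth_on_compose[OF _ _ _ _ tr(1)])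
        show "open (W \<inter> ?\<psi> -` fst \<kappa>')" by (rule continuous_open_preimage[OF c\<psi> W(1) \<kappa>'(1)])
        show "open (snd \<kappa> ` (fst \<kappa> \<inter> fst \<kappa>'))" by (rule \<kappa>(8)[OF \<kappa>'(1)])
        show "smooth_on (W \<inter> ?\<psi> -` fst \<kappa>') H" using smooth_on_subset[OF H] W(2) by blast
        show "H ` (W \<inter> ?\<psi> -` fst \<kappa>') \<subseteq> snd \<kappa> ` (fst \<kappa> \<inter> fst \<kappa>')"
        proof
          fix y assume "y \<in> H ` (W \<inter> ?\<psi> -` fst \<kappa>')"
          then obtain x where x: "x \<in> W" "?\<psi> x \<in> fst \<kappa>'" "y = H x" by auto
          then have y: "y \<in> chart_image \<kappa>" using HW U(2) by auto
          then show "y \<in> snd \<kappa> ` (fst \<kappa> \<inter> fst \<kappa>')"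
            using x \<kappa>(6)[OF y] \<kappa>(7)[OF y] by (intro image_eqI[of _ _ "chart_inv \<kappa> y"]) auto
        qed
      qed
      then show ?thesis by (simp add: comp_def)
    qed
    show "smooth_on (snd \<kappa>' ` (fst \<kappa>' \<inter> ?\<psi> ` W)) (inv_into W ?\<psi> \<circ> chart_inv \<kappa>')"
    proof (rule smooth_on_cong)
      show op: "open (snd \<kappa>' ` (fst \<kappa>' \<inter> ?\<psi> ` W))" by (rule \<kappa>'(8)[OF o\<psi>])
      show "smooth_on (snd \<kappa>' ` (fst \<kappa>' \<inter> ?\<psi> ` W)) (\<lambda>u. G ((snd \<kappa> \<circ> chart_inv \<kappa>') u))"
      proof (rule smooth_on_compose[OF op U(1) _ _ G])
        show "smooth_on (snd \<kappa>' ` (fst \<kappa>' \<inter> ?\<psi> ` W)) (snd \<kappa> \<circ> chart_inv \<kappa>')"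
          by (rule smooth_on_subset[OF tr(2)]) (use \<psi>W in blast)
        show "(snd \<kappa> \<circ> chart_inv \<kappa>') ` (snd \<kappa>' ` (fst \<kappa>' \<inter> ?\<psi> ` W)) \<subseteq> U"
        proof clarsimp
          fix x assume x: "x \<in> W" "chart_inv \<kappa> (H x) \<in> fst \<kappa>'"
          then have "H x \<in> U" using HW by blast
          then show "snd \<kappa> (chart_inv \<kappa>' (snd \<kappa>' (chart_inv \<kappa> (H x)))) \<in> U"
            using \<kappa>'(5)[OF x(2)] \<kappa>(7) U(2) by auto
        qed
      qed
      show "G ((snd \<kappa> \<circ> chart_inv \<kappa>') u) = (inv_into W ?\<psi> \<circ> chart_inv \<kappa>') u"
        if "u \<in> snd \<kappa>' ` (fst \<kappa>' \<inter> ?\<psi> ` W)" for u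
      proof -
        obtain y where y: "y \<in> fst \<kappa>'" "y \<in> ?\<psi> ` W" "u = snd \<kappa>' y" using \<open>u \<in> _\<close> by blast
        then show ?thesis using inv_into[OF y(2)] \<kappa>'(5)[OF y(1)] by simp
      qed
    qed
  qed
qed

text \<open>\<open>G\<close> records the horospherical coordinate of a point and its height divided
  by \<open>B\<close>. The model map \<open>\<Psi>\<close> recovers \<open>\<phi>\<close> from
  \<open>G\<close>, so the derivative of \<open>G\<close> is injective between spaces of equal
  dimension, and the local inverse of \<open>G\<close> is the required parametrization.\<close>

lemma (in constant_curvature_chart) local_horosphere_form:
  fixes \<mu> n0 :: real
  defines "B \<equiv> \<bar>\<mu>\<bar> / \<bar>n0\<bar>"
  assumes k: "CARD('n) = CARD('k::finite) + 1" and n: "CARD('n) \<ge> 2"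
    and p: "p \<in> U" and nu_const: "\<forall>u\<in>U. nu u = n0" and \<mu>: "\<mu>\<^sup>2 = 1 - n0\<^sup>2" "- \<mu> \<notin> \<Lambda>"
    and in_space_form: "\<forall>u\<in>U. fst (\<phi> u) \<in> space_form (-1)"
  shows "\<exists>(V :: (real^'k) set) I h N U' V' G H. open V \<and> open I \<and> is_interval I \<and> parallel_horospheres V I h N \<and>
    open U' \<and> U' \<subseteq> U \<and> p \<in> U' \<and> open V' \<and> V \<times> I \<subseteq> V' \<and> G p \<in> V \<times> I \<and> homeomorphism U' V' G H \<and>
    smooth_on U' G \<and> smooth_on V' H \<and>
    (\<forall>x\<in>V. \<forall>s\<in>I. \<phi> (H (x, s)) = (parallel h N s x, 0) + (B * s) *\<^sub>R dt)"
proof -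
  have nu: "\<And>u. u \<in> U \<Longrightarrow> nu u = n0" and space_form: "\<And>u. u \<in> U \<Longrightarrow> fst (\<phi> u) \<in> space_form (-1)"
    using nu_const in_space_form by blast+
  have c: "c = -1" by (rule hyperbolic[OF n p nu])
  have n0: "n0 \<noteq> 0" using nu_nonzero[OF p] nu[OF p] by simp
  have \<mu>0: "\<mu> \<noteq> 0" using \<mu>(1) nu_bound[OF p] nu[OF p] by auto
  have B: "B > 0" using n0 \<mu>0 by (simp add: B_def)
  obtain r where r: "r > 0" "ball p r \<subseteq> U" using open_U p open_contains_ball by blast
  have pb: "p \<in> ball p r" using r by simp
  define a where "a = n0 / \<mu>"
  define Wf where "Wf u = exp (a * snd (\<phi> u)) *\<^sub>R (P u + (1 / \<mu>) *\<^sub>R space_part (e u))" for u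
  have "\<exists>C. \<forall>u\<in>ball p r. Wf u = C"
  proof (rule has_derivative_zero_constant)
    fix u assume "u \<in> ball p r"
    then have u: "u \<in> U" using r by blast
    have "(Wf has_derivative (\<lambda>v. 0)) (at u)"
      unfolding Wf_def a_def
      by (rule horosphere_normal_constant[OF c nu \<mu>(1) \<mu>0 umbilical[OF n _ nu \<mu>] u])
    then show "(Wf has_derivative (\<lambda>v. 0)) (at u within ball p r)" by (rule has_derivative_at_withinI)
  qed simp
  then obtain C where C: "\<And>u. u \<in> ball p r \<Longrightarrow> Wf u = C" by blast
  define w where "w = fst C"
  have w_eq: "w = exp (a * snd (\<phi> u)) *\<^sub>R (fst (\<phi> u) + (1 / \<mu>) *\<^sub>R fst (e u))" if "u \<in> ball p r" for u
    using arg_cong[OF C[OF that], of fst] by (simp add: w_def Wf_def P_def space_part_def)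
  have ips: "ip1 (-1) (fst (\<phi> u)) (fst (\<phi> u)) = -1" "ip1 (-1) (fst (e u)) (fst (\<phi> u)) = 0"
    "ip1 (-1) (fst (\<phi> u)) (fst (e u)) = 0" "ip1 (-1) (fst (e u)) (fst (e u)) = \<mu>\<^sup>2" if "u \<in> U" for u
    using on_quadric[OF that] e_tangent[OF that] e_unit[OF that] nu[OF that] \<mu>(1)
      ip1_commute[of "-1" "fst (e u)" "fst (\<phi> u)"]
    by (simp_all add: c ip2_def nu_def power2_eq_square)
  have Fw: "ip1 (-1) (fst (\<phi> u)) w = - exp (a * snd (\<phi> u))" if "u \<in> ball p r" for u
    using ips[of u] that r(2) by (simp add: w_eq[OF that] ip1_simps subset_iff)
  have ww: "ip1 (-1) w w = 0"
    using ips[OF p] \<mu>0 by (simp add: w_eq[OF pb] ip1_simps power2_eq_square)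
  have w0: "fst w > 0"
    by (rule lightlike_future[OF space_form[OF p] ww]) (simp add: Fw[OF pb])
  obtain J :: "real^'k \<Rightarrow> real^'n" where "horosphere_coordinates w J"
    using horosphere_coordinates_exist[OF k ww w0] by blast
  then interpret H: horosphere_coordinates w J .
  \<comment> \<open>The level of the horosphere varies as \<open>exp (a * t)\<close> with the height
    \<open>t\<close>. This sign gives \<open>a * t = - (\<sigma> * s)\<close> for
    \<open>s = t / B\<close>, the dependence found in \<open>parallel_eq\<close>, while
    \<open>B\<close> stays positive.\<close>
  define \<sigma> where "\<sigma> = - sgn a"
  have \<sigma>: "\<sigma> \<in> {1, -1}" using n0 \<mu>0 by (auto simp: \<sigma>_def a_def sgn_if)
  have "\<bar>a\<bar> = 1 / B" using n0 \<mu>0 by (simp add: a_def B_def abs_divide)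
  then have aB: "a * t = - (\<sigma> * (t / B))" for t
    using mult_sgn_abs[of a] by (metis (no_types) \<sigma>_def minus_mult_left minus_minus mult.assoc mult_1 times_divide_eq_left)
  define s where "s u = snd (\<phi> u) / B" for u
  define G where "G u = (exp (\<sigma> * s u) *\<^sub>R H.J' (snd (fst (\<phi> u))), s u)" for u
  define \<Psi> where "\<Psi> z = (parallel H.h (H.N \<sigma>) (snd z) (fst z), B * snd z)" for z
  have \<Psi>G: "\<Psi> (G u) = \<phi> u" if u: "u \<in> ball p r" for u
  proof -
    have "parallel H.h (H.N \<sigma>) (s u) (exp (\<sigma> * s u) *\<^sub>R H.J' (snd (fst (\<phi> u)))) = fst (\<phi> u)"
      using u r(2) by (intro H.parallel_inverse \<sigma> space_form) (auto simp: Fw[OF u] aB s_def)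
    then show ?thesis using B by (simp add: \<Psi>_def G_def prod_eq_iff s_def)
  qed
  have sm\<phi>: "smooth_on (ball p r) \<phi>" by (rule smooth_on_subset[OF smooth_\<phi> r(2)])
  have sms: "smooth_on (ball p r) s"
    unfolding s_def[abs_def]
    by (rule smooth_on_linear[OF open_ball _ sm\<phi>, of "\<lambda>x. snd x / B"])
      (rule bounded_linear_compose[OF bounded_linear_divide bounded_linear_snd])
  have bJ: "bounded_linear (\<lambda>x :: 'n flat2. H.J' (snd (fst x)))"
    using bounded_linear_compose[OF _ bounded_linear_compose[OF bounded_linear_snd bounded_linear_fst]]
      H.linear_J' linear_linear by blast
  have smG: "smooth_on (ball p r) G"
    unfolding G_def[abs_def]
    by (intro smooth_on_Pair smooth_on_scaleR smooth_on_exp smooth_on_mult smooth_on_const sms open_ball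
        smooth_on_linear[OF open_ball bJ sm\<phi>])
  have d\<Psi>: "\<Psi> differentiable (at z)" for z
  proof -
    obtain E where "((\<lambda>z. parallel H.h (H.N \<sigma>) (snd z) (fst z)) has_derivative E) (at z)"
      using H.parallel_differentiable[OF \<sigma>, of z] unfolding differentiable_def by blast
    then have "(\<Psi> has_derivative (\<lambda>v. (E v, B * snd v))) (at z)"
      unfolding \<Psi>_def[abs_def] by (auto intro!: derivative_eq_intros)
    then show ?thesis by (auto simp: differentiable_def)
  qed
  have "D \<phi> p v = D \<Psi> (G p) (D G p v)" for v
  proof -
    have "frechet_derivative (\<lambda>u. \<Psi> (G u)) (at p) = frechet_derivative \<phi> (at p)"
      by (rule frechet_derivative_cong_open[OF open_ball pb]) (rule \<Psi>G)
    then show ?thesis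
      using frechet_derivative_chain(1)[OF smooth_on_differentiable[OF smG pb] d\<Psi>, of v] by simp
  qed
  then have inj: "inj (D G p)" by (intro injI) (metis D_eq_iff[OF p])
  have dim: "DIM((real^'k) \<times> real) = CARD('n)" using k by simp
  obtain U' V' H where UVH: "open U'" "U' \<subseteq> ball p r" "p \<in> U'" "open V'" "homeomorphism U' V' G H"
      "smooth_on V' H"
    using smooth_inverse_function[OF dim open_ball pb smG inj] by blast
  have "G p \<in> V'" using UVH(3,5) by (auto simp: homeomorphism_def)
  then obtain V0 I0 where VI0: "open V0" "open I0" "G p \<in> V0 \<times> I0" "V0 \<times> I0 \<subseteq> V'"
    using open_prod_elim[OF UVH(4)] by metis
  then obtain r1 r2 where r12: "r1 > 0" "ball (fst (G p)) r1 \<subseteq> V0" "r2 > 0" "ball (snd (G p)) r2 \<subseteq> I0"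
    by (metis mem_Times_iff openE)
  \<comment> \<open>Balls make \<open>V\<close> connected and \<open>I\<close> an interval.\<close>
  define V where "V = ball (fst (G p)) r1"
  define I where "I = ball (snd (G p)) r2"
  have VI: "V \<times> I \<subseteq> V'" using r12 VI0(4) by (auto simp: V_def I_def)
  have form: "\<phi> (H (x, t)) = (parallel H.h (H.N \<sigma>) t x, 0) + (B * t) *\<^sub>R dt" if "x \<in> V" "t \<in> I" for x t
  proof -
    have "(x, t) \<in> V'" using that VI by blast
    then have "H (x, t) \<in> ball p r" "G (H (x, t)) = (x, t)"
      using UVH(2,5) by (auto simp: homeomorphism_def)
    then show ?thesis using \<Psi>G[of "H (x, t)"] by (simp add: \<Psi>_def dt_def)
  qed
  have GpVI: "G p \<in> V \<times> I" using r12 by (simp add: V_def I_def mem_Times_iff)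
  have ph: "parallel_horospheres V I H.h (H.N \<sigma>)"
    by (rule H.parallel_horospheres_patch[OF \<sigma>]) (simp_all add: V_def)
  have smGU: "smooth_on U' G" by (rule smooth_on_subset[OF smG UVH(2)])
  have VIo: "open V" "open I" "is_interval I" by (simp_all add: V_def I_def is_interval_ball_real)
  have UU: "U' \<subseteq> U" using UVH(2) r(2) by blast
  show ?thesis
    by (rule exI[of _ V], rule exI[of _ I], rule exI[of _ H.h], rule exI[of _ "H.N \<sigma>"],
        rule exI[of _ U'], rule exI[of _ V'], rule exI[of _ G], rule exI[of _ H])
      (intro conjI ballI VIo ph UVH UU VI GpVI smGU form)
qed

lemma immersed_chart_hypersurface:
  assumes c: "c \<in> {1, -1}" and hyp: "hypersurface c \<A> g f \<eta>" and \<kappa>: "\<kappa> \<in> \<A>"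
  shows "immersed_chart c (chart_image \<kappa>) (f \<circ> chart_inv \<kappa>) (\<eta> \<circ> chart_inv \<kappa>)"
proof -
  have \<A>: "smooth_atlas \<A>" using hyp by (simp add: hypersurface_def)
  note K = chart_facts[OF \<A> \<kappa>]
  have md: "D (f \<circ> chart_inv \<kappa>) u v = mdiff \<kappa> f (chart_inv \<kappa> u) v" if "u \<in> chart_image \<kappa>" for u v
    using K(7)[OF that] by (simp add: mdiff_def)
  have car: "chart_inv \<kappa> u \<in> carrier_of \<A>" if "u \<in> chart_image \<kappa>" for u
    using K(6)[OF that] \<kappa> by (auto simp: carrier_of_def)
  have rm: "riemannian_metric \<A> g" and isometric: "\<forall>\<kappa>\<in>\<A>. \<forall>p\<in>fst \<kappa>. \<forall>v w.
      ip2 c (mdiff \<kappa> f p v) (mdiff \<kappa> f p w) = g \<kappa> p v w"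
    using hyp by (simp_all add: hypersurface_def)
  have metric: "\<forall>\<kappa>\<in>\<A>. \<forall>p\<in>fst \<kappa>. \<forall>v. v \<noteq> 0 \<longrightarrow> g \<kappa> p v v > 0"
    using conjunct1[OF rm[unfolded riemannian_metric_def]] by blast
  show ?thesis
  proof
    show "smooth_on (chart_image \<kappa>) (f \<circ> chart_inv \<kappa>)" "smooth_on (chart_image \<kappa>) (\<eta> \<circ> chart_inv \<kappa>)"
      using hyp \<kappa> by (auto simp: hypersurface_def smooth_map_def)
    fix u assume u: "u \<in> chart_image \<kappa>"
    have "f (chart_inv \<kappa> u) \<in> space_form c \<times> UNIV"
      using hyp car[OF u] by (auto simp: hypersurface_def)
    then show "ip1 c (fst ((f \<circ> chart_inv \<kappa>) u)) (fst ((f \<circ> chart_inv \<kappa>) u)) = c"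
      by (auto simp: space_form_def)
    show "ip2 c ((\<eta> \<circ> chart_inv \<kappa>) u) ((\<eta> \<circ> chart_inv \<kappa>) u) = 1"
      "ip2 c ((\<eta> \<circ> chart_inv \<kappa>) u) (fst ((f \<circ> chart_inv \<kappa>) u), 0) = 0"
      using hyp car[OF u] by (auto simp: hypersurface_def)
    show "ip2 c ((\<eta> \<circ> chart_inv \<kappa>) u) (D (f \<circ> chart_inv \<kappa>) u v) = 0" for v
      unfolding md[OF u] using hyp \<kappa> K(6)[OF u] by (auto simp: hypersurface_def)
    show "0 < ip2 c (D (f \<circ> chart_inv \<kappa>) u v) (D (f \<circ> chart_inv \<kappa>) u v)" if "v \<noteq> 0" for v
    proof -
      have "ip2 c (mdiff \<kappa> f (chart_inv \<kappa> u) v) (mdiff \<kappa> f (chart_inv \<kappa> u) v) = g \<kappa> (chart_inv \<kappa> u) v v"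
        "g \<kappa> (chart_inv \<kappa> u) v v > 0"
        using metric isometric \<kappa> K(6)[OF u] that by auto
      then show ?thesis unfolding md[OF u] by simp
    qed
  qed (use c K in auto)
qed

text \<open>The constants of the locale depend on the coordinate expressions of one chart. Their
  identification with the notions on the manifold is exported as well, since conclusions from
  different charts have to be combined.\<close>

lemma constant_curvature_chart_hypersurface:
  assumes c: "c \<in> {1, -1}" and hyp: "hypersurface c \<A> g f \<eta>" and \<kappa>: "\<kappa> \<in> \<A>"
    and \<Lambda>: "\<forall>\<kappa>\<in>\<A>. \<forall>p\<in>fst \<kappa>. principal_curvatures c \<kappa> f \<eta> p = \<Lambda>"
    and T: "T_principal_direction c \<A> f \<eta>" and \<nu>: "\<forall>p\<in>carrier_of \<A>. angle_fun c \<eta> p \<noteq> 0"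
  shows "\<exists>lam. constant_curvature_chart c (chart_image \<kappa>) (f \<circ> chart_inv \<kappa>) (\<eta> \<circ> chart_inv \<kappa>) \<Lambda> lam \<and>
    (\<forall>u\<in>chart_image \<kappa>. immersed_chart.nu (\<eta> \<circ> chart_inv \<kappa>) u = angle_fun c \<eta> (chart_inv \<kappa> u)) \<and>
    (\<forall>u\<in>chart_image \<kappa>. \<forall>v. immersed_chart.sh c (f \<circ> chart_inv \<kappa>) (\<eta> \<circ> chart_inv \<kappa>) u v
      = shape_operator c \<kappa> f \<eta> (chart_inv \<kappa> u) v) \<and>
    (\<forall>u\<in>chart_image \<kappa>. immersed_chart.T (f \<circ> chart_inv \<kappa>) (\<eta> \<circ> chart_inv \<kappa>) u
      = T_field c \<kappa> f \<eta> (chart_inv \<kappa> u))"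
proof -
  have \<A>: "smooth_atlas \<A>" using hyp by (simp add: hypersurface_def)
  note K = chart_facts[OF \<A> \<kappa>]
  interpret immersed_chart c "chart_image \<kappa>" "f \<circ> chart_inv \<kappa>" "\<eta> \<circ> chart_inv \<kappa>"
    by (rule immersed_chart_hypersurface[OF c hyp \<kappa>])
  have nu: "nu u = angle_fun c \<eta> (chart_inv \<kappa> u)" for u
    by (simp add: nu_def angle_fun_def ip2_dt)
  have sh: "sh u v = shape_operator c \<kappa> f \<eta> (chart_inv \<kappa> u) v" if "u \<in> chart_image \<kappa>" for u v
    unfolding sh_def shape_operator_def mdiff_def K(7)[OF that] by simp
  have T: "T u = T_field c \<kappa> f \<eta> (chart_inv \<kappa> u)" if "u \<in> chart_image \<kappa>" for u
    unfolding T_def T_field_def mdiff_def K(7)[OF that] nu by simp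
  define lam where "lam u = (SOME \<mu>. sh u (T u) = \<mu> *\<^sub>R T u)" for u
  have "constant_curvature_chart c (chart_image \<kappa>) (f \<circ> chart_inv \<kappa>) (\<eta> \<circ> chart_inv \<kappa>) \<Lambda> lam"
  proof
    fix u assume u: "u \<in> chart_image \<kappa>"
    note k = K(6)[OF u]
    show "nu u \<noteq> 0" unfolding nu using \<nu> k \<kappa> by (auto simp: carrier_of_def)
    show "T u \<noteq> 0" unfolding T[OF u] using assms(5) \<kappa> k by (auto simp: T_principal_direction_def)
    have "\<exists>\<mu>. sh u (T u) = \<mu> *\<^sub>R T u"
      unfolding T[OF u] sh[OF u] using assms(5) \<kappa> k by (auto simp: T_principal_direction_def)
    then show "sh u (T u) = lam u *\<^sub>R T u" unfolding lam_def by (rule someI_ex)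
    show "{\<mu>. \<exists>v. v \<noteq> 0 \<and> sh u v = \<mu> *\<^sub>R v} = \<Lambda>"
      unfolding sh[OF u] using \<Lambda> \<kappa> k by (auto simp: principal_curvatures_def)
  qed
  then show ?thesis using nu sh T by blast
qed

theorem theorem6p2:
  fixes c :: real
    and \<A> :: "('m::{t2_space, second_countable_topology}, real ^ 'n::finite) chart set"
    and g :: "('m, real ^ 'n) chart \<Rightarrow> 'm \<Rightarrow> real ^ 'n \<Rightarrow> real ^ 'n \<Rightarrow> real"
    and f \<eta> :: "'m \<Rightarrow> 'n flat2"
  assumes c: "c \<in> {1, -1}"
    and n: "CARD('n) \<ge> 2"
    and k: "CARD('n) = CARD('k::finite) + 1"
    and hyp: "hypersurface c \<A> g f \<eta>"
    and const: "constant_principal_curvatures c \<A> f \<eta>"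
    and T: "T_principal_direction c \<A> f \<eta>"
    and \<nu>: "\<forall>p\<in>carrier_of \<A>. angle_fun c \<eta> p \<noteq> 0"
  shows "c = -1 \<and>
    (\<exists>B>0.
       (\<forall>p\<in>carrier_of \<A>.
          \<exists>(V :: (real ^ 'k) set) I h N \<psi>.
            open I \<and> is_interval I \<and> parallel_horospheres V I h N \<and>
            diffeo_onto_open \<A> (V \<times> I) \<psi> \<and> p \<in> \<psi> ` (V \<times> I) \<and>
            (\<forall>x\<in>V. \<forall>s\<in>I. f (\<psi> (x, s)) = (parallel h N s x, 0) + (B * s) *\<^sub>R dt)) \<and>
       (\<forall>\<kappa>\<in>\<A>. \<forall>p\<in>fst \<kappa>. shape_operator c \<kappa> f \<eta> p (T_field c \<kappa> f \<eta> p) = 0) \<and>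
       (\<exists>\<mu>. (\<mu> = B / sqrt (1 + B\<^sup>2) \<or> \<mu> = - (B / sqrt (1 + B\<^sup>2))) \<and>
          (\<forall>\<kappa>\<in>\<A>. \<forall>p\<in>fst \<kappa>. principal_multiplicity c \<kappa> f \<eta> p \<mu> = CARD('n) - 1)))"
proof -
  have \<A>: "smooth_atlas \<A>" and car: "carrier_of \<A> \<noteq> {}" "connected (carrier_of \<A>)"
    using hyp by (auto simp: hypersurface_def)
  obtain \<Lambda> where \<Lambda>: "\<forall>\<kappa>\<in>\<A>. \<forall>p\<in>fst \<kappa>. principal_curvatures c \<kappa> f \<eta> p = \<Lambda>"
    using const by (auto simp: constant_principal_curvatures_def)
  note charts = constant_curvature_chart_hypersurface[OF c hyp _ \<Lambda> T \<nu>]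
  obtain p0 \<kappa>0 where \<kappa>0: "\<kappa>0 \<in> \<A>" "p0 \<in> fst \<kappa>0" using car(1) by (auto simp: carrier_of_def)
  \<comment> \<open>One finite set serves all charts, so the constancy argument can run on the whole
    connected carrier and yields a single \<open>n0\<close> rather than one per chart.\<close>
  define Q where "Q = (\<lambda>(\<mu>, \<kappa>). 1 + c * (\<mu>\<^sup>2 - \<kappa> * \<mu>)) ` (\<Lambda> \<times> \<Lambda>)"
  have "finite \<Lambda>"
  proof -
    obtain lam where "constant_curvature_chart c (chart_image \<kappa>0) (f \<circ> chart_inv \<kappa>0) (\<eta> \<circ> chart_inv \<kappa>0) \<Lambda> lam"
      using charts[OF \<kappa>0(1)] by blast
    then show ?thesis
      using constant_curvature_chart.finite_\<Lambda> chart_facts(4)[OF \<A> \<kappa>0] by blast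
  qed
  then have "finite Q" by (simp add: Q_def)
  have ang: "(angle_fun c \<eta> p)\<^sup>2 \<in> Q" if p: "p \<in> carrier_of \<A>" for p
  proof -
    obtain \<kappa> where \<kappa>: "\<kappa> \<in> \<A>" "p \<in> fst \<kappa>" using p by (auto simp: carrier_of_def)
    note u = chart_facts(4,5)[OF \<A> \<kappa>]
    obtain lam where C: "constant_curvature_chart c (chart_image \<kappa>) (f \<circ> chart_inv \<kappa>) (\<eta> \<circ> chart_inv \<kappa>) \<Lambda> lam"
      and nu: "\<And>u. u \<in> chart_image \<kappa> \<Longrightarrow> immersed_chart.nu (\<eta> \<circ> chart_inv \<kappa>) u = angle_fun c \<eta> (chart_inv \<kappa> u)"
      using charts[OF \<kappa>(1)] by blast
    show ?thesis
      using constant_curvature_chart.nu_square_range[OF C u(1) n] unfolding nu[OF u(1)] u(2) Q_def .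
  qed
  have "finite {x::real. x\<^sup>2 \<in> Q}"
  proof (rule finite_subset)
    show "{x::real. x\<^sup>2 \<in> Q} \<subseteq> (\<lambda>q. sqrt q) ` Q \<union> (\<lambda>q. - sqrt q) ` Q"
    proof
      fix x :: real assume x: "x \<in> {x. x\<^sup>2 \<in> Q}"
      have "x = sqrt (x\<^sup>2) \<or> x = - sqrt (x\<^sup>2)" by (simp add: real_sqrt_abs abs_if)
      then show "x \<in> (\<lambda>q. sqrt q) ` Q \<union> (\<lambda>q. - sqrt q) ` Q" using x by blast
    qed
  qed (use \<open>finite Q\<close> in simp)
  then have fin: "finite (angle_fun c \<eta> ` carrier_of \<A>)"
    by (rule finite_subset[rotated]) (use ang in auto)
  have "continuous_on (carrier_of \<A>) (angle_fun c \<eta>)"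
    unfolding carrier_of_def
  proof (rule continuous_on_open_UN)
    fix \<kappa> assume \<kappa>: "\<kappa> \<in> \<A>"
    note K = chart_facts[OF \<A> \<kappa>]
    show "open (fst \<kappa>)" by (rule K(1))
    have 1: "continuous_on (chart_image \<kappa>) (\<eta> \<circ> chart_inv \<kappa>)"
      using hyp \<kappa> by (intro smooth_on_continuous_on) (auto simp: hypersurface_def smooth_map_def)
    have 2: "continuous_on (fst \<kappa>) (snd \<kappa>)" "snd \<kappa> ` fst \<kappa> \<subseteq> chart_image \<kappa>"
      using K(3) by (auto simp: homeomorphism_def)
    have "continuous_on (fst \<kappa>) (\<lambda>p. (\<eta> \<circ> chart_inv \<kappa>) (snd \<kappa> p))"
      by (rule continuous_on_compose2[OF 1 2])
    then have "continuous_on (fst \<kappa>) (\<lambda>p. snd ((\<eta> \<circ> chart_inv \<kappa>) (snd \<kappa> p)))"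
      by (rule continuous_on_snd)
    then show "continuous_on (fst \<kappa>) (angle_fun c \<eta>)"
      by (rule continuous_on_eq) (simp add: K(5) angle_fun_def ip2_dt)
  qed
  from continuous_finite_range_constant[OF car(2) this fin]
  obtain n0 where n0: "\<And>p. p \<in> carrier_of \<A> \<Longrightarrow> angle_fun c \<eta> p = n0"
    by (auto simp: constant_on_def)
  have charts': "\<exists>lam. constant_curvature_chart c (chart_image \<kappa>) (f \<circ> chart_inv \<kappa>) (\<eta> \<circ> chart_inv \<kappa>) \<Lambda> lam \<and>
      (\<forall>u\<in>chart_image \<kappa>. immersed_chart.nu (\<eta> \<circ> chart_inv \<kappa>) u = n0) \<and>
      (\<forall>u\<in>chart_image \<kappa>. \<forall>v. immersed_chart.sh c (f \<circ> chart_inv \<kappa>) (\<eta> \<circ> chart_inv \<kappa>) u v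
        = shape_operator c \<kappa> f \<eta> (chart_inv \<kappa> u) v) \<and>
      (\<forall>u\<in>chart_image \<kappa>. immersed_chart.T (f \<circ> chart_inv \<kappa>) (\<eta> \<circ> chart_inv \<kappa>) u
        = T_field c \<kappa> f \<eta> (chart_inv \<kappa> u))" if \<kappa>: "\<kappa> \<in> \<A>" for \<kappa>
  proof -
    have "chart_inv \<kappa> u \<in> carrier_of \<A>" if "u \<in> chart_image \<kappa>" for u
      using chart_facts(6)[OF \<A> \<kappa> that] \<kappa> by (auto simp: carrier_of_def)
    then have "\<forall>u\<in>chart_image \<kappa>. angle_fun c \<eta> (chart_inv \<kappa> u) = n0" using n0 by blast
    then show ?thesis using charts[OF \<kappa>] by simp
  qed
  obtain lam0 where C0: "constant_curvature_chart c (chart_image \<kappa>0) (f \<circ> chart_inv \<kappa>0) (\<eta> \<circ> chart_inv \<kappa>0) \<Lambda> lam0"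
    and nu0: "\<And>u. u \<in> chart_image \<kappa>0 \<Longrightarrow> immersed_chart.nu (\<eta> \<circ> chart_inv \<kappa>0) u = n0"
    using charts'[OF \<kappa>0(1)] by blast
  define u0 where "u0 = snd \<kappa>0 p0"
  have u0: "u0 \<in> chart_image \<kappa>0" unfolding u0_def by (rule chart_facts(4)[OF \<A> \<kappa>0])
  interpret C0: constant_curvature_chart c "chart_image \<kappa>0" "f \<circ> chart_inv \<kappa>0" "\<eta> \<circ> chart_inv \<kappa>0" \<Lambda> lam0
    by (rule C0)
  have c1: "c = -1" by (rule C0.hyperbolic[OF n u0 nu0])
  obtain x \<mu> where x: "x \<noteq> 0" "C0.sh u0 x = \<mu> *\<^sub>R x" "C0.gg u0 x (C0.T u0) = 0"
    using C0.exists_orthogonal_eigenvector[OF u0 n] by blast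
  have \<mu>: "\<mu>\<^sup>2 = 1 - n0\<^sup>2" by (rule C0.orthogonal_eigenvalue_square[OF n u0 nu0 x])
  have n0_bound: "n0 \<noteq> 0" "n0\<^sup>2 < 1" using C0.nu_nonzero[OF u0] C0.nu_bound[OF u0] nu0[OF u0] by auto
  have \<mu>0: "\<mu> \<noteq> 0" using \<mu> n0_bound by auto
  \<comment> \<open>\<open>\<Lambda>\<close> is common to all charts, so excluding
    \<open>- \<mu>\<close> at one point fixes the sign of the curvature on the whole
    manifold.\<close>
  have m\<mu>: "- \<mu> \<notin> \<Lambda>"
    by (rule C0.opposite_not_in_spectrum[OF n u0 nu0 C0.orthogonal_eigenvalue(1)[OF u0 x] \<mu>0])
  define B where "B = \<bar>\<mu>\<bar> / \<bar>n0\<bar>"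
  have B: "B > 0" using \<mu>0 n0_bound by (simp add: B_def)
  \<comment> \<open>This is \<open>\<mu>\<^sup>2 + n0\<^sup>2 = 1\<close> divided by
    \<open>n0\<^sup>2\<close>; it turns the absolute value of \<open>\<mu>\<close> into the asserted
    expression in \<open>B\<close>.\<close>
  have "1 + B\<^sup>2 = (1 / \<bar>n0\<bar>)\<^sup>2"
    using n0_bound \<mu> by (simp add: B_def power_divide field_simps)
  then have "sqrt (1 + B\<^sup>2) = 1 / \<bar>n0\<bar>" by simp
  then have "B / sqrt (1 + B\<^sup>2) = \<bar>\<mu>\<bar>" using n0_bound by (simp add: B_def)
  then have \<mu>B: "\<mu> = B / sqrt (1 + B\<^sup>2) \<or> \<mu> = - (B / sqrt (1 + B\<^sup>2))" by auto
  have loc: "\<exists>(V :: (real ^ 'k) set) I h N \<psi>.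
            open I \<and> is_interval I \<and> parallel_horospheres V I h N \<and>
            diffeo_onto_open \<A> (V \<times> I) \<psi> \<and> p \<in> \<psi> ` (V \<times> I) \<and>
            (\<forall>x\<in>V. \<forall>s\<in>I. f (\<psi> (x, s)) = (parallel h N s x, 0) + (B * s) *\<^sub>R dt)"
    if p: "p \<in> carrier_of \<A>" for p
  proof -
    obtain \<kappa> where \<kappa>: "\<kappa> \<in> \<A>" "p \<in> fst \<kappa>" using p by (auto simp: carrier_of_def)
    note K = chart_facts[OF \<A> \<kappa>(1)]
    obtain lam where C: "constant_curvature_chart c (chart_image \<kappa>) (f \<circ> chart_inv \<kappa>) (\<eta> \<circ> chart_inv \<kappa>) \<Lambda> lam"
      and nu: "\<forall>u\<in>chart_image \<kappa>. immersed_chart.nu (\<eta> \<circ> chart_inv \<kappa>) u = n0"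
      using charts'[OF \<kappa>(1)] by blast
    have sf: "\<forall>u\<in>chart_image \<kappa>. fst ((f \<circ> chart_inv \<kappa>) u) \<in> space_form (-1)"
    proof
      fix u assume u: "u \<in> chart_image \<kappa>"
      have "chart_inv \<kappa> u \<in> carrier_of \<A>" using K(6)[OF u] \<kappa>(1) by (auto simp: carrier_of_def)
      then have "f (chart_inv \<kappa> u) \<in> space_form c \<times> UNIV"
        using hyp by (auto simp: hypersurface_def)
      then show "fst ((f \<circ> chart_inv \<kappa>) u) \<in> space_form (-1)" using c1 by (auto simp: mem_Times_iff)
    qed
    note local_form = constant_curvature_chart.local_horosphere_form[OF C k n K(4)[OF \<kappa>(2)] nu \<mu> m\<mu> sf,
        folded B_def]
    obtain V :: "(real ^ 'k) set" and I h N U' V' G H where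
      full: "open V \<and> open I \<and> is_interval I \<and> parallel_horospheres V I h N \<and>
        open U' \<and> U' \<subseteq> chart_image \<kappa> \<and> snd \<kappa> p \<in> U' \<and> open V' \<and> V \<times> I \<subseteq> V' \<and> G (snd \<kappa> p) \<in> V \<times> I \<and>
        homeomorphism U' V' G H \<and> smooth_on U' G \<and> smooth_on V' H \<and>
        (\<forall>x\<in>V. \<forall>s\<in>I. (f \<circ> chart_inv \<kappa>) (H (x, s)) = (parallel h N s x, 0) + (B * s) *\<^sub>R dt)"
      using local_form by (elim exE) (rule that)
    then have *: "open V" "open I" "is_interval I" "parallel_horospheres V I h N"
      "open U'" "U' \<subseteq> chart_image \<kappa>" "snd \<kappa> p \<in> U'" "open V'" "V \<times> I \<subseteq> V'" "G (snd \<kappa> p) \<in> V \<times> I"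
      "homeomorphism U' V' G H" "smooth_on U' G" "smooth_on V' H"
      by (simp_all only: simp_thms)
    have fH: "\<forall>x\<in>V. \<forall>s\<in>I. (f \<circ> chart_inv \<kappa>) (H (x, s)) = (parallel h N s x, 0) + (B * s) *\<^sub>R dt"
      using full by (elim conjE)
    have "diffeo_onto_open \<A> (V \<times> I) (chart_inv \<kappa> \<circ> H)"
      by (rule diffeo_from_chart[OF \<A> \<kappa>(1) *(5,6,8,11-13) open_Times[OF *(1,2)] *(9)])
    moreover have "p \<in> (chart_inv \<kappa> \<circ> H) ` (V \<times> I)"
    proof (rule image_eqI[OF _ *(10)])
      have "H (G (snd \<kappa> p)) = snd \<kappa> p" using *(7,11) by (auto simp: homeomorphism_def)
      then show "p = (chart_inv \<kappa> \<circ> H) (G (snd \<kappa> p))" using K(5)[OF \<kappa>(2)] by simp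
    qed
    moreover have "\<forall>x\<in>V. \<forall>s\<in>I. f ((chart_inv \<kappa> \<circ> H) (x, s)) = (parallel h N s x, 0) + (B * s) *\<^sub>R dt"
      using fH by simp
    ultimately show ?thesis
      using *(2-4)
      by (intro exI[of _ V] exI[of _ I] exI[of _ h] exI[of _ N] exI[of _ "chart_inv \<kappa> \<circ> H"] conjI)
  qed
  have ptw: "shape_operator c \<kappa> f \<eta> p (T_field c \<kappa> f \<eta> p) = 0 \<and>
      principal_multiplicity c \<kappa> f \<eta> p \<mu> = CARD('n) - 1" if \<kappa>: "\<kappa> \<in> \<A>" "p \<in> fst \<kappa>" for \<kappa> p
  proof -
    note u = chart_facts(4,5)[OF \<A> \<kappa>]
    obtain lam where C: "constant_curvature_chart c (chart_image \<kappa>) (f \<circ> chart_inv \<kappa>) (\<eta> \<circ> chart_inv \<kappa>) \<Lambda> lam"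
      and nu: "\<And>u. u \<in> chart_image \<kappa> \<Longrightarrow> immersed_chart.nu (\<eta> \<circ> chart_inv \<kappa>) u = n0"
      and sh: "\<And>v. immersed_chart.sh c (f \<circ> chart_inv \<kappa>) (\<eta> \<circ> chart_inv \<kappa>) (snd \<kappa> p) v
        = shape_operator c \<kappa> f \<eta> p v"
      and TT: "immersed_chart.T (f \<circ> chart_inv \<kappa>) (\<eta> \<circ> chart_inv \<kappa>) (snd \<kappa> p) = T_field c \<kappa> f \<eta> p"
      using charts'[OF \<kappa>(1)] u by metis
    show ?thesis
      using constant_curvature_chart.sh_T[OF C u(1)] constant_curvature_chart.lam_eq_0[OF C u(1) nu]
        constant_curvature_chart.dim_eigenspace[OF C n u(1) nu \<mu> m\<mu>]
      by (simp add: sh TT principal_multiplicity_def)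
  qed
  show ?thesis
    by (rule conjI[OF c1], rule exI[of _ B], intro conjI exI[of _ \<mu>] ballI B \<mu>B loc)
      (use ptw in blast)+
qed

end
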